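(* For the noncommutative $2n$-torus $\mathcal{A}_\Theta$ with $n>1$, there are $\mathcal{A}_\Theta$-bimodule isomorphisms (1) $\Omega^{0,0}_{\partial,\overline\partial}(\mathcal{A}_\Theta)\cong\mathcal{A}_\Theta$; (2) $\Omega^{1,0}_{\partial,\overline\partial}(\mathcal{A}_\Theta)\cong\mathcal{A}_\Theta^{n}$; (3) $\Omega^{0,1}_{\partial,\overline\partial}(\mathcal{A}_\Theta)\cong\mathcal{A}_\Theta^{n}$; (4) $\Omega^{2,0}_{\partial,\overline\partial}(\mathcal{A}_\Theta)\cong\mathcal{A}_\Theta^{n(n-1)/2}$; (5) $\Omega^{0,2}_{\partial,\overline\partial}(\mathcal{A}_\Theta)\cong\mathcal{A}_\Theta^{n(n-1)/2}$; (6) under these identifications, the product map $\Omega^{0,1}_{\partial,\overline\partial}(\mathcal{A}_\Theta)\times\Omega^{0,1}_{\partial,\overline\partial}(\mathcal{A}_\Theta)\to\Omega^{0,2}_{\partial,\overline\partial}(\mathcal{A}_\Theta)$ is given by $(a_1,\dots,a_n)\cdot(b_1,\dots,b_n)\mapsto\big((a_pb_q-a_qb_p)_{1\le p<q\le n}\big)$ (for a suitable choice of the isomorphisms).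
   Context: **Noncommutative $2n$-torus.** Let $A$ be the universal $C^*$-algebra generated by unitaries $U_1,\dots,U_{2n}$ with $U_jU_\ell=\exp(2\pi i\Theta_{\ell j})U_\ell U_j$, where $\Theta$ is a real skew-symmetric $2n\times 2n$ matrix such that the lattice $\Lambda_\Theta$ generated by its columns makes $\Lambda_\Theta+\mathbb{Z}^{2n}$ dense in $\mathbb{R}^{2n}$. $\mathbb{T}^{2n}$ acts by $\alpha_{\mathbf z}(U_\ell)=z_\ell U_\ell$ and $\mathcal{A}_\Theta$ is the smooth subalgebra $\{\sum\alpha_{(j_1,\dots,j_{2n})}U_1^{j_1}\cdots U_{2n}^{j_{2n}}:\alpha\in\mathbb{S}(\mathbb{Z}^{2n})\}$ (Schwartz coefficients). $\partial_j$ is the derivation $\partial_j(U_\ell)=i\delta_{j\ell}U_\ell$; $\tau(\sum\alpha_mU^m)=\alpha_{\mathbf 0}$. **Complex structure used.** Let $N=2^n$ and $\gamma_1,\dots,\gamma_{2n},\sigma\in M_N(\mathbb{C})$ with $\gamma_j^*=-\gamma_j$, $\gamma_j\gamma_l+\gamma_l\gamma_j=-2\delta_{jl}$ (irreducible Clifford representation), $\sigma=\sigma^*$, $\sigma^2=1$, $\sigma\gamma_j=-\gamma_j\sigma$; $\varepsilon'\in\{\pm1\}$ is a fixed sign. On $L^2(\mathcal{A}_\Theta,\tau)\otimes\mathbb{C}^N\otimes\mathbb{C}^N$ (with $\mathcal{A}_\Theta$ acting by left multiplication on the first factor) put $d=\frac12\sum_{j=1}^{2n}(\partial_j\otimes1\otimes\gamma_j+i\varepsilon'\partial_j\otimes\gamma_j\otimes\sigma)$,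 $d_2=\frac12\sum_{j\text{ odd}}\big(\partial_j\otimes1\otimes\gamma_{j+1}-\partial_{j+1}\otimes1\otimes\gamma_j+i\varepsilon'(\partial_j\otimes\gamma_{j+1}\otimes\sigma-\partial_{j+1}\otimes\gamma_j\otimes\sigma)\big)$ (sum over odd $j\le 2n-1$), $\partial=\frac12(d-id_2)$, $\overline\partial=\frac12(d+id_2)$. **Forms** (spans of bounded operators, $a,b,c\in\mathcal{A}_\Theta$; bimodule structure by operator multiplication): $\Omega^{0,0}_{\partial,\overline\partial}(\mathcal{A}_\Theta)=\mathcal{A}_\Theta$ acting as operators; $\Omega^{1,0}_{\partial,\overline\partial}=\mathrm{span}\{a[\partial,b]\}$, $\Omega^{0,1}_{\partial,\overline\partial}=\mathrm{span}\{a[\overline\partial,b]\}$, $\Omega^{2,0}_{\partial,\overline\partial}=\mathrm{span}\{a[\partial,b][\partial,c]\}$, $\Omega^{0,2}_{\partial,\overline\partial}=\mathrm{span}\{a[\overline\partial,b][\overline\partial,c]\}$. *)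

theory Defs
  imports "HOL-Analysis.Analysis"
begin

section \<open>Complex Banach spaces, Hilbert spaces and unital C*-algebras\<close>

class complex_vector = real_vector +
  fixes scaleC :: "complex \<Rightarrow> 'a \<Rightarrow> 'a"  (infixr "*\<^sub>C" 75)
  assumes scaleC_add_right: "c *\<^sub>C (x + y) = c *\<^sub>C x + c *\<^sub>C y"
    and scaleC_add_left: "(c + d) *\<^sub>C x = c *\<^sub>C x + d *\<^sub>C x"
    and scaleC_scaleC: "c *\<^sub>C (d *\<^sub>C x) = (c * d) *\<^sub>C x"
    and scaleR_scaleC: "r *\<^sub>R x = complex_of_real r *\<^sub>C x"

class complex_banach = complex_vector + banach +
  assumes norm_scaleC: "norm (c *\<^sub>C x) = cmod c * norm x"

class complex_hilbert = complex_banach +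
  fixes cinner :: "'a \<Rightarrow> 'a \<Rightarrow> complex"  \<comment> \<open>conjugate linear in the first argument\<close>
  assumes cinner_commute: "cinner x y = cnj (cinner y x)"
    and cinner_add_right: "cinner x (y + z) = cinner x y + cinner x z"
    and cinner_scaleC_right: "cinner x (c *\<^sub>C y) = c * cinner x y"
    and norm_eq_sqrt_cinner: "norm x = sqrt (Re (cinner x x))"

class cstar_algebra = complex_banach + real_normed_algebra_1 +
  fixes star :: "'a \<Rightarrow> 'a"
  assumes scaleC_mult_left: "(c *\<^sub>C x) * y = c *\<^sub>C (x * y)"
    and scaleC_mult_right: "x * (c *\<^sub>C y) = c *\<^sub>C (x * y)"
    and star_star: "star (star x) = x"
    and star_add: "star (x + y) = star x + star y"
    and star_mult: "star (x * y) = star y * star x"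
    and star_scaleC: "star (c *\<^sub>C x) = cnj c *\<^sub>C star x"
    and norm_star_mult: "norm (star x * x) = (norm x)\<^sup>2"

instantiation vec :: (complex_vector, finite) complex_vector
begin
definition scaleC_vec :: "complex \<Rightarrow> 'a ^ 'b \<Rightarrow> 'a ^ 'b" where
  "scaleC_vec c x = (\<chi> i. c *\<^sub>C (x $ i))"
instance
  by standard
    (simp_all add: scaleC_vec_def vec_eq_iff scaleC_add_right scaleC_add_left
      scaleC_scaleC scaleR_scaleC)
end

definition star_hom :: "('a::cstar_algebra \<Rightarrow> 'b::cstar_algebra) \<Rightarrow> bool" where
  "star_hom f \<longleftrightarrow>
     f 1 = 1 \<and> (\<forall>x y. f (x + y) = f x + f y) \<and> (\<forall>x y. f (x * y) = f x * f y) \<and>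
     (\<forall>c x. f (c *\<^sub>C x) = c *\<^sub>C f x) \<and> (\<forall>x. f (star x) = star (f x))"

definition cstar_subalgebra :: "'a::cstar_algebra set \<Rightarrow> bool" where
  "cstar_subalgebra B \<longleftrightarrow>
     closed B \<and> 1 \<in> B \<and> (\<forall>x\<in>B. \<forall>y\<in>B. x + y \<in> B \<and> x * y \<in> B) \<and>
     (\<forall>x\<in>B. star x \<in> B \<and> (\<forall>c. c *\<^sub>C x \<in> B))"

definition cstar_generated :: "'a::cstar_algebra set \<Rightarrow> 'a set" where
  "cstar_generated S = \<Inter>{B. cstar_subalgebra B \<and> S \<subseteq> B}"

definition is_unitary :: "'a::cstar_algebra \<Rightarrow> bool" where
  "is_unitary u \<longleftrightarrow> star u * u = 1 \<and> u * star u = 1"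


section \<open>The noncommutative torus\<close>

definition skew_symmetric :: "nat \<Rightarrow> (nat \<Rightarrow> nat \<Rightarrow> real) \<Rightarrow> bool" where
  "skew_symmetric n \<Theta> \<longleftrightarrow> (\<forall>i\<in>{1..2*n}. \<forall>j\<in>{1..2*n}. \<Theta> i j = - \<Theta> j i)"

text \<open>Density in \<open>\<real>\<^sup>2\<^sup>n\<close> of the sum of the integer lattice and the lattice generated by the columns
  \<open>(\<Theta> i j)\<^sub>i\<close>, expressed in the maximum norm.\<close>

definition dense_lattice :: "nat \<Rightarrow> (nat \<Rightarrow> nat \<Rightarrow> real) \<Rightarrow> bool" where
  "dense_lattice n \<Theta> \<longleftrightarrow>
     (\<forall>(x::nat \<Rightarrow> real) e. e > 0 \<longrightarrow>
        (\<exists>(k::nat \<Rightarrow> int) (m::nat \<Rightarrow> int). \<forall>i\<in>{1..2*n}.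
           \<bar>x i - ((\<Sum>j\<in>{1..2*n}. of_int (k j) * \<Theta> i j) + of_int (m i))\<bar> < e))"

definition torus_relations ::
  "nat \<Rightarrow> (nat \<Rightarrow> nat \<Rightarrow> real) \<Rightarrow> (nat \<Rightarrow> 'a::cstar_algebra) \<Rightarrow> bool" where
  "torus_relations n \<Theta> U \<longleftrightarrow>
     (\<forall>j\<in>{1..2*n}. is_unitary (U j)) \<and>
     (\<forall>j\<in>{1..2*n}. \<forall>l\<in>{1..2*n}.
        U j * U l = exp (2 * of_real pi * \<i> * of_real (\<Theta> l j)) *\<^sub>C (U l * U j))"

text \<open>The C*-algebra \<open>'a\<close> is generated by the \<open>U j\<close>, which satisfy the torus relations, and it is
  universal for these relations. A HOL formula cannot quantify over types, so the targets of the
  universal property range over the C*-algebras carried by one given type \<open>'b\<close>; the full universal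
  property is this predicate for all \<open>'b\<close>. A theorem that assumes it for a single, arbitrary \<open>'b\<close>
  thus covers the universal C*-algebra.\<close>

definition universal_torus ::
  "'b::cstar_algebra itself \<Rightarrow> nat \<Rightarrow> (nat \<Rightarrow> nat \<Rightarrow> real) \<Rightarrow> (nat \<Rightarrow> 'a::cstar_algebra) \<Rightarrow> bool" where
  "universal_torus T n \<Theta> U \<longleftrightarrow>
     torus_relations n \<Theta> U \<and>
     cstar_generated (U ` {1..2*n}) = UNIV \<and>
     (\<forall>V :: nat \<Rightarrow> 'b. torus_relations n \<Theta> V \<longrightarrow>
        (\<exists>!f :: 'a \<Rightarrow> 'b. star_hom f \<and> (\<forall>j\<in>{1..2*n}. f (U j) = V j)))"

definition unitary_power :: "'a::cstar_algebra \<Rightarrow> int \<Rightarrow> 'a" where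
  "unitary_power u k = (if k \<ge> 0 then u ^ nat k else star u ^ nat (- k))"

text \<open>\<open>\<int>\<^sup>2\<^sup>n\<close> is represented by the integer functions vanishing outside \<open>{1..2*n}\<close>.\<close>

definition int_vectors :: "nat \<Rightarrow> (nat \<Rightarrow> int) set" where
  "int_vectors n = {m. \<forall>i. i \<notin> {1..2*n} \<longrightarrow> m i = 0}"

definition monomial :: "nat \<Rightarrow> (nat \<Rightarrow> 'a::cstar_algebra) \<Rightarrow> (nat \<Rightarrow> int) \<Rightarrow> 'a" where
  "monomial n U m = prod_list (map (\<lambda>j. unitary_power (U j) (m j)) [1..<2*n+1])"

definition schwartz :: "nat \<Rightarrow> ((nat \<Rightarrow> int) \<Rightarrow> complex) \<Rightarrow> bool" where
  "schwartz n \<alpha> \<longleftrightarrow>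
     (\<forall>m. m \<notin> int_vectors n \<longrightarrow> \<alpha> m = 0) \<and>
     (\<forall>k::nat. \<exists>C::real. \<forall>m\<in>int_vectors n.
        (1 + (\<Sum>i\<in>{1..2*n}. (of_int (m i))\<^sup>2)) ^ k * (cmod (\<alpha> m))\<^sup>2 \<le> C)"

definition fourier_expansion ::
  "nat \<Rightarrow> (nat \<Rightarrow> 'a::cstar_algebra) \<Rightarrow> 'a \<Rightarrow> ((nat \<Rightarrow> int) \<Rightarrow> complex) \<Rightarrow> bool" where
  "fourier_expansion n U a \<alpha> \<longleftrightarrow>
     schwartz n \<alpha> \<and> ((\<lambda>m. \<alpha> m *\<^sub>C monomial n U m) has_sum a) (int_vectors n)"

definition smooth_torus :: "nat \<Rightarrow> (nat \<Rightarrow> 'a::cstar_algebra) \<Rightarrow> 'a set" where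
  "smooth_torus n U = {a. \<exists>\<alpha>. fourier_expansion n U a \<alpha>}"

definition fourier_coeff ::
  "nat \<Rightarrow> (nat \<Rightarrow> 'a::cstar_algebra) \<Rightarrow> 'a \<Rightarrow> (nat \<Rightarrow> int) \<Rightarrow> complex" where
  "fourier_coeff n U a = (THE \<alpha>. fourier_expansion n U a \<alpha>)"

text \<open>The derivation with \<open>U l \<mapsto> \<i> \<delta>\<^sub>j\<^sub>l U l\<close>: by the Leibniz rule it maps
  \<open>U\<^sup>m\<close> to \<open>\<i> m\<^sub>j U\<^sup>m\<close>, and it is extended termwise to Schwartz series.\<close>

definition torus_deriv :: "nat \<Rightarrow> (nat \<Rightarrow> 'a::cstar_algebra) \<Rightarrow> nat \<Rightarrow> 'a \<Rightarrow> 'a" where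
  "torus_deriv n U j a =
     infsum (\<lambda>m. (\<i> * of_int (m j) * fourier_coeff n U a m) *\<^sub>C monomial n U m) (int_vectors n)"

definition torus_trace :: "nat \<Rightarrow> (nat \<Rightarrow> 'a::cstar_algebra) \<Rightarrow> 'a \<Rightarrow> complex" where
  "torus_trace n U a = fourier_coeff n U a (\<lambda>_. 0)"


section \<open>The Hilbert space and the operators\<close>

text \<open>\<open>'h\<close>, with the canonical map \<open>\<eta>\<close> (used on the smooth algebra only), is the Hilbert space
  completion of the smooth algebra for the inner product \<open>(a, b) \<mapsto> \<tau> (a\<^sup>* b)\<close>.\<close>

definition is_L2 ::
  "nat \<Rightarrow> (nat \<Rightarrow> 'a::cstar_algebra) \<Rightarrow> ('a \<Rightarrow> 'h::complex_hilbert) \<Rightarrow> bool" where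
  "is_L2 n U \<eta> \<longleftrightarrow>
     (\<forall>a\<in>smooth_torus n U. \<forall>b\<in>smooth_torus n U. \<eta> (a + b) = \<eta> a + \<eta> b) \<and>
     (\<forall>c. \<forall>a\<in>smooth_torus n U. \<eta> (c *\<^sub>C a) = c *\<^sub>C \<eta> a) \<and>
     (\<forall>a\<in>smooth_torus n U. \<forall>b\<in>smooth_torus n U.
        cinner (\<eta> a) (\<eta> b) = torus_trace n U (star a * b)) \<and>
     closure (\<eta> ` smooth_torus n U) = UNIV"

text \<open>The bounded operator agreeing with \<open>f\<close> on the dense subspace \<open>D\<close>.\<close>

definition bounded_extension ::
  "'x::real_normed_vector set \<Rightarrow> ('x \<Rightarrow> 'x) \<Rightarrow> 'x \<Rightarrow> 'x" where
  "bounded_extension D f = (THE T. bounded_linear T \<and> (\<forall>v\<in>D. T v = f v))"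

text \<open>The two operators below are given on the dense subspace \<open>\<eta> ` smooth_torus n U\<close>, where
  \<open>\<eta>\<close> is invertible; the first is extended to \<open>'h\<close>, the second is unbounded with that domain.\<close>

definition left_mult ::
  "nat \<Rightarrow> (nat \<Rightarrow> 'a::cstar_algebra) \<Rightarrow> ('a \<Rightarrow> 'h::complex_hilbert) \<Rightarrow> 'a \<Rightarrow> 'h \<Rightarrow> 'h" where
  "left_mult n U \<eta> a =
     bounded_extension (\<eta> ` smooth_torus n U)
       (\<lambda>h. \<eta> (a * inv_into (smooth_torus n U) \<eta> h))"

definition L2_deriv ::
  "nat \<Rightarrow> (nat \<Rightarrow> 'a::cstar_algebra) \<Rightarrow> ('a \<Rightarrow> 'h::complex_hilbert) \<Rightarrow> nat \<Rightarrow> 'h \<Rightarrow> 'h" where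
  "L2_deriv n U \<eta> j h = \<eta> (torus_deriv n U j (inv_into (smooth_torus n U) \<eta> h))"

text \<open>The Hilbert space \<open>'h \<otimes> \<complex>\<^sup>N \<otimes> \<complex>\<^sup>N\<close>, \<open>N = CARD('s)\<close>, is \<open>'h ^ 's ^ 's\<close>: the component
  \<open>\<xi> $ p $ q\<close> is the coefficient of \<open>e\<^sub>p \<otimes> e\<^sub>q\<close>. \<open>tensor_op T M K\<close> is \<open>T \<otimes> M \<otimes> K\<close>.\<close>

definition tensor_op ::
  "('h::complex_hilbert \<Rightarrow> 'h) \<Rightarrow> complex ^ 's ^ 's \<Rightarrow> complex ^ 's ^ 's \<Rightarrow>
   'h ^ 's ^ 's \<Rightarrow> 'h ^ 's ^ 's::finite" where
  "tensor_op T M K \<xi> =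
     (\<chi> p q. \<Sum>p'\<in>UNIV. \<Sum>q'\<in>UNIV. (M $ p $ p' * K $ q $ q') *\<^sub>C T (\<xi> $ p' $ q'))"

definition conj_transpose :: "complex ^ 's ^ 's \<Rightarrow> complex ^ 's ^ 's" where
  "conj_transpose M = (\<chi> i j. cnj (M $ j $ i))"

definition clifford_rep ::
  "nat \<Rightarrow> (nat \<Rightarrow> complex ^ 's ^ 's) \<Rightarrow> complex ^ 's ^ 's::finite \<Rightarrow> bool" where
  "clifford_rep n \<gamma> \<sigma> \<longleftrightarrow>
     CARD('s) = 2 ^ n \<and>
     (\<forall>j\<in>{1..2*n}. conj_transpose (\<gamma> j) = - \<gamma> j) \<and>
     (\<forall>j\<in>{1..2*n}. \<forall>l\<in>{1..2*n}.
        \<gamma> j ** \<gamma> l + \<gamma> l ** \<gamma> j = (if j = l then mat (- 2) else 0)) \<and>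
     (\<forall>W. vec.subspace W \<and> (\<forall>j\<in>{1..2*n}. \<forall>w\<in>W. \<gamma> j *v w \<in> W) \<longrightarrow> W = {0} \<or> W = UNIV) \<and>
     conj_transpose \<sigma> = \<sigma> \<and> \<sigma> ** \<sigma> = mat 1 \<and>
     (\<forall>j\<in>{1..2*n}. \<sigma> ** \<gamma> j = - (\<gamma> j ** \<sigma>))"

definition d1_op ::
  "nat \<Rightarrow> (nat \<Rightarrow> 'a::cstar_algebra) \<Rightarrow> ('a \<Rightarrow> 'h::complex_hilbert) \<Rightarrow>
   (nat \<Rightarrow> complex ^ 's ^ 's) \<Rightarrow> complex ^ 's ^ 's \<Rightarrow> real \<Rightarrow> 'h ^ 's ^ 's \<Rightarrow> 'h ^ 's ^ 's::finite" where
  "d1_op n U \<eta> \<gamma> \<sigma> \<epsilon> \<xi> =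
     (1/2) *\<^sub>C (\<Sum>j\<in>{1..2*n}.
        tensor_op (L2_deriv n U \<eta> j) (mat 1) (\<gamma> j) \<xi>
        + (\<i> * of_real \<epsilon>) *\<^sub>C tensor_op (L2_deriv n U \<eta> j) (\<gamma> j) \<sigma> \<xi>)"

definition d2_op ::
  "nat \<Rightarrow> (nat \<Rightarrow> 'a::cstar_algebra) \<Rightarrow> ('a \<Rightarrow> 'h::complex_hilbert) \<Rightarrow>
   (nat \<Rightarrow> complex ^ 's ^ 's) \<Rightarrow> complex ^ 's ^ 's \<Rightarrow> real \<Rightarrow> 'h ^ 's ^ 's \<Rightarrow> 'h ^ 's ^ 's::finite" where
  "d2_op n U \<eta> \<gamma> \<sigma> \<epsilon> \<xi> =
     (1/2) *\<^sub>C (\<Sum>j | odd j \<and> j \<le> 2*n - 1.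
        tensor_op (L2_deriv n U \<eta> j) (mat 1) (\<gamma> (j+1)) \<xi>
        - tensor_op (L2_deriv n U \<eta> (j+1)) (mat 1) (\<gamma> j) \<xi>
        + (\<i> * of_real \<epsilon>) *\<^sub>C
            (tensor_op (L2_deriv n U \<eta> j) (\<gamma> (j+1)) \<sigma> \<xi>
             - tensor_op (L2_deriv n U \<eta> (j+1)) (\<gamma> j) \<sigma> \<xi>))"

definition del_op ::
  "nat \<Rightarrow> (nat \<Rightarrow> 'a::cstar_algebra) \<Rightarrow> ('a \<Rightarrow> 'h::complex_hilbert) \<Rightarrow>
   (nat \<Rightarrow> complex ^ 's ^ 's) \<Rightarrow> complex ^ 's ^ 's \<Rightarrow> real \<Rightarrow> 'h ^ 's ^ 's \<Rightarrow> 'h ^ 's ^ 's::finite" where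
  "del_op n U \<eta> \<gamma> \<sigma> \<epsilon> \<xi> =
     (1/2) *\<^sub>C (d1_op n U \<eta> \<gamma> \<sigma> \<epsilon> \<xi> - \<i> *\<^sub>C d2_op n U \<eta> \<gamma> \<sigma> \<epsilon> \<xi>)"

definition delbar_op ::
  "nat \<Rightarrow> (nat \<Rightarrow> 'a::cstar_algebra) \<Rightarrow> ('a \<Rightarrow> 'h::complex_hilbert) \<Rightarrow>
   (nat \<Rightarrow> complex ^ 's ^ 's) \<Rightarrow> complex ^ 's ^ 's \<Rightarrow> real \<Rightarrow> 'h ^ 's ^ 's \<Rightarrow> 'h ^ 's ^ 's::finite" where
  "delbar_op n U \<eta> \<gamma> \<sigma> \<epsilon> \<xi> =
     (1/2) *\<^sub>C (d1_op n U \<eta> \<gamma> \<sigma> \<epsilon> \<xi> + \<i> *\<^sub>C d2_op n U \<eta> \<gamma> \<sigma> \<epsilon> \<xi>)"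


section \<open>Forms\<close>

definition alg_op ::
  "nat \<Rightarrow> (nat \<Rightarrow> 'a::cstar_algebra) \<Rightarrow> ('a \<Rightarrow> 'h::complex_hilbert) \<Rightarrow> 'a \<Rightarrow>
   'h ^ 's ^ 's \<Rightarrow> 'h ^ 's ^ 's::finite" where
  "alg_op n U \<eta> a = tensor_op (left_mult n U \<eta> a) (mat 1) (mat 1)"

definition smooth_vectors ::
  "nat \<Rightarrow> (nat \<Rightarrow> 'a::cstar_algebra) \<Rightarrow> ('a \<Rightarrow> 'h::complex_hilbert) \<Rightarrow> ('h ^ 's ^ 's::finite) set" where
  "smooth_vectors n U \<eta> = {\<xi>. \<forall>p q. \<xi> $ p $ q \<in> \<eta> ` smooth_torus n U}"

text \<open>The bounded operator \<open>[D, a]\<close>: the extension of the commutator, which is defined on the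
  smooth vectors.\<close>

definition commutator ::
  "nat \<Rightarrow> (nat \<Rightarrow> 'a::cstar_algebra) \<Rightarrow> ('a \<Rightarrow> 'h::complex_hilbert) \<Rightarrow>
   ('h ^ 's ^ 's \<Rightarrow> 'h ^ 's ^ 's) \<Rightarrow> 'a \<Rightarrow> 'h ^ 's ^ 's \<Rightarrow> 'h ^ 's ^ 's::finite" where
  "commutator n U \<eta> D a =
     bounded_extension (smooth_vectors n U \<eta>)
       (\<lambda>\<xi>. D (alg_op n U \<eta> a \<xi>) - alg_op n U \<eta> a (D \<xi>))"

definition op_span :: "('x \<Rightarrow> 'x::complex_vector) set \<Rightarrow> ('x \<Rightarrow> 'x) set" where
  "op_span S =
     {(\<lambda>\<xi>. \<Sum>k<K. c k *\<^sub>C T k \<xi>) | (K::nat) c T. \<forall>k<K. T k \<in> S}"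

definition forms0 ::
  "nat \<Rightarrow> (nat \<Rightarrow> 'a::cstar_algebra) \<Rightarrow> ('a \<Rightarrow> 'h::complex_hilbert) \<Rightarrow>
   ('h ^ 's ^ 's \<Rightarrow> 'h ^ 's ^ 's::finite) set" where
  "forms0 n U \<eta> = alg_op n U \<eta> ` smooth_torus n U"

definition forms1 ::
  "nat \<Rightarrow> (nat \<Rightarrow> 'a::cstar_algebra) \<Rightarrow> ('a \<Rightarrow> 'h::complex_hilbert) \<Rightarrow>
   ('h ^ 's ^ 's \<Rightarrow> 'h ^ 's ^ 's) \<Rightarrow> ('h ^ 's ^ 's \<Rightarrow> 'h ^ 's ^ 's::finite) set" where
  "forms1 n U \<eta> D =
     op_span {alg_op n U \<eta> a \<circ> commutator n U \<eta> D b | a b.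
       a \<in> smooth_torus n U \<and> b \<in> smooth_torus n U}"

definition forms2 ::
  "nat \<Rightarrow> (nat \<Rightarrow> 'a::cstar_algebra) \<Rightarrow> ('a \<Rightarrow> 'h::complex_hilbert) \<Rightarrow>
   ('h ^ 's ^ 's \<Rightarrow> 'h ^ 's ^ 's) \<Rightarrow> ('h ^ 's ^ 's \<Rightarrow> 'h ^ 's ^ 's::finite) set" where
  "forms2 n U \<eta> D =
     op_span {alg_op n U \<eta> a \<circ> commutator n U \<eta> D b \<circ> commutator n U \<eta> D c | a b c.
       a \<in> smooth_torus n U \<and> b \<in> smooth_torus n U \<and> c \<in> smooth_torus n U}"


section \<open>Bimodules\<close>

record ('a, 'm) bimod =
  elems :: "'m set"
  madd :: "'m \<Rightarrow> 'm \<Rightarrow> 'm"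
  lact :: "'a \<Rightarrow> 'm \<Rightarrow> 'm"
  ract :: "'m \<Rightarrow> 'a \<Rightarrow> 'm"

definition bimod_closed :: "'a set \<Rightarrow> ('a, 'm) bimod \<Rightarrow> bool" where
  "bimod_closed A M \<longleftrightarrow>
     (\<forall>x\<in>elems M. \<forall>y\<in>elems M. madd M x y \<in> elems M) \<and>
     (\<forall>a\<in>A. \<forall>x\<in>elems M. lact M a x \<in> elems M \<and> ract M x a \<in> elems M)"

definition bimod_iso ::
  "'a set \<Rightarrow> ('a, 'm) bimod \<Rightarrow> ('a, 'k) bimod \<Rightarrow> ('m \<Rightarrow> 'k) \<Rightarrow> bool" where
  "bimod_iso A M N f \<longleftrightarrow>
     bimod_closed A M \<and> bimod_closed A N \<and>
     bij_betw f (elems M) (elems N) \<and>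
     (\<forall>x\<in>elems M. \<forall>y\<in>elems M. f (madd M x y) = madd N (f x) (f y)) \<and>
     (\<forall>a\<in>A. \<forall>x\<in>elems M. f (lact M a x) = lact N a (f x) \<and> f (ract M x a) = ract N (f x) a)"

definition op_bimod ::
  "nat \<Rightarrow> (nat \<Rightarrow> 'a::cstar_algebra) \<Rightarrow> ('a \<Rightarrow> 'h::complex_hilbert) \<Rightarrow>
   ('h ^ 's ^ 's \<Rightarrow> 'h ^ 's ^ 's) set \<Rightarrow> ('a, 'h ^ 's ^ 's \<Rightarrow> 'h ^ 's ^ 's::finite) bimod" where
  "op_bimod n U \<eta> \<Omega> =
     \<lparr> elems = \<Omega>, madd = (\<lambda>S T \<xi>. S \<xi> + T \<xi>),
       lact = (\<lambda>a S. alg_op n U \<eta> a \<circ> S), ract = (\<lambda>S a. S \<circ> alg_op n U \<eta> a) \<rparr>"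

definition regular_bimod :: "'a::ring set \<Rightarrow> ('a, 'a) bimod" where
  "regular_bimod A = \<lparr> elems = A, madd = (+), lact = (*), ract = (*) \<rparr>"

definition free_bimod :: "'a::ring set \<Rightarrow> nat \<Rightarrow> ('a, nat \<Rightarrow> 'a) bimod" where
  "free_bimod A r =
     \<lparr> elems = {1..r} \<rightarrow>\<^sub>E A,
       madd = (\<lambda>x y. \<lambda>i\<in>{1..r}. x i + y i),
       lact = (\<lambda>a x. \<lambda>i\<in>{1..r}. a * x i),
       ract = (\<lambda>x a. \<lambda>i\<in>{1..r}. x i * a) \<rparr>"

end

theory Submission
  imports Defs
begin

text \<open>
  The operator \<open>\<partial>\<close> and its conjugate are sums of derivations of the algebra with Grassmann
  coefficients, so that the forms of degree one and two are the free bimodules on the Grassmann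
  generators and on their products. The proof has an analytic half, which makes the derivations and
  the left multiplications behave as the formal series suggest, and an algebraic half.

  The analytic half rests on \<open>coeff_le_norm\<close>: each coefficient of a convergent Fourier series is
  bounded by the norm of the sum. Conjugation by \<open>U j\<close> multiplies each monomial by a value of a
  character of \<open>\<int>\<^sup>2\<^sup>n\<close>, the density of the lattice says that these characters separate
  the integer vectors (\<open>angle_separates\<close>), and averages over conjugates delete all monomials but one.
  Hence Fourier coefficients are unique, the Leibniz rule can be checked on coefficients
  (\<open>deriv_mult\<close>), the trace is contractive, and \<open>\<eta>\<close> is an injective contraction. A
  Schwartz series acts on the Hilbert space with norm at most the sum of its absolute coefficients
  (\<open>eta_mult_bounded\<close>), which gives a faithful bounded representation.

  For the algebraic half put \<open>\<Gamma>\<^sub>j = 1/2 (1 \<otimes> \<gamma>\<^sub>j + i\<epsilon> \<gamma>\<^sub>j \<otimes> \<sigma>)\<close>. The two summands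
  anticommute and their squares cancel, so the \<open>\<Gamma>\<^sub>j\<close> anticommute and have square zero. With
  a sign \<open>s\<close>, which is \<open>1\<close> for the antiholomorphic and \<open>-1\<close> for the holomorphic operator, the
  definitions regroup to \<open>\<Sum>\<^sub>p \<delta>\<^sub>p G\<^sub>p\<close> where
  \<open>G\<^sub>p = \<Gamma>\<^sub>2\<^sub>p\<^sub>-\<^sub>1 + s i \<Gamma>\<^sub>2\<^sub>p\<close> and
  \<open>\<delta>\<^sub>p = 1/2 (\<partial>\<^sub>2\<^sub>p\<^sub>-\<^sub>1 - s i \<partial>\<^sub>2\<^sub>p)\<close>. As \<open>G\<^sub>p\<close> commutes with the
  algebra, the commutator with \<open>b\<close> is \<open>\<Sum>\<^sub>p \<delta>\<^sub>p(b) G\<^sub>p\<close> (\<open>commutator_dolb\<close>). The forms are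
  therefore combinations of the \<open>G\<^sub>p\<close>, respectively of the \<open>G\<^sub>p G\<^sub>q\<close> with \<open>p < q\<close>. All
  coefficients occur, because \<open>\<delta>\<^sub>q\<close> maps the unitary \<open>U\<^sub>2\<^sub>p\<^sub>-\<^sub>1\<close> to a nonzero multiple of
  itself if \<open>q = p\<close> and to \<open>0\<close> otherwise. They are unique, because the operators
  \<open>1/2 (- 1 \<otimes> \<gamma>\<^sub>j + i\<epsilon> \<gamma>\<^sub>j \<otimes> \<sigma>)\<close> satisfy the canonical anticommutation relations
  with the \<open>\<Gamma>\<^sub>j\<close> and contract a form to its coefficients. The product formula is
  \<open>G\<^sub>q G\<^sub>p = - G\<^sub>p G\<^sub>q\<close>.
\<close>

section \<open>Complex scalars and the involution\<close>

lemma scaleC_one [simp]: "1 *\<^sub>C (x::'a::complex_vector) = x"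
  using scaleR_scaleC[of 1 x] by simp

lemma scaleC_zero_right [simp]: "c *\<^sub>C (0::'a::complex_vector) = 0"
  using scaleC_add_right[of c "0::'a" 0] by simp

lemma scaleC_zero_left [simp]: "0 *\<^sub>C (x::'a::complex_vector) = 0"
  using scaleC_add_left[of 0 0 x] by simp

lemma scaleC_minus_left [simp]: "(- c) *\<^sub>C (x::'a::complex_vector) = - (c *\<^sub>C x)"
  using scaleC_add_left[of c "- c" x] by (simp add: eq_neg_iff_add_eq_0 add.commute)

lemma scaleC_minus_right [simp]: "c *\<^sub>C (- x::'a::complex_vector) = - (c *\<^sub>C x)"
  using scaleC_add_right[of c x "- x"] by (simp add: eq_neg_iff_add_eq_0 add.commute)

lemma scaleC_diff_right: "c *\<^sub>C (x - y::'a::complex_vector) = c *\<^sub>C x - c *\<^sub>C y"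
  using scaleC_add_right[of c x "- y"] by simp

lemma scaleC_diff_left: "(c - d) *\<^sub>C (x::'a::complex_vector) = c *\<^sub>C x - d *\<^sub>C x"
  using scaleC_add_left[of c "- d" x] by simp

lemma scaleC_sum_right: "c *\<^sub>C (\<Sum>i\<in>I. f i :: 'a::complex_vector) = (\<Sum>i\<in>I. c *\<^sub>C f i)"
  by (induction I rule: infinite_finite_induct) (auto simp: scaleC_add_right)

lemma scaleC_sum_left: "(\<Sum>i\<in>I. f i) *\<^sub>C (x :: 'a::complex_vector) = (\<Sum>i\<in>I. f i *\<^sub>C x)"
  by (induction I rule: infinite_finite_induct) (auto simp: scaleC_add_left)

lemma scaleC_scaleR: "c *\<^sub>C (r *\<^sub>R (x::'a::complex_vector)) = r *\<^sub>R (c *\<^sub>C x)"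
  by (simp add: scaleR_scaleC scaleC_scaleC mult.commute)

lemma bounded_linear_scaleC_right: "bounded_linear (\<lambda>x::'a::complex_banach. c *\<^sub>C x)"
  by (rule bounded_linear_intro[of _ "cmod c"])
     (auto simp: scaleC_add_right scaleC_scaleR norm_scaleC)

lemma bounded_linear_scaleC_left: "bounded_linear (\<lambda>c. c *\<^sub>C (x::'a::complex_banach))"
  by (rule bounded_linear_intro[of _ "norm x"])
     (auto simp: scaleC_add_left scaleR_scaleC scaleC_scaleC scaleR_conv_of_real norm_scaleC)

lemma star_one [simp]: "star (1::'a::cstar_algebra) = 1"
  by (metis mult.left_neutral mult.right_neutral star_mult star_star)

lemma star_zero [simp]: "star (0::'a::cstar_algebra) = 0"
  using star_add[of "0::'a" 0] by simp

lemma norm_star [simp]: "norm (star (x::'a::cstar_algebra)) = norm x"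
proof -
  have le: "norm y \<le> norm (star y)" for y :: 'a
  proof (cases "y = 0")
    case False
    have "norm y * norm y \<le> norm (star y) * norm y"
      using norm_mult_ineq[of "star y" y] by (simp add: norm_star_mult power2_eq_square)
    then show ?thesis using False by simp
  qed simp
  show ?thesis using le[of x] le[of "star x"] by (simp add: star_star)
qed

lemma bounded_linear_star: "bounded_linear (star :: 'a::cstar_algebra \<Rightarrow> 'a)"
  by (rule bounded_linear_intro[of _ 1]) (auto simp: star_add scaleR_scaleC star_scaleC)

lemma unitary_star: "is_unitary u \<Longrightarrow> is_unitary (star u)"
  by (simp add: is_unitary_def star_star)

lemma unitary_one [simp]: "is_unitary 1"
  by (simp add: is_unitary_def)

lemma unitary_mult:
  assumes "is_unitary u" "is_unitary v" shows "is_unitary (u * v)"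
  using assms unfolding is_unitary_def star_mult
  by (metis (no_types, lifting) mult.assoc mult.left_neutral)

lemma norm_unitary: "is_unitary (u::'a::cstar_algebra) \<Longrightarrow> norm u = 1"
  using norm_star_mult[of u] by (simp add: is_unitary_def power2_eq_1_iff)
    (smt (verit) norm_ge_zero)

lemma norm_unitary_mult_left:
  assumes "is_unitary (u::'a::cstar_algebra)" shows "norm (u * x) = norm x"
proof -
  have "star (u * x) * (u * x) = star x * x"
    using assms unfolding is_unitary_def star_mult by (metis mult.assoc mult.left_neutral)
  then have "(norm (u * x))\<^sup>2 = (norm x)\<^sup>2" by (metis norm_star_mult)
  then show ?thesis by simp
qed


section \<open>Monomials in the generators\<close>

lemma unitary_power_0 [simp]: "unitary_power u 0 = 1"
  by (simp add: unitary_power_def)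

lemma unitary_power_1 [simp]: "unitary_power u 1 = u"
  by (simp add: unitary_power_def)

lemma unitary_power_succ:
  assumes "is_unitary u" shows "unitary_power u (k + 1) = unitary_power u k * u"
proof (cases "k \<ge> 0")
  case True
  then show ?thesis by (simp add: unitary_power_def nat_add_distrib power_Suc2 del: power_Suc)
next
  case False
  then obtain n where k: "k = - int (Suc n)" by (metis not_le negD)
  have "unitary_power u (k + 1) = star u ^ n" by (auto simp: unitary_power_def k)
  moreover have "unitary_power u k * u = star u ^ n * (star u * u)"
    unfolding unitary_power_def k by (simp add: nat_add_distrib power_Suc2 mult.assoc del: power_Suc)
  ultimately show ?thesis using assms by (simp add: is_unitary_def)
qed

lemma unitary_power_pred:
  assumes "is_unitary u" shows "unitary_power u (k - 1) = unitary_power u k * star u"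
  using unitary_power_succ[OF assms, of "k - 1"] assms
  by (simp add: is_unitary_def mult.assoc)

lemma unitary_power_add:
  assumes "is_unitary u"
  shows "unitary_power u (k + l) = unitary_power u k * unitary_power u l"
proof (induction l rule: int_induct[of _ 0])
  case (step1 i)
  then show ?case
    using unitary_power_succ[OF assms, of "k + i"] unitary_power_succ[OF assms, of i]
    by (simp add: mult.assoc add.assoc)
next
  case (step2 i)
  then show ?case
    using unitary_power_pred[OF assms, of "k + i"] unitary_power_pred[OF assms, of i]
    by (simp add: mult.assoc add_diff_eq)
qed simp

lemma unitary_unitary_power:
  assumes "is_unitary u" shows "is_unitary (unitary_power u k)"
proof (induction k rule: int_induct[of _ 0])
  case (step1 i)
  then show ?case by (simp add: unitary_power_succ unitary_mult assms)
next
  case (step2 i)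
  then show ?case by (simp add: unitary_power_pred unitary_mult unitary_star assms)
qed simp

lemma cis_swap:
  fixes x y :: "'a::cstar_algebra"
  assumes "x * y = cis t *\<^sub>C (y * x)" shows "y * x = cis (- t) *\<^sub>C (x * y)"
  using assms by (simp add: scaleC_scaleC cis_mult)

text \<open>Multiplying the relation by \<open>star u\<close> on both sides inverts the phase, which covers the negative
  powers.\<close>

lemma cis_commute_power:
  fixes x u :: "'a::cstar_algebra"
  assumes u: "is_unitary u" and xu: "x * u = cis t *\<^sub>C (u * x)"
  shows "x * unitary_power u k = cis (of_int k * t) *\<^sub>C (unitary_power u k * x)"
proof -
  have "star u * x = star u * (x * u) * star u"
    using u by (simp add: mult.assoc is_unitary_def)
  also have "\<dots> = cis t *\<^sub>C (star u * u * (x * star u))"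
    by (simp add: xu scaleC_mult_left scaleC_mult_right mult.assoc)
  also have "\<dots> = cis t *\<^sub>C (x * star u)" using u by (simp add: is_unitary_def)
  finally have xs: "x * star u = cis (- t) *\<^sub>C (star u * x)"
    using cis_swap[of "star u" x t] by simp
  show ?thesis
  proof (induction k rule: int_induct[of _ 0])
    case base
    show ?case by simp
  next
    case (step1 i)
    have "x * unitary_power u (i + 1) = (x * unitary_power u i) * u"
      by (simp add: unitary_power_succ u mult.assoc)
    also have "\<dots> = cis (of_int i * t) *\<^sub>C (unitary_power u i * (x * u))"
      by (simp only: step1 scaleC_mult_left mult.assoc)
    also have "\<dots> = (cis (of_int i * t) * cis t) *\<^sub>C (unitary_power u i * u * x)"
      by (simp only: xu scaleC_mult_right mult.assoc scaleC_scaleC)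
    finally show ?case
      by (simp add: unitary_power_succ u cis_mult ring_distribs)
  next
    case (step2 i)
    have "x * unitary_power u (i - 1) = (x * unitary_power u i) * star u"
      by (simp add: unitary_power_pred u mult.assoc)
    also have "\<dots> = cis (of_int i * t) *\<^sub>C (unitary_power u i * (x * star u))"
      by (simp only: step2 scaleC_mult_left mult.assoc)
    also have "\<dots> = (cis (of_int i * t) * cis (- t)) *\<^sub>C (unitary_power u i * star u * x)"
      by (simp only: xs scaleC_mult_right mult.assoc scaleC_scaleC)
    finally show ?case
      by (simp add: unitary_power_pred u cis_mult left_diff_distrib)
  qed
qed

lemma cis_commute_prod_list:
  fixes x :: "'a::cstar_algebra"
  assumes "\<And>j. j \<in> set js \<Longrightarrow> x * f j = cis (t j) *\<^sub>C (f j * x)"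
  shows "x * prod_list (map f js) = cis (\<Sum>j\<leftarrow>js. t j) *\<^sub>C (prod_list (map f js) * x)"
  using assms
proof (induction js)
  case (Cons j js)
  have "x * prod_list (map f (j # js)) = (x * f j) * prod_list (map f js)"
    by (simp add: mult.assoc)
  also have "\<dots> = cis (t j) *\<^sub>C (f j * (x * prod_list (map f js)))"
    using Cons.prems[of j] by (simp add: scaleC_mult_left mult.assoc)
  also have "\<dots> = cis (t j) *\<^sub>C cis (\<Sum>j\<leftarrow>js. t j) *\<^sub>C (f j * (prod_list (map f js) * x))"
    using Cons by (simp add: scaleC_mult_right)
  finally show ?case by (simp add: scaleC_scaleC cis_mult mult.assoc)
qed simp

text \<open>Each letter of the second word is moved to the left past the remaining letters of the first,
  which costs one phase per letter.\<close>

lemma prod_list_mult_phase: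
  fixes f g :: "'i \<Rightarrow> 'a::cstar_algebra"
  assumes "\<And>i j. i \<in> set js \<Longrightarrow> j \<in> set js \<Longrightarrow> \<exists>t. f i * g j = cis t *\<^sub>C (g j * f i)"
  shows "\<exists>t. prod_list (map f js) * prod_list (map g js)
            = cis t *\<^sub>C prod_list (map (\<lambda>j. f j * g j) js)"
  using assms
proof (induction js)
  case Nil
  show ?case by (rule exI[of _ 0]) simp
next
  case (Cons j js)
  let ?F = "prod_list (map f js)" and ?G = "prod_list (map g js)"
  let ?H = "prod_list (map (\<lambda>j. f j * g j) js)"
  have "\<exists>t. g j * f i = cis t *\<^sub>C (f i * g j)" if "i \<in> set js" for i
    using cis_swap Cons.prems[of i j] that by (metis list.set_intros)
  then obtain t where "\<And>i. i \<in> set js \<Longrightarrow> g j * f i = cis (t i) *\<^sub>C (f i * g j)" by metis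
  then have "g j * ?F = cis (\<Sum>j\<leftarrow>js. t j) *\<^sub>C (?F * g j)" by (rule cis_commute_prod_list)
  then obtain s where s: "?F * g j = cis s *\<^sub>C (g j * ?F)" using cis_swap by blast
  obtain r where r: "?F * ?G = cis r *\<^sub>C ?H" using Cons.IH Cons.prems by (metis list.set_intros(2))
  have "prod_list (map f (j # js)) * prod_list (map g (j # js)) = f j * (?F * g j) * ?G"
    by (simp add: mult.assoc)
  also have "\<dots> = cis s *\<^sub>C (f j * g j * (?F * ?G))"
    by (simp only: s scaleC_mult_left scaleC_mult_right mult.assoc)
  also have "\<dots> = cis (s + r) *\<^sub>C (f j * g j * ?H)"
    by (simp only: r scaleC_mult_right scaleC_scaleC cis_mult)
  finally show ?case by auto
qed

lemma unitary_prod_list: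
  "(\<And>j. j \<in> set js \<Longrightarrow> is_unitary (f j)) \<Longrightarrow> is_unitary (prod_list (map f js))"
  by (induction js) (auto intro: unitary_mult)

locale torus =
  fixes n :: nat and \<Theta> :: "nat \<Rightarrow> nat \<Rightarrow> real" and U :: "nat \<Rightarrow> 'a::cstar_algebra"
  assumes relations: "torus_relations n \<Theta> U" and dense: "dense_lattice n \<Theta>"
begin

abbreviation Z :: "(nat \<Rightarrow> int) set" where "Z \<equiv> int_vectors n"
abbreviation M :: "(nat \<Rightarrow> int) \<Rightarrow> 'a" where "M \<equiv> monomial n U"
abbreviation A :: "'a set" where "A \<equiv> smooth_torus n U"

text \<open>The argument of the character by which conjugation with \<open>U j\<close> acts on the monomial of
  exponent \<open>m\<close>.\<close>

definition angle :: "nat \<Rightarrow> (nat \<Rightarrow> int) \<Rightarrow> real" where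
  "angle j m = 2 * pi * (\<Sum>l\<in>{1..2*n}. of_int (m l) * \<Theta> l j)"

lemma set_index: "set [1..<2*n+1] = {1..2*n}"
  by auto

lemma unitary_U: "j \<in> {1..2*n} \<Longrightarrow> is_unitary (U j)"
  using relations unfolding torus_relations_def by auto

lemma commute_U:
  assumes "j \<in> {1..2*n}" "l \<in> {1..2*n}"
  shows "U j * U l = cis (2 * pi * \<Theta> l j) *\<^sub>C (U l * U j)"
proof -
  have "exp (2 * of_real pi * \<i> * of_real (\<Theta> l j)) = cis (2 * pi * \<Theta> l j)"
    by (simp add: cis_conv_exp mult_ac)
  then show ?thesis using relations assms unfolding torus_relations_def by metis
qed

lemma commute_U_power:
  assumes "j \<in> {1..2*n}" "l \<in> {1..2*n}"
  shows "U j * unitary_power (U l) k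
           = cis (of_int k * (2 * pi * \<Theta> l j)) *\<^sub>C (unitary_power (U l) k * U j)"
  using cis_commute_power[OF unitary_U commute_U] assms by blast

lemma commute_power_power:
  assumes "j \<in> {1..2*n}" "l \<in> {1..2*n}"
  shows "\<exists>t. unitary_power (U j) p * unitary_power (U l) k
           = cis t *\<^sub>C (unitary_power (U l) k * unitary_power (U j) p)"
  using cis_commute_power[OF unitary_U cis_swap[OF commute_U_power]] assms
  by (metis cis_swap)

lemma unitary_M: "is_unitary (M m)"
  unfolding monomial_def
  by (intro unitary_prod_list unitary_unitary_power unitary_U) auto

lemma norm_M [simp]: "norm (M m) = 1"
  by (rule norm_unitary[OF unitary_M])

lemma M_0 [simp]: "M (\<lambda>_. 0) = 1"
proof -
  have "map (\<lambda>j. unitary_power (U j) 0) js = replicate (length js) 1" for js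
    by (induction js) auto
  then show ?thesis unfolding monomial_def by (simp add: prod_list_replicate)
qed

lemma M_add: "\<exists>t. M k * M l = cis t *\<^sub>C M (\<lambda>i. k i + l i)"
proof -
  have *: "\<exists>t. M k * M l = cis t *\<^sub>C
      prod_list (map (\<lambda>j. unitary_power (U j) (k j) * unitary_power (U j) (l j)) [1..<2*n+1])"
    unfolding monomial_def
    by (rule prod_list_mult_phase, unfold set_index) (rule commute_power_power)
  have "map (\<lambda>j. unitary_power (U j) (k j) * unitary_power (U j) (l j)) [1..<2*n+1]
      = map (\<lambda>j. unitary_power (U j) (k j + l j)) [1..<2*n+1]"
    by (rule map_cong[OF refl], unfold set_index) (simp add: unitary_power_add unitary_U)
  with * show ?thesis unfolding monomial_def by (simp only:)
qed

text \<open>The two-cocycle that presents the smooth algebra as a twisted group algebra of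
  \<open>\<int>\<^sup>2\<^sup>n\<close>. It is chosen, not computed from \<open>\<Theta>\<close>: what the convolution estimates use is its modulus.\<close>

definition cocycle :: "(nat \<Rightarrow> int) \<Rightarrow> (nat \<Rightarrow> int) \<Rightarrow> complex" where
  "cocycle k l = cis (SOME t. M k * M l = cis t *\<^sub>C M (\<lambda>i. k i + l i))"

lemma M_mult: "M k * M l = cocycle k l *\<^sub>C M (\<lambda>i. k i + l i)"
  unfolding cocycle_def by (rule someI_ex[OF M_add])

lemma norm_cocycle [simp]: "cmod (cocycle k l) = 1"
  by (simp add: cocycle_def)

lemma star_M: "\<exists>t. star (M m) = cis t *\<^sub>C M (\<lambda>i. - m i)"
proof -
  obtain t where t: "M m * M (\<lambda>i. - m i) = cis t *\<^sub>C 1" using M_add[of m "\<lambda>i. - m i"] by auto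
  have "M (\<lambda>i. - m i) = star (M m) * (M m * M (\<lambda>i. - m i))"
    using unitary_M[of m] by (simp add: is_unitary_def flip: mult.assoc)
  also have "\<dots> = cis t *\<^sub>C star (M m)" by (simp add: t scaleC_mult_right)
  finally have "star (M m) = cis (- t) *\<^sub>C M (\<lambda>i. - m i)" by (simp add: scaleC_scaleC cis_mult)
  then show ?thesis by blast
qed

lemma commute_U_M:
  assumes "j \<in> {1..2*n}"
  shows "U j * M m = cis (angle j m) *\<^sub>C (M m * U j)"
proof -
  have "U j * M m = cis (\<Sum>l\<leftarrow>[1..<2*n+1]. of_int (m l) * (2 * pi * \<Theta> l j)) *\<^sub>C (M m * U j)"
    unfolding monomial_def
    by (rule cis_commute_prod_list, unfold set_index) (rule commute_U_power[OF assms])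
  moreover have "(\<Sum>l\<leftarrow>[1..<2*n+1]. of_int (m l) * (2 * pi * \<Theta> l j)) = angle j m"
    by (simp add: interv_sum_list_conv_sum_set_nat angle_def sum_distrib_left atLeastLessThanSuc_atLeastAtMost
        mult_ac del: upt_Suc)
  ultimately show ?thesis by simp
qed

section \<open>Fourier coefficients\<close>

text \<open>An integer vector \<open>d\<close> with trivial characters pairs integrally with the whole lattice
  \<open>\<Lambda> + \<int>\<^sup>2\<^sup>n\<close>. By density there is a lattice vector near a point that pairs with \<open>d\<close> to \<open>1/2\<close>,
  which is impossible unless \<open>d = 0\<close>.\<close>

lemma angle_separates:
  assumes m: "m \<in> Z" and m': "m' \<in> Z" and ne: "m \<noteq> m'"
  shows "\<exists>j\<in>{1..2*n}. cis (angle j m) \<noteq> cis (angle j m')"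
proof (rule ccontr)
  assume neg: "\<not> ?thesis"
  define d where "d i = m i - m' i" for i
  have "\<exists>z::int. (\<Sum>l\<in>{1..2*n}. of_int (d l) * \<Theta> l j) = of_int z" if j: "j \<in> {1..2*n}" for j
  proof -
    have "cis (angle j m - angle j m') = 1" using neg j by (auto simp flip: cis_divide)
    moreover have "angle j m - angle j m' = 2 * pi * (\<Sum>l\<in>{1..2*n}. of_int (d l) * \<Theta> l j)"
      by (simp add: angle_def d_def sum_subtractf ring_distribs)
    ultimately have "cos (2 * pi * (\<Sum>l\<in>{1..2*n}. of_int (d l) * \<Theta> l j)) = 1"
      by (metis cis.simps(1) one_complex.simps(1))
    then obtain z :: int where "2 * pi * (\<Sum>l\<in>{1..2*n}. of_int (d l) * \<Theta> l j) = of_int z * 2 * pi"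
      using cos_one_2pi_int by blast
    then show ?thesis by (intro exI[of _ z]) simp
  qed
  then obtain z :: "nat \<Rightarrow> int"
    where z: "\<And>j. j \<in> {1..2*n} \<Longrightarrow> (\<Sum>l\<in>{1..2*n}. of_int (d l) * \<Theta> l j) = of_int (z j)"
    by metis
  obtain i0 where i0: "d i0 \<noteq> 0" using ne by (force simp: d_def)
  then have i0in: "i0 \<in> {1..2*n}" using m m' unfolding d_def int_vectors_def by force
  define D where "D = (\<Sum>i\<in>{1..2*n}. \<bar>d i\<bar>)"
  have "\<bar>d i0\<bar> \<le> D" unfolding D_def by (rule member_le_sum) (use i0in in auto)
  then have D: "D > 0" using i0 by linarith
  \<comment> \<open>This point pairs with \<open>d\<close> to \<open>1/2\<close>.\<close>
  define x where "x i = (if i = i0 then 1 / (2 * of_int (d i0)) else 0 :: real)" for i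
  have "1 / (4 * of_int D) > (0::real)" using D by simp
  from dense[unfolded dense_lattice_def, rule_format, OF this, of x]
  obtain k p where kp: "\<And>i. i \<in> {1..2*n} \<Longrightarrow>
      \<bar>x i - ((\<Sum>j\<in>{1..2*n}. of_int (k j) * \<Theta> i j) + of_int (p i))\<bar> < 1 / (4 * of_int D)"
    by blast
  define y where "y i = (\<Sum>j\<in>{1..2*n}. of_int (k j) * \<Theta> i j) + of_int (p i)" for i
  define I where "I = (\<Sum>j\<in>{1..2*n}. k j * z j) + (\<Sum>i\<in>{1..2*n}. d i * p i)"
  have "(\<Sum>i\<in>{1..2*n}. of_int (d i) * y i)
      = (\<Sum>i\<in>{1..2*n}. \<Sum>j\<in>{1..2*n}. of_int (k j) * (of_int (d i) * \<Theta> i j))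
        + of_int (\<Sum>i\<in>{1..2*n}. d i * p i)"
    by (simp add: y_def ring_distribs sum.distrib sum_distrib_left mult_ac)
  also have "(\<Sum>i\<in>{1..2*n}. \<Sum>j\<in>{1..2*n}. of_int (k j) * (of_int (d i) * \<Theta> i j))
      = (\<Sum>j\<in>{1..2*n}. of_int (k j) * (\<Sum>i\<in>{1..2*n}. of_int (d i) * \<Theta> i j))"
    by (subst sum.swap) (simp add: sum_distrib_left)
  also have "\<dots> = of_int (\<Sum>j\<in>{1..2*n}. k j * z j)"
    unfolding of_int_sum by (rule sum.cong) (simp_all only: z of_int_mult)
  finally have yI: "(\<Sum>i\<in>{1..2*n}. of_int (d i) * y i) = of_int I" by (simp add: I_def)
  have "(\<Sum>i\<in>{1..2*n}. of_int (d i) * x i) = 1/2"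
    using i0 i0in by (simp add: x_def if_distrib[of "\<lambda>t. _ * t"] sum.delta cong: if_cong)
  then have "\<bar>1/2 - of_int I\<bar> = \<bar>\<Sum>i\<in>{1..2*n}. of_int (d i) * (x i - y i)\<bar>"
    unfolding right_diff_distrib sum_subtractf yI by (simp only:)
  also have "\<dots> \<le> (\<Sum>i\<in>{1..2*n}. of_int \<bar>d i\<bar> * (1 / (4 * of_int D)))"
  proof (rule order.trans[OF sum_abs], rule sum_mono)
    fix i assume "i \<in> {1..2*n}"
    then have "\<bar>x i - y i\<bar> \<le> 1 / (4 * of_int D)" unfolding y_def by (rule less_imp_le[OF kp])
    then show "\<bar>of_int (d i) * (x i - y i)\<bar> \<le> of_int \<bar>d i\<bar> * (1 / (4 * of_int D))"
      unfolding abs_mult of_int_abs by (rule mult_left_mono) simp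
  qed
  also have "\<dots> = of_int D * (1 / (4 * of_int D))"
    by (simp only: D_def of_int_sum sum_distrib_right)
  also have "\<dots> = 1/4" using D by simp
  finally have "\<bar>1 - 2 * of_int I\<bar> < (1::real)" by linarith
  then have "\<bar>1 - 2 * I\<bar> < 1" by linarith
  then show False by presburger
qed

text \<open>Averages of conjugates by powers of \<open>U j\<close>, twisted by the value of the \<open>j\<close>-th character at
  \<open>m0\<close>, do not increase the norm; in the limit they delete the terms with another value.\<close>

lemma averaging:
  assumes F: "finite F" and j: "j \<in> {1..2*n}"
  shows "norm (\<Sum>m\<in>{m\<in>F. cis (angle j m) = cis (angle j m0)}. \<alpha> m *\<^sub>C M m)
           \<le> norm (\<Sum>m\<in>F. \<alpha> m *\<^sub>C M m)"
proof -
  let ?a = "\<Sum>m\<in>F. \<alpha> m *\<^sub>C M m"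
  define r where "r m = cis (angle j m - angle j m0)" for m
  define conj where "conj k = cis (- (of_nat k * angle j m0)) *\<^sub>C (U j ^ k * ?a * star (U j) ^ k)" for k
  have pow: "U j ^ k * star (U j) ^ k = 1" for k
  proof (induction k)
    case (Suc k)
    have "U j ^ Suc k * star (U j) ^ Suc k = U j ^ k * (U j * star (U j)) * star (U j) ^ k"
      by (simp only: power_Suc2 power_Suc mult.assoc)
         (simp only: mult.assoc[symmetric] power_commutes)
    then show ?case using Suc unitary_U[OF j] by (simp add: is_unitary_def)
  qed simp
  have up: "is_unitary (U j ^ k)" "is_unitary (star (U j) ^ k)" for k
    by (induction k) (auto intro: unitary_mult unitary_star unitary_U j)
  have norm_conj: "norm (conj k) \<le> norm ?a" for k
  proof -
    have "norm (conj k) \<le> norm (U j ^ k * ?a) * norm (star (U j) ^ k)"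
      by (simp add: conj_def norm_scaleC norm_mult_ineq)
    then show ?thesis by (simp add: norm_unitary_mult_left norm_unitary up)
  qed
  have conj_eq: "conj k = (\<Sum>m\<in>F. (\<alpha> m * r m ^ k) *\<^sub>C M m)" for k
  proof -
    have "U j ^ k * M m * star (U j) ^ k = cis (of_nat k * angle j m) *\<^sub>C M m" for m
    proof -
      have "U j ^ k * M m = cis (of_nat k * angle j m) *\<^sub>C (M m * U j ^ k)"
        using cis_swap[OF cis_commute_power[OF unitary_U[OF j] cis_swap[OF commute_U_M[OF j]], of m "int k"]]
        by (simp add: unitary_power_def)
      then show ?thesis by (simp add: scaleC_mult_left mult.assoc pow)
    qed
    then have "conj k = (\<Sum>m\<in>F. (cis (- (of_nat k * angle j m0)) * \<alpha> m * cis (of_nat k * angle j m)) *\<^sub>C M m)"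
      by (simp add: conj_def sum_distrib_left sum_distrib_right scaleC_sum_right scaleC_mult_left
          scaleC_mult_right scaleC_scaleC mult.assoc)
    moreover have "cis (- (of_nat k * angle j m0)) * \<alpha> m * cis (of_nat k * angle j m) = \<alpha> m * r m ^ k" for m
    proof -
      have "r m ^ k = cis (- (of_nat k * angle j m0)) * cis (of_nat k * angle j m)"
        by (simp add: r_def Complex.DeMoivre cis_mult algebra_simps)
      then show ?thesis by simp
    qed
    ultimately show ?thesis by simp
  qed
  define avg where "avg N = (1 / of_nat N) *\<^sub>C (\<Sum>k<N. conj k)" for N
  have norm_avg: "norm (avg N) \<le> norm ?a" for N
  proof (cases "N = 0")
    case False
    have "norm (\<Sum>k<N. conj k) \<le> of_nat N * norm ?a"
      using sum_norm_bound[of "{..<N}" conj "norm ?a"] norm_conj by simp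
    then show ?thesis using False
      by (simp add: avg_def norm_scaleC norm_divide field_simps)
  qed (simp add: avg_def)
  define q where "q N m = (1 / of_nat N) * (\<Sum>k<N. r m ^ k)" for N m
  have avg_eq: "avg N = (\<Sum>m\<in>F. (\<alpha> m * q N m) *\<^sub>C M m)" for N
    unfolding avg_def conj_eq q_def
    by (subst sum.swap)
       (simp add: scaleC_sum_right scaleC_scaleC sum_distrib_left mult_ac flip: scaleC_sum_left)
  have q_lim: "(\<lambda>N. q N m) \<longlonglongrightarrow> (if cis (angle j m) = cis (angle j m0) then 1 else 0)" for m
  proof (cases "cis (angle j m) = cis (angle j m0)")
    case True
    then have "r m = 1" by (simp add: r_def flip: cis_divide)
    then have "q N m = 1" if "N > 0" for N using that by (simp add: q_def)
    then have "\<forall>\<^sub>F N in sequentially. q N m = 1" by (auto simp: eventually_sequentially intro!: exI[of _ 1])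
    then show ?thesis using True by (simp add: tendsto_eventually)
  next
    case False
    then have r1: "r m \<noteq> 1" by (simp add: r_def flip: cis_divide)
    have bound: "cmod (q N m) \<le> (2 / cmod (r m - 1)) * (1 / of_nat N)" for N
    proof -
      have "(\<Sum>k<N. r m ^ k) = (r m ^ N - 1) / (r m - 1)" using geometric_sum[OF r1] by simp
      moreover have "cmod (r m ^ N - 1) \<le> 2"
        using norm_triangle_ineq4[of "r m ^ N" 1] by (simp add: norm_power r_def)
      ultimately have "cmod (\<Sum>k<N. r m ^ k) \<le> 2 / cmod (r m - 1)"
        by (simp add: norm_divide divide_right_mono)
      then have "1 / of_nat N * cmod (\<Sum>k<N. r m ^ k) \<le> 1 / of_nat N * (2 / cmod (r m - 1))"
        by (intro mult_left_mono) auto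
      then show ?thesis by (simp add: q_def norm_mult norm_divide mult.commute)
    qed
    have "(\<lambda>N. (2 / cmod (r m - 1)) * (1 / of_nat N)) \<longlonglongrightarrow> 0"
      using tendsto_mult_right_zero[OF lim_1_over_n] by blast
    then have "(\<lambda>N. q N m) \<longlonglongrightarrow> 0"
      by (rule Lim_null_comparison[rotated]) (intro always_eventually allI bound)
    then show ?thesis using False by simp
  qed
  have "avg \<longlonglongrightarrow> (\<Sum>m\<in>F. (\<alpha> m * (if cis (angle j m) = cis (angle j m0) then 1 else 0)) *\<^sub>C M m)"
    unfolding avg_eq
    by (intro tendsto_sum bounded_linear.tendsto[OF bounded_linear_scaleC_left] tendsto_mult
        tendsto_const q_lim)
  also have "(\<Sum>m\<in>F. (\<alpha> m * (if cis (angle j m) = cis (angle j m0) then 1 else 0)) *\<^sub>C M m)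
      = (\<Sum>m\<in>{m\<in>F. cis (angle j m) = cis (angle j m0)}. \<alpha> m *\<^sub>C M m)"
    using F by (intro sum.mono_neutral_cong_right) auto
  finally have "(\<lambda>N. norm (avg N)) \<longlonglongrightarrow>
      norm (\<Sum>m\<in>{m\<in>F. cis (angle j m) = cis (angle j m0)}. \<alpha> m *\<^sub>C M m)"
    by (rule tendsto_norm)
  then show ?thesis
    by (rule LIMSEQ_le_const2) (use norm_avg in blast)
qed

text \<open>While another exponent is left in \<open>F\<close>, some character separates it from \<open>m0\<close>, and averaging over
  that character passes to a proper subset that still contains \<open>m0\<close>.\<close>

lemma coeff_le_norm_finite:
  assumes "finite F" "F \<subseteq> Z" "m0 \<in> F"
  shows "cmod (\<alpha> m0) \<le> norm (\<Sum>m\<in>F. \<alpha> m *\<^sub>C M m)"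
  using assms
proof (induction F rule: finite_psubset_induct)
  case (psubset F)
  show ?case
  proof (cases "F = {m0}")
    case True
    then show ?thesis by (simp add: norm_scaleC)
  next
    case False
    then obtain m1 where m1: "m1 \<in> F" "m1 \<noteq> m0" using psubset.prems by blast
    then obtain j where j: "j \<in> {1..2*n}" "cis (angle j m1) \<noteq> cis (angle j m0)"
      using angle_separates[of m1 m0] psubset.prems by blast
    let ?F = "{m\<in>F. cis (angle j m) = cis (angle j m0)}"
    have "?F \<subset> F" using m1 j by blast
    then have "cmod (\<alpha> m0) \<le> norm (\<Sum>m\<in>?F. \<alpha> m *\<^sub>C M m)"
      using psubset.prems by (intro psubset.IH) auto
    also have "\<dots> \<le> norm (\<Sum>m\<in>F. \<alpha> m *\<^sub>C M m)" by (rule averaging[OF psubset.hyps(1) j(1)])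
    finally show ?thesis .
  qed
qed

text \<open>The bound for finite sums passes to the limit along the finite partial sums.\<close>

lemma coeff_le_norm:
  assumes sum: "((\<lambda>m. \<alpha> m *\<^sub>C M m) has_sum a) Z" and m0: "m0 \<in> Z"
  shows "cmod (\<alpha> m0) \<le> norm a"
proof -
  have "((\<lambda>F. norm (\<Sum>m\<in>F. \<alpha> m *\<^sub>C M m)) \<longlongrightarrow> norm a) (finite_subsets_at_top Z)"
    using sum unfolding has_sum_def by (rule tendsto_norm)
  moreover have "\<forall>\<^sub>F F in finite_subsets_at_top Z. cmod (\<alpha> m0) \<le> norm (\<Sum>m\<in>F. \<alpha> m *\<^sub>C M m)"
    unfolding eventually_finite_subsets_at_top
    using m0 coeff_le_norm_finite[of _ m0 \<alpha>] by (intro exI[of _ "{m0}"]) auto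
  ultimately show ?thesis
    using tendsto_lowerbound finite_subsets_at_top_neq_bot by blast
qed

lemma fourier_expansion_unique:
  assumes "fourier_expansion n U a \<alpha>" "fourier_expansion n U a \<beta>"
  shows "\<alpha> = \<beta>"
proof
  fix m
  show "\<alpha> m = \<beta> m"
  proof (cases "m \<in> Z")
    case True
    have "((\<lambda>m. \<alpha> m *\<^sub>C M m + - (\<beta> m *\<^sub>C M m)) has_sum a + - a) Z"
      using assms unfolding fourier_expansion_def by (intro has_sum_add has_sum_uminusI) auto
    then have "((\<lambda>m. (\<alpha> m - \<beta> m) *\<^sub>C M m) has_sum 0) Z" by (simp add: scaleC_diff_left)
    from coeff_le_norm[OF this True] show ?thesis by simp
  next
    case False
    then show ?thesis using assms unfolding fourier_expansion_def schwartz_def by auto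
  qed
qed

lemma fourier_coeff_eq:
  "fourier_expansion n U a \<alpha> \<Longrightarrow> fourier_coeff n U a = \<alpha>"
  unfolding fourier_coeff_def
  by (rule the_equality, assumption, erule fourier_expansion_unique, assumption)

end


section \<open>Rapidly decreasing families\<close>

definition weight :: "nat \<Rightarrow> (nat \<Rightarrow> int) \<Rightarrow> real" where
  "weight n m = 1 + (\<Sum>i\<in>{1..2*n}. (of_int (m i))\<^sup>2)"

lemma weight_ge_1: "weight n m \<ge> 1"
  unfolding weight_def by (simp add: sum_nonneg)

lemma weight_pos: "weight n m > 0"
  using weight_ge_1[of n m] by linarith

lemma weight_power_ge_1: "weight n m ^ k \<ge> 1"
  by (simp add: weight_ge_1 one_le_power)

lemma weight_minus [simp]: "weight n (\<lambda>i. - m i) = weight n m"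
  by (simp add: weight_def)

text \<open>This is Peetre's inequality in the form that makes the weighted decay submultiplicative, up to a
  constant, under convolution.\<close>

lemma weight_add: "weight n (\<lambda>i. k i + l i) \<le> 2 * weight n k * weight n l"
proof -
  define K L where "K = (\<Sum>i\<in>{1..2*n}. (of_int (k i) :: real)\<^sup>2)"
    and "L = (\<Sum>i\<in>{1..2*n}. (of_int (l i) :: real)\<^sup>2)"
  have "(\<Sum>i\<in>{1..2*n}. (of_int (k i + l i) :: real)\<^sup>2)
      \<le> (\<Sum>i\<in>{1..2*n}. 2 * (of_int (k i))\<^sup>2 + 2 * (of_int (l i))\<^sup>2)"
  proof (rule sum_mono)
    fix i
    show "(of_int (k i + l i) :: real)\<^sup>2 \<le> 2 * (of_int (k i))\<^sup>2 + 2 * (of_int (l i))\<^sup>2"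
      using sum_squares_bound[of "of_int (k i) :: real" "of_int (l i)"]
      by (simp add: power2_sum)
  qed
  also have "\<dots> = 2 * K + 2 * L" by (simp add: sum.distrib sum_distrib_left K_def L_def)
  finally have "weight n (\<lambda>i. k i + l i) \<le> 1 + 2 * K + 2 * L" by (simp add: weight_def)
  also have "\<dots> \<le> 2 * (1 + K) * (1 + L)"
  proof -
    have "K \<ge> 0" "L \<ge> 0" by (auto simp: K_def L_def intro: sum_nonneg)
    then have "K * L \<ge> 0" by simp
    then show ?thesis by (simp add: algebra_simps)
  qed
  finally show ?thesis by (simp add: weight_def K_def L_def)
qed

lemma coordinate_le_weight: "j \<in> {1..2*n} \<Longrightarrow> \<bar>of_int (m j)\<bar> \<le> weight n m"
proof -
  assume j: "j \<in> {1..2*n}"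
  have "(of_int (m j) :: real)\<^sup>2 \<le> (\<Sum>i\<in>{1..2*n}. (of_int (m i))\<^sup>2)"
    by (rule member_le_sum[OF j]) auto
  moreover have "\<bar>of_int (m j) :: real\<bar> \<le> 1 + (of_int (m j))\<^sup>2"
    using sum_squares_bound[of "\<bar>of_int (m j)\<bar> :: real" 1] by simp
  ultimately show ?thesis by (simp add: weight_def)
qed

lemma summable_inverse_squares_int: "(\<lambda>x::int. 1 / (1 + (of_int x)\<^sup>2) :: real) summable_on UNIV"
proof -
  let ?f = "\<lambda>x::int. 1 / (1 + (of_int x)\<^sup>2) :: real"
  have "summable (\<lambda>k. norm (1 / (1 + (real k)\<^sup>2)))"
  proof (rule summable_comparison_test')
    show "summable (\<lambda>k. inverse (real k ^ 2))" by (rule inverse_power_summable) simp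
    show "norm (norm (1 / (1 + (real k)\<^sup>2))) \<le> inverse (real k ^ 2)" if "k \<ge> 1" for k
      using that by (simp add: divide_simps add_pos_nonneg)
  qed
  then have s: "(\<lambda>k::nat. 1 / (1 + (real k)\<^sup>2)) summable_on UNIV"
    by (rule norm_summable_imp_summable_on)
  have "?f summable_on range int" "?f summable_on range (\<lambda>k. - int k)"
    by (subst summable_on_reindex; use s in \<open>simp add: o_def inj_on_def\<close>)+
  then have "?f summable_on (range int \<union> range (\<lambda>k. - int k))" by (rule summable_on_union)
  moreover have "range int \<union> range (\<lambda>k. - int k) = UNIV"
    by (auto simp: image_iff) (metis int_cases2)
  ultimately show ?thesis by simp
qed

text \<open>Since the weight dominates each \<open>1 + (m i)\<^sup>2\<close>, its power \<open>2 n\<close> dominates their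
  product, whose inverse is a product of summable families in one variable.\<close>

lemma summable_inverse_weight: "(\<lambda>m. 1 / weight n m ^ (2*n)) summable_on int_vectors n"
proof (rule nonneg_bdd_above_summable_on)
  let ?I = "{1..2*n}"
  define h where "h x = (1 / (1 + (of_int x)\<^sup>2) :: real)" for x :: int
  have h0: "h x \<ge> 0" for x by (simp add: h_def add_pos_nonneg)
  \<comment> \<open>The exponents of \<open>F\<close> lie in the box of its projections, over which the product sums factor by factor.\<close>
  define C where "C = infsum h UNIV"
  have C: "sum h B \<le> C" if "finite B" for B
    unfolding C_def using summable_inverse_squares_int that
    by (intro finite_sum_le_infsum) (auto simp: h_def[abs_def] add_pos_nonneg)
  show "bdd_above (sum (\<lambda>m. 1 / weight n m ^ (2*n)) ` {F. F \<subseteq> int_vectors n \<and> finite F})"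
  proof (rule bdd_aboveI2)
    fix F assume "F \<in> {F. F \<subseteq> int_vectors n \<and> finite F}"
    then have F: "F \<subseteq> int_vectors n" "finite F" by auto
    have inj: "inj_on (\<lambda>m. restrict m ?I) F"
    proof (rule inj_onI, rule ext)
      fix m m' i assume "m \<in> F" "m' \<in> F" and eq: "restrict m ?I = restrict m' ?I"
      then have "m \<in> int_vectors n" "m' \<in> int_vectors n" using F by auto
      then show "m i = m' i"
        using fun_cong[OF eq, of i] unfolding int_vectors_def restrict_def by (cases "i \<in> ?I") auto
    qed
    have "(\<Sum>m\<in>F. 1 / weight n m ^ (2*n)) \<le> (\<Sum>m\<in>F. \<Prod>i\<in>?I. h (m i))"
    proof (rule sum_mono)
      fix m
      have "(\<Prod>i\<in>?I. 1 / weight n m) \<le> (\<Prod>i\<in>?I. h (m i))"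
      proof (rule prod_mono, safe)
        fix i assume i: "i \<in> ?I"
        have "(of_int (m i) :: real)\<^sup>2 \<le> (\<Sum>i\<in>?I. (of_int (m i))\<^sup>2)"
          by (rule member_le_sum[OF i]) auto
        then have "1 + (of_int (m i) :: real)\<^sup>2 \<le> weight n m" by (simp add: weight_def)
        moreover have "0 < 1 + (of_int (m i) :: real)\<^sup>2" by (simp add: add_pos_nonneg)
        ultimately show "1 / weight n m \<le> h (m i)" by (simp add: h_def frac_le)
      qed (use weight_pos[of n m] in auto)
      then show "1 / weight n m ^ (2*n) \<le> (\<Prod>i\<in>?I. h (m i))" by (simp add: power_one_over)
    qed
    also have "\<dots> = (\<Sum>m\<in>(\<lambda>m. restrict m ?I) ` F. \<Prod>i\<in>?I. h (m i))"
      by (subst sum.reindex[OF inj]) (auto intro!: sum.cong prod.cong)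
    also have "\<dots> \<le> (\<Sum>m\<in>(\<Pi>\<^sub>E i\<in>?I. (\<lambda>m. m i) ` F). \<Prod>i\<in>?I. h (m i))"
      using F by (intro sum_mono2 finite_PiE) (auto intro: prod_nonneg h0)
    also have "\<dots> = (\<Prod>i\<in>?I. \<Sum>x\<in>(\<lambda>m. m i) ` F. h x)"
      using F by (intro prod_sum_PiE[symmetric]) auto
    also have "\<dots> \<le> (\<Prod>i\<in>?I. C)"
      using F by (intro prod_mono) (auto intro: C sum_nonneg h0)
    finally show "(\<Sum>m\<in>F. 1 / weight n m ^ (2*n)) \<le> (\<Prod>i\<in>?I. C)" .
  qed
qed (simp add: less_imp_le weight_pos)

text \<open>The weight is at least \<open>1\<close>, so decay of the squared moduli and decay of the moduli themselves
  against all powers of the weight are the same condition; the linear form is the one that sums well.\<close>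

lemma schwartz_iff:
  "schwartz n \<alpha> \<longleftrightarrow> (\<forall>m. m \<notin> int_vectors n \<longrightarrow> \<alpha> m = 0) \<and>
     (\<forall>k. \<exists>C. \<forall>m\<in>int_vectors n. weight n m ^ k * cmod (\<alpha> m) \<le> C)" (is "?L \<longleftrightarrow> ?z \<and> ?R")
proof -
  let ?L' = "\<forall>k. \<exists>C. \<forall>m\<in>int_vectors n. weight n m ^ k * (cmod (\<alpha> m))\<^sup>2 \<le> C"
  have "?L' \<longleftrightarrow> ?R"
  proof
    assume L: ?L'
    show ?R
    proof
      fix k
      obtain C where C: "\<And>m. m \<in> int_vectors n \<Longrightarrow> weight n m ^ (2*k) * (cmod (\<alpha> m))\<^sup>2 \<le> C"
        using L by meson
      have "weight n m ^ k * cmod (\<alpha> m) \<le> sqrt C" if "m \<in> int_vectors n" for m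
        using C[OF that] by (intro real_le_rsqrt) (simp add: power_mult_distrib power_mult[symmetric] mult.commute)
      then show "\<exists>C. \<forall>m\<in>int_vectors n. weight n m ^ k * cmod (\<alpha> m) \<le> C" by blast
    qed
  next
    assume R: ?R
    show ?L'
    proof
      fix k
      obtain C where C: "\<And>m. m \<in> int_vectors n \<Longrightarrow> weight n m ^ k * cmod (\<alpha> m) \<le> C"
        using R by meson
      have "weight n m ^ k * (cmod (\<alpha> m))\<^sup>2 \<le> C\<^sup>2" if "m \<in> int_vectors n" for m
      proof -
        have "weight n m ^ k * (cmod (\<alpha> m))\<^sup>2 \<le> (weight n m ^ k * weight n m ^ k) * (cmod (\<alpha> m))\<^sup>2"
          using weight_power_ge_1[of n m k] by (intro mult_right_mono) auto
        also have "\<dots> = (weight n m ^ k * cmod (\<alpha> m))\<^sup>2" by (simp add: power2_eq_square)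
        also have "\<dots> \<le> C\<^sup>2" using C[OF that] weight_pos[of n m]
          by (intro power_mono) (auto intro: mult_nonneg_nonneg)
        finally show ?thesis .
      qed
      then show "\<exists>C. \<forall>m\<in>int_vectors n. weight n m ^ k * (cmod (\<alpha> m))\<^sup>2 \<le> C" by blast
    qed
  qed
  then show ?thesis unfolding schwartz_def weight_def by blast
qed

lemma schwartzI:
  assumes "\<And>m. m \<notin> int_vectors n \<Longrightarrow> \<alpha> m = 0"
    and "\<And>k. \<exists>C. \<forall>m\<in>int_vectors n. weight n m ^ k * cmod (\<alpha> m) \<le> C"
  shows "schwartz n \<alpha>"
  using assms unfolding schwartz_iff by blast

lemma schwartz_zero: "schwartz n \<alpha> \<Longrightarrow> m \<notin> int_vectors n \<Longrightarrow> \<alpha> m = 0"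
  unfolding schwartz_iff by blast

lemma schwartz_bound:
  assumes "schwartz n \<alpha>"
  obtains C where "C \<ge> 0" "\<And>m. weight n m ^ k * cmod (\<alpha> m) \<le> C"
proof -
  obtain C where "\<And>m. m \<in> int_vectors n \<Longrightarrow> weight n m ^ k * cmod (\<alpha> m) \<le> C"
    using assms unfolding schwartz_iff by meson
  then have "weight n m ^ k * cmod (\<alpha> m) \<le> max C 0" for m
    using schwartz_zero[OF assms, of m] by (cases "m \<in> int_vectors n") (auto simp: le_max_iff_disj)
  then show ?thesis using that[of "max C 0"] by simp
qed

text \<open>Boundedness against \<open>2*n\<close> further powers of the weight leaves the summable factor
  \<open>1 / weight ^ (2*n)\<close>.\<close>

lemma schwartz_weighted_summable:
  assumes "schwartz n \<alpha>"
  shows "(\<lambda>m. weight n m ^ k * cmod (\<alpha> m)) summable_on int_vectors n"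
proof -
  obtain C where C: "\<And>m. weight n m ^ (k + 2*n) * cmod (\<alpha> m) \<le> C"
    using schwartz_bound[OF assms, of "k + 2*n"] by blast
  have "(\<lambda>m. C * (1 / weight n m ^ (2*n))) summable_on int_vectors n"
    by (intro summable_on_cmult_right summable_inverse_weight)
  then show ?thesis
  proof (rule summable_on_comparison_test)
    fix m
    have p: "weight n m ^ (2*n) > 0" by (simp add: weight_pos)
    show "weight n m ^ k * cmod (\<alpha> m) \<le> C * (1 / weight n m ^ (2*n))"
      using C[of m] p by (simp add: power_add field_simps)
    show "0 \<le> weight n m ^ k * cmod (\<alpha> m)" using weight_pos[of n m] by simp
  qed
qed

lemma schwartz_summable: "schwartz n \<alpha> \<Longrightarrow> (\<lambda>m. cmod (\<alpha> m)) summable_on int_vectors n"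
  using schwartz_weighted_summable[of n \<alpha> 0] by simp

lemma schwartz_comparison:
  assumes "schwartz n \<alpha>" "C \<ge> 0" "\<And>m. cmod (\<beta> m) \<le> C * (weight n m ^ p * cmod (\<alpha> m))"
  shows "schwartz n \<beta>"
proof (rule schwartzI)
  show "\<beta> m = 0" if "m \<notin> int_vectors n" for m
    using assms(3)[of m] schwartz_zero[OF assms(1) that] by simp
  fix k
  obtain B where B: "\<And>m. weight n m ^ (k + p) * cmod (\<alpha> m) \<le> B"
    using schwartz_bound[OF assms(1), of "k + p"] by blast
  have "weight n m ^ k * cmod (\<beta> m) \<le> C * B" for m
  proof -
    have "weight n m ^ k * cmod (\<beta> m) \<le> weight n m ^ k * (C * (weight n m ^ p * cmod (\<alpha> m)))"
      using assms(3) weight_pos[of n m] by (intro mult_left_mono) auto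
    also have "\<dots> = C * (weight n m ^ (k + p) * cmod (\<alpha> m))" by (simp add: power_add)
    also have "\<dots> \<le> C * B" using B assms(2) by (intro mult_left_mono) auto
    finally show ?thesis .
  qed
  then show "\<exists>B. \<forall>m\<in>int_vectors n. weight n m ^ k * cmod (\<beta> m) \<le> B" by blast
qed

lemma schwartz_add:
  assumes "schwartz n \<alpha>" "schwartz n \<beta>" shows "schwartz n (\<lambda>m. \<alpha> m + \<beta> m)"
proof (rule schwartzI)
  show "\<alpha> m + \<beta> m = 0" if "m \<notin> int_vectors n" for m
    using assms schwartz_zero that by (metis add.left_neutral)
  fix k
  obtain B where B: "\<And>m. weight n m ^ k * cmod (\<alpha> m) \<le> B" using schwartz_bound[OF assms(1)] by blast
  obtain C where C: "\<And>m. weight n m ^ k * cmod (\<beta> m) \<le> C" using schwartz_bound[OF assms(2)] by blast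
  have "weight n m ^ k * cmod (\<alpha> m + \<beta> m) \<le> B + C" for m
  proof -
    have "weight n m ^ k * cmod (\<alpha> m + \<beta> m) \<le> weight n m ^ k * (cmod (\<alpha> m) + cmod (\<beta> m))"
      using weight_pos[of n m] by (intro mult_left_mono norm_triangle_ineq) auto
    also have "\<dots> \<le> B + C" using add_mono[OF B C] by (simp add: ring_distribs)
    finally show ?thesis .
  qed
  then show "\<exists>B. \<forall>m\<in>int_vectors n. weight n m ^ k * cmod (\<alpha> m + \<beta> m) \<le> B" by blast
qed

lemma schwartz_reflect:
  assumes "schwartz n \<alpha>" "\<And>m. cmod (\<beta> m) \<le> cmod (\<alpha> (\<lambda>i. - m i))"
  shows "schwartz n \<beta>"
proof (rule schwartzI)
  have neg: "(\<lambda>i. - m i) \<in> int_vectors n \<longleftrightarrow> m \<in> int_vectors n" for m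
    by (simp add: int_vectors_def)
  show "\<beta> m = 0" if "m \<notin> int_vectors n" for m
    using assms(2)[of m] schwartz_zero[OF assms(1), of "\<lambda>i. - m i"] that neg by simp
  fix k
  obtain B where B: "\<And>m. weight n m ^ k * cmod (\<alpha> m) \<le> B" using schwartz_bound[OF assms(1)] by blast
  have "weight n m ^ k * cmod (\<beta> m) \<le> B" for m
  proof -
    have "weight n m ^ k * cmod (\<beta> m) \<le> weight n m ^ k * cmod (\<alpha> (\<lambda>i. - m i))"
      using weight_pos[of n m] assms(2) by (intro mult_left_mono) auto
    also have "\<dots> \<le> B" using B[of "\<lambda>i. - m i"] by simp
    finally show ?thesis .
  qed
  then show "\<exists>B. \<forall>m\<in>int_vectors n. weight n m ^ k * cmod (\<beta> m) \<le> B" by blast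
qed

lemma int_vectors_diff:
  "k \<in> int_vectors n \<Longrightarrow> (\<lambda>i. m i - k i) \<in> int_vectors n \<longleftrightarrow> m \<in> int_vectors n"
  by (auto simp: int_vectors_def)

text \<open>The product of the twisted group algebra with cocycle \<open>\<omega>\<close>.\<close>

definition twisted_conv ::
  "nat \<Rightarrow> ((nat \<Rightarrow> int) \<Rightarrow> (nat \<Rightarrow> int) \<Rightarrow> complex) \<Rightarrow> ((nat \<Rightarrow> int) \<Rightarrow> complex) \<Rightarrow>
   ((nat \<Rightarrow> int) \<Rightarrow> complex) \<Rightarrow> (nat \<Rightarrow> int) \<Rightarrow> complex" where
  "twisted_conv n \<omega> \<alpha> \<beta> m =
     (\<Sum>\<^sub>\<infinity>k\<in>int_vectors n. \<alpha> k * \<beta> (\<lambda>i. m i - k i) * \<omega> k (\<lambda>i. m i - k i))"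

lemma twisted_conv_abs_summable:
  assumes "schwartz n \<alpha>" "schwartz n \<beta>" "\<And>k l. cmod (\<omega> k l) = 1"
  shows "(\<lambda>k. cmod (\<alpha> k * \<beta> (\<lambda>i. m i - k i) * \<omega> k (\<lambda>i. m i - k i))) summable_on int_vectors n"
proof -
  obtain C where C: "C \<ge> 0" "\<And>m. cmod (\<beta> m) \<le> C" using schwartz_bound[OF assms(2), of 0] by auto
  have "(\<lambda>k. cmod (\<alpha> k) * C) summable_on int_vectors n"
    by (intro summable_on_cmult_left schwartz_summable assms)
  then show ?thesis
    by (rule Infinite_Sum.abs_summable_on_comparison_test') (auto simp: norm_mult assms(3) intro!: mult_left_mono C)
qed

text \<open>Writing \<open>m = k + (m - k)\<close> splits the weight of \<open>m\<close> into weights of the two factors; one factor is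
  bounded uniformly and the other is summed.\<close>

lemma schwartz_twisted_conv:
  assumes \<alpha>: "schwartz n \<alpha>" and \<beta>: "schwartz n \<beta>" and \<omega>: "\<And>k l. cmod (\<omega> k l) = 1"
  shows "schwartz n (twisted_conv n \<omega> \<alpha> \<beta>)"
proof (rule schwartzI)
  let ?Z = "int_vectors n"
  fix m assume "m \<notin> ?Z"
  then have "\<beta> (\<lambda>i. m i - k i) = 0" if "k \<in> ?Z" for k
    using that schwartz_zero[OF \<beta>] int_vectors_diff by blast
  then show "twisted_conv n \<omega> \<alpha> \<beta> m = 0"
    unfolding twisted_conv_def by (intro infsum_0) auto
next
  let ?Z = "int_vectors n"
  fix p
  obtain C where C: "C \<ge> 0" "\<And>m. weight n m ^ p * cmod (\<beta> m) \<le> C"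
    using schwartz_bound[OF \<beta>, of p] by blast
  define S where "S = (\<Sum>\<^sub>\<infinity>k\<in>?Z. weight n k ^ p * cmod (\<alpha> k))"
  have "weight n m ^ p * cmod (twisted_conv n \<omega> \<alpha> \<beta> m) \<le> 2 ^ p * C * S" for m
  proof -
    let ?t = "\<lambda>k. \<alpha> k * \<beta> (\<lambda>i. m i - k i) * \<omega> k (\<lambda>i. m i - k i)"
    have s: "(\<lambda>k. cmod (?t k)) summable_on ?Z" by (rule twisted_conv_abs_summable[OF assms])
    have "weight n m ^ p * cmod (twisted_conv n \<omega> \<alpha> \<beta> m) \<le> weight n m ^ p * (\<Sum>\<^sub>\<infinity>k\<in>?Z. cmod (?t k))"
      unfolding twisted_conv_def using weight_pos[of n m]
      by (intro mult_left_mono norm_infsum_bound s) auto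
    also have "\<dots> = (\<Sum>\<^sub>\<infinity>k\<in>?Z. weight n m ^ p * cmod (?t k))"
      by (rule infsum_cmult_right[OF s, symmetric])
    also have "\<dots> \<le> (\<Sum>\<^sub>\<infinity>k\<in>?Z. 2 ^ p * C * (weight n k ^ p * cmod (\<alpha> k)))"
    proof (rule infsum_mono)
      show "(\<lambda>k. weight n m ^ p * cmod (?t k)) summable_on ?Z" by (rule summable_on_cmult_right[OF s])
      show "(\<lambda>k. 2 ^ p * C * (weight n k ^ p * cmod (\<alpha> k))) summable_on ?Z"
        by (intro summable_on_cmult_right schwartz_weighted_summable \<alpha>)
      fix k
      let ?l = "\<lambda>i. m i - k i"
      have "weight n m ^ p \<le> (2 * weight n k * weight n ?l) ^ p"
        using weight_add[of n k ?l] weight_pos[of n m] by (intro power_mono) auto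
      then have "weight n m ^ p * cmod (?t k) \<le> (2 * weight n k * weight n ?l) ^ p * cmod (?t k)"
        by (intro mult_right_mono) auto
      also have "\<dots> = 2 ^ p * (weight n ?l ^ p * cmod (\<beta> ?l)) * (weight n k ^ p * cmod (\<alpha> k))"
        by (simp add: norm_mult \<omega> power_mult_distrib)
      also have "\<dots> \<le> 2 ^ p * C * (weight n k ^ p * cmod (\<alpha> k))"
        using C weight_pos[of n k] by (intro mult_right_mono mult_left_mono) auto
      finally show "weight n m ^ p * cmod (?t k) \<le> 2 ^ p * C * (weight n k ^ p * cmod (\<alpha> k))" .
    qed
    also have "\<dots> = 2 ^ p * C * S"
      unfolding S_def by (intro infsum_cmult_right schwartz_weighted_summable \<alpha>)
    finally show ?thesis .
  qed
  then show "\<exists>B. \<forall>m\<in>?Z. weight n m ^ p * cmod (twisted_conv n \<omega> \<alpha> \<beta> m) \<le> B" by blast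
qed


section \<open>The smooth algebra and its derivations\<close>

context torus
begin

abbreviation FE :: "'a \<Rightarrow> ((nat \<Rightarrow> int) \<Rightarrow> complex) \<Rightarrow> bool" where
  "FE \<equiv> fourier_expansion n U"

abbreviation deriv :: "nat \<Rightarrow> 'a \<Rightarrow> 'a" where
  "deriv \<equiv> torus_deriv n U"

lemma FE_schwartz: "FE a \<alpha> \<Longrightarrow> schwartz n \<alpha>"
  by (simp add: fourier_expansion_def)

lemma FE_has_sum: "FE a \<alpha> \<Longrightarrow> ((\<lambda>m. \<alpha> m *\<^sub>C M m) has_sum a) Z"
  by (simp add: fourier_expansion_def)

lemma FE_smooth: "FE a \<alpha> \<Longrightarrow> a \<in> A"
  by (auto simp: smooth_torus_def)

lemma smoothE: assumes "a \<in> A" obtains \<alpha> where "FE a \<alpha>"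
  using assms by (auto simp: smooth_torus_def)

lemma FE_unique_element: "FE a \<alpha> \<Longrightarrow> FE b \<alpha> \<Longrightarrow> a = b"
  using FE_has_sum has_sum_unique by blast

lemma FE_infsum:
  assumes "schwartz n \<alpha>" shows "FE (\<Sum>\<^sub>\<infinity>m\<in>Z. \<alpha> m *\<^sub>C M m) \<alpha>"
  unfolding fourier_expansion_def
  using assms abs_summable_summable[of "\<lambda>m. \<alpha> m *\<^sub>C M m" Z] schwartz_summable[OF assms]
  by (auto simp: norm_scaleC)

lemma FE_add:
  assumes "FE a \<alpha>" "FE b \<beta>" shows "FE (a + b) (\<lambda>m. \<alpha> m + \<beta> m)"
  using assms unfolding fourier_expansion_def scaleC_add_left
  by (intro conjI schwartz_add has_sum_add) auto

lemma FE_scaleC: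
  assumes "FE a \<alpha>" shows "FE (c *\<^sub>C a) (\<lambda>m. c * \<alpha> m)"
  unfolding fourier_expansion_def
proof
  show "schwartz n (\<lambda>m. c * \<alpha> m)"
    by (rule schwartz_comparison[OF FE_schwartz[OF assms], of "cmod c" _ 0]) (auto simp: norm_mult)
  show "((\<lambda>m. (c * \<alpha> m) *\<^sub>C M m) has_sum c *\<^sub>C a) Z"
    using has_sum_bounded_linear[OF bounded_linear_scaleC_right FE_has_sum[OF assms], of c]
    by (simp add: scaleC_scaleC)
qed

lemma FE_M:
  assumes "k \<in> Z" shows "FE (M k) (\<lambda>m. if m = k then 1 else 0)"
  unfolding fourier_expansion_def
proof
  show "schwartz n (\<lambda>m. if m = k then 1 else 0)"
  proof (rule schwartzI)
    show "\<exists>C. \<forall>m\<in>Z. weight n m ^ p * cmod (if m = k then 1 else 0) \<le> C" for p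
      using weight_pos[of n k] by (intro exI[of _ "weight n k ^ p"]) auto
  qed (use assms in auto)
  show "((\<lambda>m. (if m = k then 1 else 0) *\<^sub>C M m) has_sum M k) Z"
    by (rule has_sum_finite_neutralI[where B = "{k}"]) (use assms in auto)
qed

lemma FE_star:
  assumes "FE a \<alpha>" shows "\<exists>\<beta>. FE (star a) \<beta>"
proof -
  obtain t where t: "\<And>m. star (M m) = cis (t m) *\<^sub>C M (\<lambda>i. - m i)" using star_M by metis
  define \<beta> where "\<beta> m = cnj (\<alpha> (\<lambda>i. - m i)) * cis (t (\<lambda>i. - m i))" for m
  have "schwartz n \<beta>"
    by (rule schwartz_reflect[OF FE_schwartz[OF assms]]) (simp add: \<beta>_def norm_mult)
  moreover have "((\<lambda>m. star (\<alpha> m *\<^sub>C M m)) has_sum star a) Z"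
    by (rule has_sum_bounded_linear[OF bounded_linear_star FE_has_sum[OF assms]])
  then have "((\<lambda>m. \<beta> m *\<^sub>C M m) has_sum star a) Z"
    by (rule has_sum_reindex_bij_witness[where i = "\<lambda>m i. - m i" and j = "\<lambda>m i. - m i",
          THEN iffD1, rotated -1])
       (auto simp: int_vectors_def \<beta>_def t star_scaleC scaleC_scaleC)
  ultimately show ?thesis unfolding fourier_expansion_def by blast
qed

text \<open>The double series converges absolutely over \<open>Z \<times> Z\<close>. Summing it along rows gives the product of
  the sums, and summing it along the antidiagonals \<open>k + l = m\<close> gives the twisted convolution.\<close>

lemma FE_mult:
  assumes a: "FE a \<alpha>" and b: "FE b \<beta>"
  shows "FE (a * b) (twisted_conv n cocycle \<alpha> \<beta>)"
  unfolding fourier_expansion_def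
proof
  note sw = FE_schwartz[OF a] FE_schwartz[OF b]
  show "schwartz n (twisted_conv n cocycle \<alpha> \<beta>)"
    by (rule schwartz_twisted_conv[OF sw]) simp
  define g where "g = (\<lambda>(k, l). (\<alpha> k *\<^sub>C M k) * (\<beta> l *\<^sub>C M l))"
  have g: "g (k, l) = (\<alpha> k * \<beta> l * cocycle k l) *\<^sub>C M (\<lambda>i. k i + l i)" for k l
    by (simp add: g_def scaleC_mult_left scaleC_mult_right M_mult scaleC_scaleC mult_ac)
  have "(\<lambda>kl. cmod (\<alpha> (fst kl)) * cmod (\<beta> (snd kl))) summable_on Z \<times> Z"
  proof (rule summable_on_SigmaI)
    show "((\<lambda>l. cmod (\<alpha> (fst (k, l))) * cmod (\<beta> (snd (k, l)))) has_sum
        cmod (\<alpha> k) * (\<Sum>\<^sub>\<infinity>l\<in>Z. cmod (\<beta> l))) Z" for k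
      using has_sum_cmult_right[OF has_sum_infsum[OF schwartz_summable[OF sw(2)]]] by simp
    show "(\<lambda>k. cmod (\<alpha> k) * (\<Sum>\<^sub>\<infinity>l\<in>Z. cmod (\<beta> l))) summable_on Z"
      by (intro summable_on_cmult_left schwartz_summable sw)
  qed simp
  then have "(\<lambda>kl. norm (g kl)) summable_on Z \<times> Z"
    by (rule Infinite_Sum.abs_summable_on_comparison_test') (auto simp: g norm_scaleC norm_mult)
  then obtain S where S: "(g has_sum S) (Z \<times> Z)"
    using abs_summable_summable[of g "Z \<times> Z"] unfolding summable_on_def by auto
  have "((\<lambda>k. (\<alpha> k *\<^sub>C M k) * b) has_sum S) Z"
    by (rule has_sum_SigmaD[OF S]) (simp add: g_def has_sum_cmult_right FE_has_sum[OF b])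
  moreover have "((\<lambda>k. (\<alpha> k *\<^sub>C M k) * b) has_sum a * b) Z"
    by (rule has_sum_cmult_left[OF FE_has_sum[OF a]])
  ultimately have S_eq: "S = a * b" by (rule has_sum_unique)
  \<comment> \<open>The same double series, indexed by the total exponent and the first factor.\<close>
  define h where "h = (\<lambda>(m, k). g (k, \<lambda>i. m i - k i :: int))"
  have "(g has_sum S) (Z \<times> Z) \<longleftrightarrow> (h has_sum a * b) (Z \<times> Z)"
  proof (rule has_sum_reindex_bij_witness[where i = "\<lambda>(m, k). (k, \<lambda>i. m i - k i)" and
        j = "\<lambda>(k, l). (\<lambda>i. k i + l i, k)"])
    show "h (case kl of (k, l) \<Rightarrow> (\<lambda>i. k i + l i, k)) = g kl" for kl
      by (cases kl) (simp add: h_def)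
  qed (auto simp: int_vectors_def S_eq)
  with S have "(h has_sum a * b) (Z \<times> Z)" by simp
  then show "((\<lambda>m. twisted_conv n cocycle \<alpha> \<beta> m *\<^sub>C M m) has_sum a * b) Z"
  proof (rule has_sum_SigmaD)
    fix m
    have "((\<lambda>k. \<alpha> k * \<beta> (\<lambda>i. m i - k i) * cocycle k (\<lambda>i. m i - k i)) has_sum
        twisted_conv n cocycle \<alpha> \<beta> m) Z"
      unfolding twisted_conv_def
      by (rule has_sum_infsum[OF abs_summable_summable[OF twisted_conv_abs_summable[of n \<alpha> \<beta> cocycle m, OF sw]]])
         simp
    from has_sum_bounded_linear[OF bounded_linear_scaleC_left this, of "M m"]
    show "((\<lambda>k. h (m, k)) has_sum twisted_conv n cocycle \<alpha> \<beta> m *\<^sub>C M m) Z"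
      by (simp add: h_def g)
  qed
qed

lemma FE_deriv:
  assumes a: "FE a \<alpha>" and j: "j \<in> {1..2*n}"
  shows "FE (deriv j a) (\<lambda>m. \<i> * of_int (m j) * \<alpha> m)"
  unfolding torus_deriv_def fourier_coeff_eq[OF a]
proof (rule FE_infsum, rule schwartz_comparison[OF FE_schwartz[OF a], of 1 _ 1])
  show "cmod (\<i> * of_int (m j) * \<alpha> m) \<le> 1 * (weight n m ^ 1 * cmod (\<alpha> m))" for m
    using coordinate_le_weight[OF j, of m] by (simp add: norm_mult mult_right_mono)
qed simp

lemma zero_vec_Z [simp]: "(\<lambda>_. 0) \<in> Z"
  by (simp add: int_vectors_def)

lemma M_smooth: "k \<in> Z \<Longrightarrow> M k \<in> A"
  using FE_M FE_smooth by blast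

lemma one_smooth [simp]: "1 \<in> A"
  using M_smooth[of "\<lambda>_. 0"] by simp

lemma add_smooth [intro]: "a \<in> A \<Longrightarrow> b \<in> A \<Longrightarrow> a + b \<in> A"
  by (metis FE_add FE_smooth smoothE)

lemma scaleC_smooth [intro]: "a \<in> A \<Longrightarrow> c *\<^sub>C a \<in> A"
  by (metis FE_scaleC FE_smooth smoothE)

lemma zero_smooth [simp]: "0 \<in> A"
  using scaleC_smooth[OF one_smooth, of 0] by simp

lemma minus_smooth [intro]: "a \<in> A \<Longrightarrow> - a \<in> A"
  using scaleC_smooth[of a "- 1"] by simp

lemma diff_smooth [intro]: "a \<in> A \<Longrightarrow> b \<in> A \<Longrightarrow> a - b \<in> A"
  using add_smooth[of a "- b"] by auto

lemma mult_smooth [intro]: "a \<in> A \<Longrightarrow> b \<in> A \<Longrightarrow> a * b \<in> A"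
  by (metis FE_mult FE_smooth smoothE)

lemma star_smooth [intro]: "a \<in> A \<Longrightarrow> star a \<in> A"
  by (metis FE_star FE_smooth smoothE)

lemma sum_smooth: "(\<And>i. i \<in> I \<Longrightarrow> f i \<in> A) \<Longrightarrow> sum f I \<in> A"
  by (induction I rule: infinite_finite_induct) auto

lemma deriv_smooth: "a \<in> A \<Longrightarrow> j \<in> {1..2*n} \<Longrightarrow> deriv j a \<in> A"
  by (erule smoothE) (rule FE_smooth[OF FE_deriv])

text \<open>On coefficients this is \<open>m j = k j + (m - k) j\<close> under the convolution sum; uniqueness of the
  coefficients transfers it to the algebra.\<close>

lemma deriv_mult:
  assumes "a \<in> A" "b \<in> A" and j: "j \<in> {1..2*n}"
  shows "deriv j (a * b) = deriv j a * b + a * deriv j b"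
proof -
  obtain \<alpha> where a: "FE a \<alpha>" using assms(1) by (rule smoothE)
  obtain \<beta> where b: "FE b \<beta>" using assms(2) by (rule smoothE)
  note da = FE_deriv[OF a j] and db = FE_deriv[OF b j]
  note ab = FE_mult[OF a b]
  let ?\<alpha>' = "\<lambda>m. \<i> * of_int (m j) * \<alpha> m" and ?\<beta>' = "\<lambda>m. \<i> * of_int (m j) * \<beta> m"
  let ?t = "\<lambda>m k. \<alpha> k * \<beta> (\<lambda>i. m i - k i) * cocycle k (\<lambda>i. m i - k i)"
  have summable: "(\<lambda>k. \<xi> k * \<eta> (\<lambda>i. m i - k i) * cocycle k (\<lambda>i. m i - k i)) summable_on Z"
    if "schwartz n \<xi>" "schwartz n \<eta>" for \<xi> \<eta> m
    by (rule abs_summable_summable[OF twisted_conv_abs_summable[of n \<xi> \<eta> cocycle m, OF that]]) simp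
  have "\<i> * of_int (m j) * twisted_conv n cocycle \<alpha> \<beta> m
      = twisted_conv n cocycle ?\<alpha>' \<beta> m + twisted_conv n cocycle \<alpha> ?\<beta>' m" for m
  proof -
    have "twisted_conv n cocycle ?\<alpha>' \<beta> m + twisted_conv n cocycle \<alpha> ?\<beta>' m
        = (\<Sum>\<^sub>\<infinity>k\<in>Z. ?\<alpha>' k * \<beta> (\<lambda>i. m i - k i) * cocycle k (\<lambda>i. m i - k i)
            + \<alpha> k * ?\<beta>' (\<lambda>i. m i - k i) * cocycle k (\<lambda>i. m i - k i))"
      unfolding twisted_conv_def
      by (rule infsum_add[symmetric]; rule summable; rule FE_schwartz; fact)
    also have "\<dots> = (\<Sum>\<^sub>\<infinity>k\<in>Z. \<i> * of_int (m j) * ?t m k)"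
      by (rule infsum_cong) (simp add: algebra_simps)
    also have "\<dots> = \<i> * of_int (m j) * twisted_conv n cocycle \<alpha> \<beta> m"
      unfolding twisted_conv_def
      by (rule infsum_cmult_right) (rule summable[OF FE_schwartz[OF a] FE_schwartz[OF b]])
    finally show ?thesis by simp
  qed
  then have "FE (deriv j (a * b)) (\<lambda>m. twisted_conv n cocycle ?\<alpha>' \<beta> m + twisted_conv n cocycle \<alpha> ?\<beta>' m)"
    using FE_deriv[OF ab j] by simp
  moreover have "FE (deriv j a * b + a * deriv j b)
      (\<lambda>m. twisted_conv n cocycle ?\<alpha>' \<beta> m + twisted_conv n cocycle \<alpha> ?\<beta>' m)"
    by (rule FE_add[OF FE_mult[OF da b] FE_mult[OF a db]])
  ultimately show ?thesis by (rule FE_unique_element)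
qed

lemma U_eq_M:
  assumes "l \<in> {1..2*n}" shows "U l = M (\<lambda>i. if i = l then 1 else 0)"
proof -
  have "prod_list (map (\<lambda>j. unitary_power (U j) (if j = l then 1 else 0)) js)
      = (if l \<in> set js then U l else 1)" if "distinct js" for js
    using that by (induction js) auto
  from this[of "[1..<2*n+1]"] assms show ?thesis
    unfolding monomial_def set_index by (simp del: upt_Suc)
qed

lemma U_smooth: "l \<in> {1..2*n} \<Longrightarrow> U l \<in> A"
  using U_eq_M M_smooth[of "\<lambda>i. if i = l then 1 else 0"] by (auto simp: int_vectors_def)

lemma deriv_U:
  assumes "l \<in> {1..2*n}" "j \<in> {1..2*n}"
  shows "deriv j (U l) = (if j = l then \<i> *\<^sub>C U l else 0)"
proof -
  let ?e = "\<lambda>i. if i = l then 1 else 0 :: int"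
  have e: "?e \<in> Z" using assms by (auto simp: int_vectors_def)
  have "FE (deriv j (M ?e)) (\<lambda>m. \<i> * of_int (m j) * (if m = ?e then 1 else 0))"
    by (rule FE_deriv[OF FE_M[OF e] assms(2)])
  also have "(\<lambda>m. \<i> * of_int (m j) * (if m = ?e then 1 else 0))
      = (\<lambda>m. (\<i> * of_int (?e j)) * (if m = ?e then 1 else 0))"
    by (rule ext) auto
  finally have "deriv j (M ?e) = (\<i> * of_int (?e j)) *\<^sub>C M ?e"
    by (rule FE_unique_element) (rule FE_scaleC[OF FE_M[OF e]])
  then show ?thesis using U_eq_M[OF assms(1)] by simp
qed

end


section \<open>Extension of bounded operators\<close>

lemma bounded_linear_eq_on_dense:
  fixes S T :: "'x::real_normed_vector \<Rightarrow> 'y::real_normed_vector"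
  assumes "bounded_linear S" "bounded_linear T" "closure D = UNIV" "\<And>v. v \<in> D \<Longrightarrow> S v = T v"
  shows "S = T"
proof -
  have "closed {x. S x = T x}"
    using assms(1,2) by (intro closed_Collect_eq linear_continuous_on)
  moreover have "D \<subseteq> {x. S x = T x}" using assms(4) by blast
  ultimately have "closure D \<subseteq> {x. S x = T x}" by (rule closure_minimal[rotated])
  then show ?thesis using assms(3) by (intro ext) blast
qed

lemma bounded_extension_eqI:
  assumes "bounded_linear T" "closure D = UNIV" "\<And>v. v \<in> D \<Longrightarrow> T v = f v"
  shows "bounded_extension D f = T"
  unfolding bounded_extension_def
proof (rule the_equality)
  fix T' assume "bounded_linear T' \<and> (\<forall>v\<in>D. T' v = f v)"
  then have T': "bounded_linear T'" "\<And>v. v \<in> D \<Longrightarrow> T' v = f v" by blast+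
  show "T' = T"
    by (rule bounded_linear_eq_on_dense[OF T'(1) assms(1,2)]) (simp only: T'(2) assms(3))
next
  show "bounded_linear T \<and> (\<forall>v\<in>D. T v = f v)" by (intro conjI ballI assms)
qed

text \<open>The map is Lipschitz on the subspace, hence extends to a uniformly continuous map on the closure,
  and linearity and the bound pass to limits of sequences.\<close>

lemma bounded_linear_extension_exists:
  fixes f :: "'x::real_normed_vector \<Rightarrow> 'y::banach"
  assumes "subspace D" "closure D = UNIV"
    and add: "\<And>v w. v \<in> D \<Longrightarrow> w \<in> D \<Longrightarrow> f (v + w) = f v + f w"
    and scale: "\<And>r v. v \<in> D \<Longrightarrow> f (r *\<^sub>R v) = r *\<^sub>R f v"
    and bound: "\<And>v. v \<in> D \<Longrightarrow> norm (f v) \<le> C * norm v"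
  shows "\<exists>T. bounded_linear T \<and> (\<forall>v\<in>D. T v = f v)"
proof -
  have diff: "f v - f w = f (v - w)" if "v \<in> D" "w \<in> D" for v w
    using add[of v "(-1) *\<^sub>R w"] scale[of w "-1"] that subspace_scale[OF assms(1), of w "-1"] by simp
  have "\<bar>C\<bar>-lipschitz_on D f"
  proof (rule lipschitz_onI)
    fix v w assume vw: "v \<in> D" "w \<in> D"
    have "norm (f (v - w)) \<le> C * norm (v - w)" using vw assms(1) by (intro bound subspace_diff)
    also have "\<dots> \<le> \<bar>C\<bar> * norm (v - w)" by (intro mult_right_mono) auto
    finally show "dist (f v) (f w) \<le> \<bar>C\<bar> * dist v w" using vw by (simp add: dist_norm diff)
  qed simp
  then have "uniformly_continuous_on D f" by (rule lipschitz_on_uniformly_continuous)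
  then obtain T where T: "uniformly_continuous_on (closure D) T" "\<And>v. v \<in> D \<Longrightarrow> f v = T v"
    by (rule uniformly_continuous_on_extension_on_closure) blast
  have cont: "isCont T x" for x
    using uniformly_continuous_imp_continuous[OF T(1)] assms(2) by (simp add: continuous_on_eq_continuous_at)
  have approx: "\<exists>v. (\<forall>k. v k \<in> D) \<and> v \<longlonglongrightarrow> x \<and> (\<lambda>k. f (v k)) \<longlonglongrightarrow> T x" for x
  proof -
    obtain v where v: "\<And>k. v k \<in> D" "v \<longlonglongrightarrow> x"
      using closure_sequential[of x D] assms(2) by auto
    have "(\<lambda>k. T (v k)) \<longlonglongrightarrow> T x" by (rule isCont_tendsto_compose[OF cont v(2)])
    then have "(\<lambda>k. f (v k)) \<longlonglongrightarrow> T x" by (simp only: T(2)[OF v(1)])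
    with v show ?thesis by blast
  qed
  have "bounded_linear T"
  proof (rule bounded_linear_intro)
    fix x y
    obtain v where v: "\<And>k. v k \<in> D" "v \<longlonglongrightarrow> x" "(\<lambda>k. f (v k)) \<longlonglongrightarrow> T x" using approx by blast
    obtain w where w: "\<And>k. w k \<in> D" "w \<longlonglongrightarrow> y" "(\<lambda>k. f (w k)) \<longlonglongrightarrow> T y" using approx by blast
    have "(\<lambda>k. T (v k + w k)) \<longlonglongrightarrow> T (x + y)"
      by (rule isCont_tendsto_compose[OF cont tendsto_add[OF v(2) w(2)]])
    moreover have "T (v k + w k) = f (v k) + f (w k)" for k
      using T(2) add v(1) w(1) subspace_add[OF assms(1)] by metis
    ultimately show "T (x + y) = T x + T y"
      using LIMSEQ_unique[OF _ tendsto_add[OF v(3) w(3)]] by simp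
    show "norm (T x) \<le> norm x * C"
    proof (rule LIMSEQ_le[OF tendsto_norm[OF v(3)] tendsto_mult_right[OF tendsto_norm[OF v(2)]]])
      show "\<exists>N. \<forall>k\<ge>N. norm (f (v k)) \<le> norm (v k) * C"
        using bound[OF v(1)] by (simp add: mult.commute)
    qed
    fix r
    have "(\<lambda>k. T (r *\<^sub>R v k)) \<longlonglongrightarrow> T (r *\<^sub>R x)"
      by (rule isCont_tendsto_compose[OF cont tendsto_scaleR[OF tendsto_const v(2)]])
    moreover have "T (r *\<^sub>R v k) = r *\<^sub>R f (v k)" for k
      using T(2) scale v(1) subspace_scale[OF assms(1)] by metis
    ultimately show "T (r *\<^sub>R x) = r *\<^sub>R T x"
      using LIMSEQ_unique[OF _ tendsto_scaleR[OF tendsto_const v(3)]] by simp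
  qed
  then show ?thesis using T(2) by metis
qed


section \<open>The representation on the Hilbert space\<close>

locale torus_L2 = torus n \<Theta> U for n \<Theta> and U :: "nat \<Rightarrow> 'a::cstar_algebra" +
  fixes \<eta> :: "'a \<Rightarrow> 'h::complex_hilbert"
  assumes L2: "is_L2 n U \<eta>"
begin

abbreviation \<tau> :: "'a \<Rightarrow> complex" where "\<tau> \<equiv> torus_trace n U"

lemma trace_FE: "FE a \<alpha> \<Longrightarrow> \<tau> a = \<alpha> (\<lambda>_. 0)"
  by (simp add: torus_trace_def fourier_coeff_eq)

lemma trace_le_norm: "a \<in> A \<Longrightarrow> cmod (\<tau> a) \<le> norm a"
  by (erule smoothE) (simp add: trace_FE coeff_le_norm[OF FE_has_sum])

lemma eta_add: "a \<in> A \<Longrightarrow> b \<in> A \<Longrightarrow> \<eta> (a + b) = \<eta> a + \<eta> b"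
  using L2 unfolding is_L2_def by blast

lemma eta_scaleC: "a \<in> A \<Longrightarrow> \<eta> (c *\<^sub>C a) = c *\<^sub>C \<eta> a"
  using L2 unfolding is_L2_def by blast

lemma cinner_eta: "a \<in> A \<Longrightarrow> b \<in> A \<Longrightarrow> cinner (\<eta> a) (\<eta> b) = \<tau> (star a * b)"
  using L2 unfolding is_L2_def by blast

lemma dense_eta: "closure (\<eta> ` A) = UNIV"
  using L2 unfolding is_L2_def by blast

lemma eta_zero [simp]: "\<eta> 0 = 0"
  using eta_scaleC[OF zero_smooth, of 0] by simp

lemma eta_diff: "a \<in> A \<Longrightarrow> b \<in> A \<Longrightarrow> \<eta> (a - b) = \<eta> a - \<eta> b"
  using eta_add[of a "- b"] eta_scaleC[of b "-1"] minus_smooth by simp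

lemma eta_sum: "(\<And>i. i \<in> I \<Longrightarrow> f i \<in> A) \<Longrightarrow> \<eta> (\<Sum>i\<in>I. f i) = (\<Sum>i\<in>I. \<eta> (f i))"
  by (induction I rule: infinite_finite_induct) (auto simp: eta_add sum_smooth)

lemma norm_eta: "a \<in> A \<Longrightarrow> (norm (\<eta> a))\<^sup>2 = Re (\<tau> (star a * a))"
proof -
  assume a: "a \<in> A"
  have "norm (\<eta> a) = sqrt (Re (\<tau> (star a * a)))" by (simp add: norm_eq_sqrt_cinner cinner_eta a)
  moreover from this have "Re (\<tau> (star a * a)) \<ge> 0" by (metis norm_ge_zero real_sqrt_ge_0_iff)
  ultimately show ?thesis by simp
qed

text \<open>Contractivity of the trace applied to \<open>star a * a\<close>, with the C*-identity.\<close>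

lemma norm_eta_le: "a \<in> A \<Longrightarrow> norm (\<eta> a) \<le> norm a"
proof -
  assume a: "a \<in> A"
  have "(norm (\<eta> a))\<^sup>2 \<le> cmod (\<tau> (star a * a))" by (simp add: norm_eta a complex_Re_le_cmod)
  also have "\<dots> \<le> norm (star a * a)" by (rule trace_le_norm) (use a in auto)
  also have "\<dots> = (norm a)\<^sup>2" by (rule norm_star_mult)
  finally show ?thesis by (rule power2_le_imp_le) simp
qed

lemma norm_eta_M_mult: "k \<in> Z \<Longrightarrow> b \<in> A \<Longrightarrow> norm (\<eta> (M k * b)) = norm (\<eta> b)"
proof -
  assume kb: "k \<in> Z" "b \<in> A"
  have "star (M k * b) * (M k * b) = star b * (star (M k) * M k) * b"
    by (simp add: star_mult mult.assoc)
  also have "\<dots> = star b * b" using unitary_M[of k] by (simp add: is_unitary_def)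
  finally have "(norm (\<eta> (M k * b)))\<^sup>2 = (norm (\<eta> b))\<^sup>2"
    using kb by (simp add: norm_eta mult_smooth M_smooth)
  then show ?thesis by simp
qed

text \<open>The Fourier coefficient of \<open>a\<close> at \<open>k\<close> is, up to a phase, the inner product of \<open>\<eta> a\<close> with
  \<open>\<eta> (M k)\<close>.\<close>

lemma eta_eq_0:
  assumes a: "a \<in> A" and zero: "\<eta> a = 0" shows "a = 0"
proof -
  obtain \<alpha> where \<alpha>: "FE a \<alpha>" using a by (rule smoothE)
  have "\<alpha> k = 0" if k: "k \<in> Z" for k
  proof -
    have "\<tau> (star (M k) * a) = cinner (\<eta> (M k)) (0 *\<^sub>C \<eta> a)"
      using cinner_eta[OF M_smooth[OF k] a] zero by simp
    then have tr: "\<tau> (star (M k) * a) = 0" by (simp only: cinner_scaleC_right mult_zero_left)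
    obtain t where t: "star (M k) = cis t *\<^sub>C M (\<lambda>i. - k i)" using star_M by blast
    have k': "(\<lambda>i. - k i) \<in> Z" using k by (simp add: int_vectors_def)
    have "FE (star (M k) * a) (twisted_conv n cocycle (\<lambda>m. cis t * (if m = (\<lambda>i. - k i) then 1 else 0)) \<alpha>)"
      unfolding t by (rule FE_mult[OF FE_scaleC[OF FE_M[OF k']] \<alpha>])
    from trace_FE[OF this] tr
    have "twisted_conv n cocycle (\<lambda>m. cis t * (if m = (\<lambda>i. - k i) then 1 else 0)) \<alpha> (\<lambda>_. 0) = 0"
      by simp
    moreover have "twisted_conv n cocycle (\<lambda>m. cis t * (if m = (\<lambda>i. - k i) then 1 else 0)) \<alpha> (\<lambda>_. 0)
        = cis t * \<alpha> k * cocycle (\<lambda>i. - k i) k"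
      unfolding twisted_conv_def
      by (rule infsumI, rule has_sum_finite_neutralI[where B = "{\<lambda>i. - k i}"]) (use k' in auto)
    moreover have "cocycle (\<lambda>i. - k i) k \<noteq> 0" by (metis norm_cocycle norm_zero zero_neq_one)
    ultimately show ?thesis by simp
  qed
  then have "((\<lambda>m. \<alpha> m *\<^sub>C M m) has_sum 0) Z" by (intro has_sum_0) simp
  then show ?thesis using FE_has_sum[OF \<alpha>] has_sum_unique by blast
qed

lemma inj_eta: "inj_on \<eta> A"
proof (rule inj_onI)
  fix a b assume "a \<in> A" "b \<in> A" "\<eta> a = \<eta> b"
  then have "a - b = 0" by (intro eta_eq_0) (auto simp: eta_diff)
  then show "a = b" by simp
qed

lemma inv_eta [simp]: "a \<in> A \<Longrightarrow> inv_into A \<eta> (\<eta> a) = a"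
  by (rule inv_into_f_f[OF inj_eta])

lemma subspace_eta: "subspace (\<eta> ` A)"
proof (rule subspaceI)
  show "0 \<in> \<eta> ` A" using eta_zero zero_smooth by (metis image_eqI)
  show "v + w \<in> \<eta> ` A" if "v \<in> \<eta> ` A" "w \<in> \<eta> ` A" for v w
    using that by (auto simp flip: eta_add)
  show "r *\<^sub>R v \<in> \<eta> ` A" if "v \<in> \<eta> ` A" for r v
    using that by (auto simp: scaleR_scaleC simp flip: eta_scaleC)
qed

text \<open>Monomials act isometrically, so a finite sum acts with norm at most the sum of its absolute
  coefficients; since \<open>\<eta>\<close> contracts the C*-norm, this passes to the limit.\<close>

lemma eta_mult_bounded:
  assumes a: "a \<in> A"
  shows "\<exists>C. \<forall>b\<in>A. norm (\<eta> (a * b)) \<le> C * norm (\<eta> b)"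
proof -
  obtain \<alpha> where \<alpha>: "FE a \<alpha>" using a by (rule smoothE)
  define C where "C = (\<Sum>\<^sub>\<infinity>m\<in>Z. cmod (\<alpha> m))"
  have "norm (\<eta> (a * b)) \<le> C * norm (\<eta> b)" if b: "b \<in> A" for b
  proof -
    define p where "p F = (\<Sum>m\<in>F. \<alpha> m *\<^sub>C M m)" for F
    have "((\<lambda>F. C * norm (\<eta> b) + norm (a - p F) * norm b) \<longlongrightarrow> C * norm (\<eta> b) + norm (a - a) * norm b)
        (finite_subsets_at_top Z)"
      using FE_has_sum[OF \<alpha>] unfolding has_sum_def p_def by (intro tendsto_intros)
    then have lim: "((\<lambda>F. C * norm (\<eta> b) + norm (a - p F) * norm b) \<longlongrightarrow> C * norm (\<eta> b))
        (finite_subsets_at_top Z)" by simp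
    \<comment> \<open>The partial sum is estimated in the Hilbert space, the remainder in the C*-norm.\<close>
    have "norm (\<eta> (a * b)) \<le> C * norm (\<eta> b) + norm (a - p F) * norm b"
      if F: "finite F" "F \<subseteq> Z" for F
    proof -
      have p: "p F \<in> A" unfolding p_def by (intro sum_smooth scaleC_smooth M_smooth) (use F in auto)
      have "p F * b = (\<Sum>m\<in>F. \<alpha> m *\<^sub>C (M m * b))"
        by (simp add: p_def sum_distrib_right scaleC_mult_left)
      then have "\<eta> (p F * b) = (\<Sum>m\<in>F. \<alpha> m *\<^sub>C \<eta> (M m * b))"
        using F b by (simp add: eta_sum eta_scaleC scaleC_smooth mult_smooth M_smooth subset_iff)
      then have "norm (\<eta> (p F * b)) \<le> (\<Sum>m\<in>F. norm (\<alpha> m *\<^sub>C \<eta> (M m * b)))"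
        by (simp add: norm_sum)
      also have "\<dots> = (\<Sum>m\<in>F. cmod (\<alpha> m) * norm (\<eta> b))"
        using F b by (intro sum.cong) (auto simp: norm_scaleC norm_eta_M_mult)
      also have "\<dots> = (\<Sum>m\<in>F. cmod (\<alpha> m)) * norm (\<eta> b)" by (simp add: sum_distrib_right)
      also have "\<dots> \<le> C * norm (\<eta> b)"
        unfolding C_def using F
        by (intro mult_right_mono finite_sum_le_infsum schwartz_summable[OF FE_schwartz[OF \<alpha>]]) auto
      finally have 1: "norm (\<eta> (p F * b)) \<le> C * norm (\<eta> b)" .
      have "norm (\<eta> ((a - p F) * b)) \<le> norm ((a - p F) * b)"
        using a b p by (intro norm_eta_le) auto
      also have "\<dots> \<le> norm (a - p F) * norm b" by (rule norm_mult_ineq)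
      finally have 2: "norm (\<eta> ((a - p F) * b)) \<le> norm (a - p F) * norm b" .
      have "a * b = p F * b + (a - p F) * b" by (simp add: algebra_simps)
      then have "\<eta> (a * b) = \<eta> (p F * b) + \<eta> ((a - p F) * b)"
        using eta_add[of "p F * b" "(a - p F) * b"] a b p by auto
      then show ?thesis using norm_triangle_ineq[of "\<eta> (p F * b)" "\<eta> ((a - p F) * b)"] 1 2 by simp
    qed
    then have "\<forall>\<^sub>F F in finite_subsets_at_top Z. norm (\<eta> (a * b)) \<le> C * norm (\<eta> b) + norm (a - p F) * norm b"
      by (intro eventually_finite_subsets_at_top_weakI) auto
    from tendsto_lowerbound[OF lim this] show ?thesis by simp
  qed
  then show ?thesis by blast
qed

abbreviation Lm :: "'a \<Rightarrow> 'h \<Rightarrow> 'h" where "Lm \<equiv> left_mult n U \<eta>"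

lemma Lm_bounded_linear_and_eta:
  assumes a: "a \<in> A"
  shows "bounded_linear (Lm a) \<and> (\<forall>b\<in>A. Lm a (\<eta> b) = \<eta> (a * b))"
proof -
  let ?f = "\<lambda>h. \<eta> (a * inv_into A \<eta> h)"
  obtain C where C: "\<And>b. b \<in> A \<Longrightarrow> norm (\<eta> (a * b)) \<le> C * norm (\<eta> b)"
    using eta_mult_bounded[OF a] by blast
  have "\<exists>T. bounded_linear T \<and> (\<forall>v\<in>\<eta> ` A. T v = ?f v)"
  proof (rule bounded_linear_extension_exists[OF subspace_eta dense_eta])
    fix v w assume "v \<in> \<eta> ` A" "w \<in> \<eta> ` A"
    then obtain b c where bc: "b \<in> A" "c \<in> A" "v = \<eta> b" "w = \<eta> c" by blast
    then have "inv_into A \<eta> (v + w) = b + c" by (simp add: add_smooth flip: eta_add)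
    then show "?f (v + w) = ?f v + ?f w" using a bc by (simp add: ring_distribs eta_add mult_smooth)
    fix r
    have "r *\<^sub>R v = \<eta> (of_real r *\<^sub>C b)" using bc by (simp add: eta_scaleC scaleR_scaleC)
    then have "inv_into A \<eta> (r *\<^sub>R v) = of_real r *\<^sub>C b" using bc by (simp add: scaleC_smooth)
    then show "?f (r *\<^sub>R v) = r *\<^sub>R ?f v"
      using a bc by (simp add: scaleC_mult_right eta_scaleC mult_smooth scaleR_scaleC)
    show "norm (?f v) \<le> C * norm v" using C bc by simp
  qed
  then obtain T where T: "bounded_linear T" "\<And>v. v \<in> \<eta> ` A \<Longrightarrow> T v = ?f v" by blast
  have "Lm a = T" unfolding left_mult_def by (rule bounded_extension_eqI[OF T(1) dense_eta T(2)])
  then show ?thesis using T by simp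
qed

lemma Lm_bounded_linear: "a \<in> A \<Longrightarrow> bounded_linear (Lm a)"
  using Lm_bounded_linear_and_eta by blast

lemma Lm_eta: "a \<in> A \<Longrightarrow> b \<in> A \<Longrightarrow> Lm a (\<eta> b) = \<eta> (a * b)"
  using Lm_bounded_linear_and_eta by blast

text \<open>Identities between bounded operators are verified on the dense image of \<open>\<eta>\<close>, where left
  multiplication is the product of the algebra; this yields the multiplicativity, additivity and
  complex linearity of the representation.\<close>

lemma eq_on_eta:
  fixes S T :: "'h \<Rightarrow> 'y::real_normed_vector"
  assumes "bounded_linear S" "bounded_linear T" "\<And>b. b \<in> A \<Longrightarrow> S (\<eta> b) = T (\<eta> b)"
  shows "S x = T x"
proof -
  have "S = T" by (rule bounded_linear_eq_on_dense[OF assms(1,2) dense_eta]) (use assms(3) in blast)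
  then show ?thesis by simp
qed

lemma Lm_add: "a \<in> A \<Longrightarrow> b \<in> A \<Longrightarrow> Lm (a + b) x = Lm a x + Lm b x"
  by (rule eq_on_eta[where T = "\<lambda>x. Lm a x + Lm b x"])
     (auto simp: Lm_bounded_linear Lm_eta bounded_linear_add ring_distribs eta_add mult_smooth add_smooth)

lemma Lm_scaleC: "a \<in> A \<Longrightarrow> Lm (c *\<^sub>C a) x = c *\<^sub>C Lm a x"
  by (rule eq_on_eta[where T = "\<lambda>x. c *\<^sub>C Lm a x"])
     (auto simp: Lm_bounded_linear Lm_eta scaleC_mult_left eta_scaleC mult_smooth scaleC_smooth
       intro!: bounded_linear_compose[OF bounded_linear_scaleC_right])

lemma Lm_mult: "a \<in> A \<Longrightarrow> b \<in> A \<Longrightarrow> Lm (a * b) x = Lm a (Lm b x)"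
  by (rule eq_on_eta[where T = "\<lambda>x. Lm a (Lm b x)"])
     (auto simp: Lm_bounded_linear Lm_eta mult_smooth mult.assoc
       intro!: bounded_linear_compose[OF Lm_bounded_linear])

lemma Lm_scaleC_right: "a \<in> A \<Longrightarrow> Lm a (c *\<^sub>C x) = c *\<^sub>C Lm a x"
proof (rule eq_on_eta[where S = "\<lambda>x. Lm a (c *\<^sub>C x)" and T = "\<lambda>x. c *\<^sub>C Lm a x"])
  assume a: "a \<in> A"
  show "bounded_linear (\<lambda>x. Lm a (c *\<^sub>C x))" "bounded_linear (\<lambda>x. c *\<^sub>C Lm a x)"
    by (rule bounded_linear_compose[OF Lm_bounded_linear[OF a] bounded_linear_scaleC_right]
        bounded_linear_compose[OF bounded_linear_scaleC_right Lm_bounded_linear[OF a]])+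
  show "Lm a (c *\<^sub>C \<eta> b) = c *\<^sub>C Lm a (\<eta> b)" if "b \<in> A" for b
    using Lm_eta[OF a scaleC_smooth[OF that, of c]] a that
    by (simp add: eta_scaleC Lm_eta scaleC_mult_right mult_smooth)
qed

lemma Lm_add_right: "a \<in> A \<Longrightarrow> Lm a (x + y) = Lm a x + Lm a y"
  by (rule linear_simps(1)[OF Lm_bounded_linear])

lemma L2_deriv_eta: "b \<in> A \<Longrightarrow> L2_deriv n U \<eta> j (\<eta> b) = \<eta> (deriv j b)"
  by (simp add: L2_deriv_def)

lemma L2_deriv_Lm:
  assumes "a \<in> A" "h \<in> \<eta> ` A" and j: "j \<in> {1..2*n}"
  shows "L2_deriv n U \<eta> j (Lm a h) = Lm (deriv j a) h + Lm a (L2_deriv n U \<eta> j h)"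
proof -
  obtain b where b: "b \<in> A" "h = \<eta> b" using assms(2) by blast
  then show ?thesis using assms(1)
    by (simp add: Lm_eta L2_deriv_eta deriv_mult[OF _ _ j] eta_add mult_smooth deriv_smooth[OF _ j])
qed

end


section \<open>Matrices acting on the tensor product\<close>

lemma bounded_linear_vec_componentwise:
  fixes f :: "'x::real_normed_vector \<Rightarrow> 'y::real_normed_vector ^ 's::finite"
  assumes "\<And>i. bounded_linear (\<lambda>x. f x $ i)"
  shows "bounded_linear f"
proof -
  obtain C where C: "\<And>i x. norm (f x $ i) \<le> norm x * C i"
    using bounded_linear.bounded[OF assms] by metis
  show ?thesis
  proof (rule bounded_linear_intro)
    show "f (x + y) = f x + f y" for x y
      by (simp add: vec_eq_iff linear_simps(1)[OF assms])
    show "f (r *\<^sub>R x) = r *\<^sub>R f x" for r x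
      by (simp add: vec_eq_iff linear_simps(5)[OF assms])
    show "norm (f x) \<le> norm x * (\<Sum>i\<in>UNIV. C i)" for x
    proof -
      have "norm (f x) \<le> (\<Sum>i\<in>UNIV. norm (f x $ i))"
        unfolding norm_vec_def by (rule L2_set_le_sum) simp
      also have "\<dots> \<le> (\<Sum>i\<in>UNIV. norm x * C i)" by (rule sum_mono) (rule C)
      finally show ?thesis by (simp add: sum_distrib_left)
    qed
  qed
qed

lemma closure_vec_UNIV:
  fixes D :: "'y::real_normed_vector set"
  assumes "closure D = UNIV"
  shows "closure {\<xi>::'y ^ 's::finite. \<forall>p. \<xi> $ p \<in> D} = UNIV"
proof -
  have "\<xi> \<in> closure {\<xi>. \<forall>p. \<xi> $ p \<in> D}" for \<xi> :: "'y ^ 's"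
  proof -
    have "\<exists>v. (\<forall>k. v k \<in> D) \<and> v \<longlonglongrightarrow> \<xi> $ p" for p
      using assms closure_sequential[of "\<xi> $ p" D] by auto
    then obtain v where v: "\<And>p k. v p k \<in> D" "\<And>p. v p \<longlonglongrightarrow> \<xi> $ p" by metis
    have "(\<lambda>k. \<chi> p. v p k) \<longlonglongrightarrow> \<xi>" by (rule vec_tendstoI) (simp add: v)
    then show ?thesis unfolding closure_sequential using v(1) by (intro exI[of _ "\<lambda>k. \<chi> p. v p k"]) simp
  qed
  then show ?thesis by blast
qed

lemma scaleC_vec_nth [simp]: "(c *\<^sub>C x) $ i = c *\<^sub>C (x $ i)"
  by (simp add: scaleC_vec_def)

definition clinear :: "('x::complex_vector \<Rightarrow> 'y::complex_vector) \<Rightarrow> bool" where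
  "clinear f \<longleftrightarrow> (\<forall>x y. f (x + y) = f x + f y) \<and> (\<forall>c x. f (c *\<^sub>C x) = c *\<^sub>C f x)"

lemma clinear_add: "clinear f \<Longrightarrow> f (x + y) = f x + f y"
  by (simp add: clinear_def)

lemma clinear_scaleC: "clinear f \<Longrightarrow> f (c *\<^sub>C x) = c *\<^sub>C f x"
  by (simp add: clinear_def)

lemma clinear_zero: "clinear f \<Longrightarrow> f 0 = 0"
  using clinear_scaleC[of f 0 0] by simp

lemma clinear_minus: "clinear f \<Longrightarrow> f (- x) = - f x"
  using clinear_scaleC[of f "- 1" x] by simp

lemma clinear_diff: "clinear f \<Longrightarrow> f (x - y) = f x - f y"
  using clinear_add[of f x "- y"] by (simp add: clinear_minus)

lemma clinear_sum: "clinear f \<Longrightarrow> f (\<Sum>i\<in>I. g i) = (\<Sum>i\<in>I. f (g i))"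
  by (induction I rule: infinite_finite_induct) (auto simp: clinear_add clinear_zero)

lemmas clinear_simps = clinear_add clinear_scaleC clinear_zero clinear_minus clinear_diff clinear_sum

text \<open>The operator \<open>1 \<otimes> M \<otimes> K\<close>. Separating it from the first tensor factor lets the matrix algebra
  be computed without any linearity of the operator there, which may be unbounded.\<close>

definition mat_op :: "complex ^ 's ^ 's \<Rightarrow> complex ^ 's ^ 's \<Rightarrow> 'h::complex_vector ^ 's ^ 's \<Rightarrow> 'h ^ 's ^ 's::finite" where
  "mat_op M K \<xi> = (\<chi> p q. \<Sum>p'\<in>UNIV. \<Sum>q'\<in>UNIV. (M $ p $ p' * K $ q $ q') *\<^sub>C (\<xi> $ p' $ q'))"

lemma tensor_op_mat_op: "tensor_op T M K \<xi> = mat_op M K (\<chi> p q. T (\<xi> $ p $ q))"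
  by (simp add: tensor_op_def mat_op_def)

lemma clinear_mat_op: "clinear (mat_op M K)"
  unfolding clinear_def mat_op_def
  by (simp add: vec_eq_iff scaleC_add_right sum.distrib scaleC_sum_right scaleC_scaleC mult_ac)

lemma mat_op_add_left: "mat_op (M + M') K \<xi> = mat_op M K \<xi> + mat_op M' K \<xi>"
  by (simp add: mat_op_def vec_eq_iff scaleC_add_left sum.distrib ring_distribs)

lemma mat_op_add_right: "mat_op M (K + K') \<xi> = mat_op M K \<xi> + mat_op M K' \<xi>"
  by (simp add: mat_op_def vec_eq_iff scaleC_add_left sum.distrib ring_distribs)

lemma mat_op_zero_left [simp]: "mat_op 0 K \<xi> = 0"
  by (simp add: mat_op_def vec_eq_iff)

lemma mat_op_zero_right [simp]: "mat_op M 0 \<xi> = 0"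
  by (simp add: mat_op_def vec_eq_iff)

lemma mat_op_mat:
  fixes \<xi> :: "'h::complex_vector ^ 's ^ 's::finite"
  shows "mat_op (mat c) (mat d) \<xi> = (c * d) *\<^sub>C \<xi>"
proof -
  have "(\<Sum>p'\<in>UNIV. \<Sum>q'\<in>UNIV. ((mat c :: complex^'s^'s) $ p $ p' * (mat d :: complex^'s^'s) $ q $ q') *\<^sub>C (\<xi> $ p' $ q'))
      = (c * d) *\<^sub>C (\<xi> $ p $ q)" for p q
  proof -
    have "(\<Sum>p'\<in>UNIV. \<Sum>q'\<in>UNIV. ((mat c :: complex^'s^'s) $ p $ p' * (mat d :: complex^'s^'s) $ q $ q') *\<^sub>C (\<xi> $ p' $ q'))
      = (\<Sum>p'\<in>UNIV. \<Sum>q'\<in>UNIV. if p = p' then if q = q' then (c * d) *\<^sub>C (\<xi> $ p' $ q') else 0 else 0)"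
      by (intro sum.cong refl) (auto simp: mat_def)
    also have "\<dots> = (\<Sum>p'\<in>UNIV. if p = p' then (\<Sum>q'\<in>UNIV. if q = q' then (c * d) *\<^sub>C (\<xi> $ p' $ q') else 0) else 0)"
      by (intro sum.cong refl) auto
    also have "\<dots> = (c * d) *\<^sub>C (\<xi> $ p $ q)" by (simp add: sum.delta')
    finally show ?thesis .
  qed
  then show ?thesis by (simp add: mat_op_def vec_eq_iff)
qed

lemma mat_op_mult:
  fixes \<xi> :: "'h::complex_vector ^ 's ^ 's::finite"
  shows "mat_op M K (mat_op M' K' \<xi>) = mat_op (M ** M') (K ** K') \<xi>"
proof -
  let ?U = "UNIV :: ('s \<times> 's) set"
  have pair: "(\<Sum>x\<in>?U. f x) = (\<Sum>p'\<in>UNIV. \<Sum>q'\<in>UNIV. f (p', q'))" for f :: "'s \<times> 's \<Rightarrow> 'h"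
    by (simp add: sum.cartesian_product)
  have "(\<Sum>p'\<in>UNIV. \<Sum>q'\<in>UNIV. (M $ p $ p' * K $ q $ q') *\<^sub>C
          (\<Sum>p''\<in>UNIV. \<Sum>q''\<in>UNIV. (M' $ p' $ p'' * K' $ q' $ q'') *\<^sub>C (\<xi> $ p'' $ q'')))
      = (\<Sum>p''\<in>UNIV. \<Sum>q''\<in>UNIV. ((M ** M') $ p $ p'' * (K ** K') $ q $ q'') *\<^sub>C (\<xi> $ p'' $ q''))"
    (is "?l = ?r") for p q
  proof -
    let ?t = "\<lambda>x y. (M $ p $ fst x * K $ q $ snd x * (M' $ fst x $ fst y * K' $ snd x $ snd y)) *\<^sub>C (\<xi> $ fst y $ snd y)"
    have "?l = (\<Sum>x\<in>?U. \<Sum>y\<in>?U. ?t x y)"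
      by (simp add: scaleC_sum_right scaleC_scaleC pair)
    also have "\<dots> = (\<Sum>y\<in>?U. \<Sum>x\<in>?U. ?t x y)" by (rule sum.swap)
    also have "\<dots> = (\<Sum>y\<in>?U. (\<Sum>x\<in>?U. (M $ p $ fst x * M' $ fst x $ fst y) * (K $ q $ snd x * K' $ snd x $ snd y))
                        *\<^sub>C (\<xi> $ fst y $ snd y))"
      by (simp add: scaleC_sum_left mult_ac)
    also have "\<dots> = (\<Sum>y\<in>?U. ((M ** M') $ p $ fst y * (K ** K') $ q $ snd y) *\<^sub>C (\<xi> $ fst y $ snd y))"
      by (simp add: matrix_matrix_mult_def sum_product sum.cartesian_product case_prod_unfold)
    also have "\<dots> = ?r" by (simp add: pair)
    finally show ?thesis .
  qed
  then show ?thesis by (simp add: mat_op_def vec_eq_iff)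
qed

lemma bounded_linear_mat_op: "bounded_linear (mat_op M K :: 'h::complex_banach ^ 's ^ 's \<Rightarrow> 'h ^ 's ^ 's::finite)"
  unfolding mat_op_def
  by (intro bounded_linear_vec_componentwise)
     (auto intro!: bounded_linear_sum bounded_linear_compose[OF bounded_linear_scaleC_right]
       bounded_linear_compose[OF bounded_linear_vec_nth bounded_linear_vec_nth])

lemma bounded_linear_scaleC_vec: "bounded_linear (\<lambda>\<xi> :: 'h::complex_banach ^ 's ^ 's::finite. c *\<^sub>C \<xi>)"
  by (intro bounded_linear_vec_componentwise)
     (auto intro!: bounded_linear_compose[OF bounded_linear_scaleC_right]
       bounded_linear_compose[OF bounded_linear_vec_nth bounded_linear_vec_nth])


section \<open>The Grassmann operators\<close>

locale clifford =
  fixes n :: nat and \<gamma> :: "nat \<Rightarrow> complex ^ 's ^ 's::finite" and \<sigma> :: "complex ^ 's ^ 's" and \<epsilon> :: real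
  assumes rep: "clifford_rep n \<gamma> \<sigma>" and \<epsilon>: "\<epsilon> \<in> {1, -1}"
begin

definition E :: "nat \<Rightarrow> 'h::complex_vector ^ 's ^ 's \<Rightarrow> 'h ^ 's ^ 's" where
  "E j \<xi> = mat_op (mat 1) (\<gamma> j) \<xi>"

definition F :: "nat \<Rightarrow> 'h::complex_vector ^ 's ^ 's \<Rightarrow> 'h ^ 's ^ 's" where
  "F j \<xi> = (\<i> * of_real \<epsilon>) *\<^sub>C mat_op (\<gamma> j) \<sigma> \<xi>"

text \<open>The Grassmann generators \<open>\<Gamma> j\<close> are the coefficients of the derivations in \<open>d1_op\<close>. Changing
  the sign of the first summand gives the dual annihilation operators \<open>\<Gamma>' j\<close>.\<close>

definition \<Gamma> :: "nat \<Rightarrow> 'h::complex_vector ^ 's ^ 's \<Rightarrow> 'h ^ 's ^ 's" where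
  "\<Gamma> j \<xi> = (1/2) *\<^sub>C (E j \<xi> + F j \<xi>)"

definition \<Gamma>' :: "nat \<Rightarrow> 'h::complex_vector ^ 's ^ 's \<Rightarrow> 'h ^ 's ^ 's" where
  "\<Gamma>' j \<xi> = (1/2) *\<^sub>C (F j \<xi> - E j \<xi>)"

lemma gamma_anticommute:
  assumes "j \<in> {1..2*n}" "l \<in> {1..2*n}"
  shows "\<gamma> j ** \<gamma> l + \<gamma> l ** \<gamma> j = (if j = l then mat (- 2) else 0)"
  using rep assms unfolding clifford_rep_def by blast

lemma sigma_anticommute: "j \<in> {1..2*n} \<Longrightarrow> \<gamma> j ** \<sigma> + \<sigma> ** \<gamma> j = 0"
  using rep unfolding clifford_rep_def by simp

lemma sigma_square: "\<sigma> ** \<sigma> = mat 1"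
  using rep unfolding clifford_rep_def by blast

lemma epsilon_square: "(\<i> * of_real \<epsilon>) * (\<i> * of_real \<epsilon>) = - (1::complex)"
  using \<epsilon> by auto

lemma clinear_E: "clinear (E j)" and clinear_F: "clinear (F j)"
  and clinear_\<Gamma>: "clinear (\<Gamma> j)" and clinear_\<Gamma>': "clinear (\<Gamma>' j)"
  by (simp_all add: clinear_def E_def F_def \<Gamma>_def \<Gamma>'_def clinear_simps[OF clinear_mat_op]
      scaleC_add_right scaleC_diff_right scaleC_scaleC mult_ac)

lemma E_E:
  assumes "j \<in> {1..2*n}" "l \<in> {1..2*n}"
  shows "E j (E l \<xi>) + E l (E j \<xi>) = (if j = l then - 2 else 0) *\<^sub>C \<xi>"
proof -
  have "E j (E l \<xi>) + E l (E j \<xi>) = mat_op (mat 1) (\<gamma> j ** \<gamma> l + \<gamma> l ** \<gamma> j) \<xi>"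
    by (simp add: E_def mat_op_mult mat_op_add_right)
  then show ?thesis by (simp add: gamma_anticommute[OF assms] mat_op_mat)
qed

lemma F_F:
  assumes "j \<in> {1..2*n}" "l \<in> {1..2*n}"
  shows "F j (F l \<xi>) + F l (F j \<xi>) = (if j = l then 2 else 0) *\<^sub>C \<xi>"
proof -
  have "F j (F l \<xi>) + F l (F j \<xi>) = - mat_op (\<gamma> j ** \<gamma> l + \<gamma> l ** \<gamma> j) (mat 1) \<xi>"
    by (simp add: F_def clinear_simps[OF clinear_mat_op] mat_op_mult mat_op_add_left scaleC_scaleC
        epsilon_square sigma_square)
  then show ?thesis by (simp add: gamma_anticommute[OF assms] mat_op_mat flip: scaleC_minus_left)
qed

lemma E_F:
  assumes "j \<in> {1..2*n}"
  shows "E j (F l \<xi>) + F l (E j \<xi>) = 0"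
proof -
  have "E j (F l \<xi>) + F l (E j \<xi>) = (\<i> * of_real \<epsilon>) *\<^sub>C mat_op (\<gamma> l) (\<gamma> j ** \<sigma> + \<sigma> ** \<gamma> j) \<xi>"
    by (simp add: E_def F_def clinear_simps[OF clinear_mat_op] mat_op_mult mat_op_add_right scaleC_add_right)
  then show ?thesis by (simp add: sigma_anticommute[OF assms])
qed

text \<open>The mixed anticommutators vanish and the two pure ones are opposite, so everything cancels. For
  \<open>\<Gamma>'\<close> the pure ones add up instead, which gives the canonical relation in the lemma after it.\<close>

lemma \<Gamma>_\<Gamma>:
  assumes "j \<in> {1..2*n}" "l \<in> {1..2*n}"
  shows "\<Gamma> j (\<Gamma> l \<xi>) + \<Gamma> l (\<Gamma> j \<xi>) = 0"
proof -
  have "\<Gamma> j (\<Gamma> l \<xi>) + \<Gamma> l (\<Gamma> j \<xi>) = (1/4) *\<^sub>C ((E j (E l \<xi>) + E l (E j \<xi>)) + (F j (F l \<xi>) + F l (F j \<xi>))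
      + (E j (F l \<xi>) + F l (E j \<xi>)) + (E l (F j \<xi>) + F j (E l \<xi>)))"
    by (simp add: \<Gamma>_def clinear_simps[OF clinear_E] clinear_simps[OF clinear_F] scaleC_add_right
        scaleC_scaleC)
  then show ?thesis
    unfolding E_E[OF assms] F_F[OF assms] E_F[OF assms(1)] E_F[OF assms(2)] by simp
qed

lemma \<Gamma>'_\<Gamma>:
  assumes "j \<in> {1..2*n}" "l \<in> {1..2*n}"
  shows "\<Gamma>' j (\<Gamma> l \<xi>) + \<Gamma> l (\<Gamma>' j \<xi>) = (if j = l then \<xi> else 0)"
proof -
  have "\<Gamma>' j (\<Gamma> l \<xi>) + \<Gamma> l (\<Gamma>' j \<xi>) = (1/4) *\<^sub>C ((F j (F l \<xi>) + F l (F j \<xi>)) - (E j (E l \<xi>) + E l (E j \<xi>))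
      + (E l (F j \<xi>) + F j (E l \<xi>)) - (E j (F l \<xi>) + F l (E j \<xi>)))"
    by (simp add: \<Gamma>_def \<Gamma>'_def clinear_simps[OF clinear_E] clinear_simps[OF clinear_F] scaleC_add_right
        scaleC_diff_right scaleC_scaleC)
  moreover have "(1/4) *\<^sub>C (2 *\<^sub>C \<xi> + 2 *\<^sub>C \<xi>) = \<xi>"
    by (simp add: scaleC_scaleC flip: scaleC_add_left)
  ultimately show ?thesis
    unfolding E_E[OF assms] F_F[OF assms] E_F[OF assms(1)] E_F[OF assms(2)] by simp
qed

end


section \<open>Commutators with the Dolbeault operators\<close>

lemma sum_pairs: "(\<Sum>j\<in>{1..2*n}. f j) = (\<Sum>p\<in>{1..n}. f (2*p-1) + f (2*p))"
  for f :: "nat \<Rightarrow> 'v::comm_monoid_add"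
  by (induction n) (simp_all add: add.assoc)

lemma sum_odd: "(\<Sum>j | odd j \<and> j \<le> 2*n-1. f j) = (\<Sum>p\<in>{1..n}. f (2*p-1))"
  for f :: "nat \<Rightarrow> 'v::comm_monoid_add"
  by (rule sum.reindex_bij_witness[where i = "\<lambda>p. 2*p-1" and j = "\<lambda>j. (j+1) div 2"])
     (auto elim!: oddE)

locale dolbeault = torus_L2 n \<Theta> U \<eta> + clifford n \<gamma> \<sigma> \<epsilon>
  for n \<Theta> and U :: "nat \<Rightarrow> 'a::cstar_algebra" and \<eta> :: "'a \<Rightarrow> 'h::complex_hilbert"
    and \<gamma> :: "nat \<Rightarrow> complex ^ 's ^ 's::finite" and \<sigma> \<epsilon> +
  fixes s :: complex
  assumes s_square: "s * s = 1"
begin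

abbreviation L :: "'a \<Rightarrow> 'h ^ 's ^ 's \<Rightarrow> 'h ^ 's ^ 's" where "L \<equiv> alg_op n U \<eta>"

lemma L_nth: "L a \<xi> $ p $ q = Lm a (\<xi> $ p $ q)"
  by (simp add: alg_op_def tensor_op_mat_op mat_op_mat)

lemma L_add: "a \<in> A \<Longrightarrow> b \<in> A \<Longrightarrow> L (a + b) \<xi> = L a \<xi> + L b \<xi>"
  by (simp add: vec_eq_iff L_nth Lm_add)

lemma L_scaleC: "a \<in> A \<Longrightarrow> L (c *\<^sub>C a) \<xi> = c *\<^sub>C L a \<xi>"
  by (simp add: vec_eq_iff L_nth Lm_scaleC)

lemma L_mult: "a \<in> A \<Longrightarrow> b \<in> A \<Longrightarrow> L (a * b) \<xi> = L a (L b \<xi>)"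
  by (simp add: vec_eq_iff L_nth Lm_mult)

lemma L_zero: "L 0 \<xi> = 0"
  using L_scaleC[OF one_smooth, of 0 \<xi>] by simp

lemma L_diff: "a \<in> A \<Longrightarrow> b \<in> A \<Longrightarrow> L (a - b) \<xi> = L a \<xi> - L b \<xi>"
  using L_add[of a "- b" \<xi>] L_scaleC[of b "- 1" \<xi>] by (simp add: minus_smooth)

lemma L_sum: "(\<And>i. i \<in> I \<Longrightarrow> f i \<in> A) \<Longrightarrow> L (\<Sum>i\<in>I. f i) \<xi> = (\<Sum>i\<in>I. L (f i) \<xi>)"
  by (induction I rule: infinite_finite_induct) (auto simp: L_zero L_add sum_smooth)

lemma clinear_L: "a \<in> A \<Longrightarrow> clinear (L a)"
  by (simp add: clinear_def vec_eq_iff L_nth Lm_add_right Lm_scaleC_right)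

lemma bounded_linear_L: "a \<in> A \<Longrightarrow> bounded_linear (L a)"
  by (intro bounded_linear_vec_componentwise)
     (auto simp: L_nth intro!: bounded_linear_compose[OF Lm_bounded_linear]
       bounded_linear_compose[OF bounded_linear_vec_nth bounded_linear_vec_nth])

lemma L_inject:
  assumes "a \<in> A" "b \<in> A" "L a = L b" shows "a = b"
proof -
  have "Lm a (\<eta> 1) = Lm b (\<eta> 1)"
    using arg_cong[OF assms(3), of "\<lambda>T. T (\<chi> p q. \<eta> 1) $ undefined $ undefined"]
    by (simp add: L_nth)
  then have "\<eta> a = \<eta> b" using assms by (simp add: Lm_eta)
  then show ?thesis using inj_onD[OF inj_eta] assms by blast
qed

lemma L_mat_op: "a \<in> A \<Longrightarrow> L a (mat_op X Y \<xi>) = mat_op X Y (L a \<xi>)"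
proof -
  assume a: "a \<in> A"
  have lin: "clinear (Lm a)" using a by (simp add: clinear_def Lm_add_right Lm_scaleC_right)
  show ?thesis by (simp add: vec_eq_iff L_nth mat_op_def clinear_simps[OF lin])
qed

lemma L_\<Gamma>: "a \<in> A \<Longrightarrow> L a (\<Gamma> j \<xi>) = \<Gamma> j (L a \<xi>)"
  by (simp add: \<Gamma>_def E_def F_def clinear_simps[OF clinear_L] L_mat_op)

lemma L_\<Gamma>': "a \<in> A \<Longrightarrow> L a (\<Gamma>' j \<xi>) = \<Gamma>' j (L a \<xi>)"
  by (simp add: \<Gamma>'_def E_def F_def clinear_simps[OF clinear_L] L_mat_op)

lemma bounded_linear_\<Gamma>: "bounded_linear (\<Gamma> j :: 'h ^ 's ^ 's \<Rightarrow> _)"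
  unfolding \<Gamma>_def E_def F_def
  by (intro bounded_linear_compose[OF bounded_linear_scaleC_vec] bounded_linear_add bounded_linear_mat_op)

lemma dense_smooth_vectors: "closure (smooth_vectors n U \<eta> :: ('h ^ 's ^ 's) set) = UNIV"
proof -
  have "closure {\<xi>::'h ^ 's ^ 's. \<forall>p. \<xi> $ p \<in> {\<zeta>. \<forall>q. \<zeta> $ q \<in> \<eta> ` A}} = UNIV"
    by (intro closure_vec_UNIV dense_eta)
  then show ?thesis by (simp add: smooth_vectors_def)
qed

text \<open>The amplification \<open>\<partial>\<^sub>j \<otimes> 1 \<otimes> 1\<close>, on the smooth vectors.\<close>

definition D :: "nat \<Rightarrow> 'h ^ 's ^ 's \<Rightarrow> 'h ^ 's ^ 's" where
  "D j \<xi> = (\<chi> p q. L2_deriv n U \<eta> j (\<xi> $ p $ q))"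

lemma D_L:
  assumes "a \<in> A" "j \<in> {1..2*n}" "\<xi> \<in> smooth_vectors n U \<eta>"
  shows "D j (L a \<xi>) = L (deriv j a) \<xi> + L a (D j \<xi>)"
  using assms by (simp add: vec_eq_iff D_def L_nth L2_deriv_Lm smooth_vectors_def)

text \<open>For \<open>s = 1\<close> this is \<open>delbar_op\<close>, for \<open>s = -1\<close> it is \<open>del_op\<close>; one computation serves both.\<close>

definition dolb :: "'h ^ 's ^ 's \<Rightarrow> 'h ^ 's ^ 's" where
  "dolb \<xi> = (1/2) *\<^sub>C (d1_op n U \<eta> \<gamma> \<sigma> \<epsilon> \<xi> + (s * \<i>) *\<^sub>C d2_op n U \<eta> \<gamma> \<sigma> \<epsilon> \<xi>)"

definition G :: "nat \<Rightarrow> 'h ^ 's ^ 's \<Rightarrow> 'h ^ 's ^ 's" where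
  "G p \<xi> = \<Gamma> (2*p-1) \<xi> + (s * \<i>) *\<^sub>C \<Gamma> (2*p) \<xi>"

definition \<delta> :: "nat \<Rightarrow> 'a \<Rightarrow> 'a" where
  "\<delta> p a = (1/2) *\<^sub>C (deriv (2*p-1) a - (s * \<i>) *\<^sub>C deriv (2*p) a)"

lemma d1_eq: "d1_op n U \<eta> \<gamma> \<sigma> \<epsilon> \<xi> = (\<Sum>j\<in>{1..2*n}. \<Gamma> j (D j \<xi>))"
  by (simp add: d1_op_def tensor_op_mat_op scaleC_sum_right \<Gamma>_def E_def F_def D_def)

lemma d2_eq: "d2_op n U \<eta> \<gamma> \<sigma> \<epsilon> \<xi> = (\<Sum>p\<in>{1..n}. \<Gamma> (2*p) (D (2*p-1) \<xi>) - \<Gamma> (2*p-1) (D (2*p) \<xi>))"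
proof -
  have "d2_op n U \<eta> \<gamma> \<sigma> \<epsilon> \<xi> = (\<Sum>j | odd j \<and> j \<le> 2*n-1. \<Gamma> (j+1) (D j \<xi>) - \<Gamma> j (D (j+1) \<xi>))"
    unfolding d2_op_def scaleC_sum_right
    by (rule sum.cong)
       (simp_all add: tensor_op_mat_op \<Gamma>_def E_def F_def D_def scaleC_add_right scaleC_diff_right
         scaleC_scaleC)
  also have "\<dots> = (\<Sum>p\<in>{1..n}. \<Gamma> (2*p-1+1) (D (2*p-1) \<xi>) - \<Gamma> (2*p-1) (D (2*p-1+1) \<xi>))"
    by (rule sum_odd)
  also have "\<dots> = (\<Sum>p\<in>{1..n}. \<Gamma> (2*p) (D (2*p-1) \<xi>) - \<Gamma> (2*p-1) (D (2*p) \<xi>))"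
    by (rule sum.cong) auto
  finally show ?thesis .
qed

text \<open>The pair of indices \<open>2*p-1\<close>, \<open>2*p\<close> contributes four terms. Because \<open>(s * \<i>)\<^sup>2 = - 1\<close>, they
  factor as a product of one complex Grassmann generator with one complex derivation.\<close>

lemma dolb_eq:
  "dolb \<xi> = (\<Sum>p\<in>{1..n}. (1/2) *\<^sub>C (G p (D (2*p-1) \<xi>) - (s * \<i>) *\<^sub>C G p (D (2*p) \<xi>)))"
proof -
  have si: "(s * \<i>) * (s * \<i>) = - 1" using s_square by (simp add: algebra_simps)
  have "dolb \<xi> = (\<Sum>p\<in>{1..n}. (1/2) *\<^sub>C (\<Gamma> (2*p-1) (D (2*p-1) \<xi>) + \<Gamma> (2*p) (D (2*p) \<xi>)
      + (s * \<i>) *\<^sub>C (\<Gamma> (2*p) (D (2*p-1) \<xi>) - \<Gamma> (2*p-1) (D (2*p) \<xi>))))"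
    by (simp only: dolb_def d1_eq d2_eq sum_pairs scaleC_sum_right sum.distrib scaleC_add_right)
  also have "\<dots> = (\<Sum>p\<in>{1..n}. (1/2) *\<^sub>C (G p (D (2*p-1) \<xi>) - (s * \<i>) *\<^sub>C G p (D (2*p) \<xi>)))"
    by (intro sum.cong arg_cong[where f = "\<lambda>x. (1/2) *\<^sub>C x"] refl)
       (simp add: G_def scaleC_add_right scaleC_diff_right scaleC_scaleC si s_square algebra_simps)
  finally show ?thesis .
qed

lemma clinear_G: "clinear (G p)"
  by (simp add: clinear_def G_def clinear_simps[OF clinear_\<Gamma>] scaleC_add_right scaleC_scaleC mult_ac)

lemma L_G: "a \<in> A \<Longrightarrow> L a (G p \<xi>) = G p (L a \<xi>)"
  by (simp add: G_def clinear_simps[OF clinear_L] L_\<Gamma>)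

lemma bounded_linear_G: "bounded_linear (G p)"
  unfolding G_def
  by (intro bounded_linear_add bounded_linear_compose[OF bounded_linear_scaleC_vec] bounded_linear_\<Gamma>)

lemma index: "p \<in> {1..n} \<Longrightarrow> 2*p-1 \<in> {1..2*n}" "p \<in> {1..n} \<Longrightarrow> 2*p \<in> {1..2*n}"
  by auto

lemma delta_smooth: "a \<in> A \<Longrightarrow> p \<in> {1..n} \<Longrightarrow> \<delta> p a \<in> A"
  unfolding \<delta>_def by (intro scaleC_smooth diff_smooth deriv_smooth index)

definition one_form :: "(nat \<Rightarrow> 'a) \<Rightarrow> 'h ^ 's ^ 's \<Rightarrow> 'h ^ 's ^ 's" where
  "one_form x \<xi> = (\<Sum>p\<in>{1..n}. L (x p) (G p \<xi>))"

text \<open>The matrix part commutes with left multiplication, so only the derivations contribute to the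
  commutator, each through the Leibniz rule.\<close>

lemma commutator_dolb:
  assumes a: "a \<in> A"
  shows "commutator n U \<eta> dolb a = one_form (\<lambda>p. \<delta> p a)"
  unfolding commutator_def
proof (rule bounded_extension_eqI[OF _ dense_smooth_vectors])
  show "bounded_linear (one_form (\<lambda>p. \<delta> p a))"
    unfolding one_form_def
    by (intro bounded_linear_sum bounded_linear_compose[OF bounded_linear_L bounded_linear_G]
        delta_smooth a)
  fix \<xi> :: "'h ^ 's ^ 's" assume \<xi>: "\<xi> \<in> smooth_vectors n U \<eta>"
  have "dolb (L a \<xi>) = (\<Sum>p\<in>{1..n}. L (\<delta> p a) (G p \<xi>) +
      L a ((1/2) *\<^sub>C (G p (D (2*p-1) \<xi>) - (s * \<i>) *\<^sub>C G p (D (2*p) \<xi>))))"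
    unfolding dolb_eq
  proof (rule sum.cong[OF refl])
    fix p assume p: "p \<in> {1..n}"
    note da = deriv_smooth[OF a index(1)[OF p]] deriv_smooth[OF a index(2)[OF p]]
    have "L (\<delta> p a) (G p \<xi>) = (1/2) *\<^sub>C (G p (L (deriv (2*p-1) a) \<xi>) - (s * \<i>) *\<^sub>C G p (L (deriv (2*p) a) \<xi>))"
      using da by (simp add: \<delta>_def L_scaleC L_diff scaleC_smooth diff_smooth L_G
          clinear_simps[OF clinear_G])
    then show "(1/2) *\<^sub>C (G p (D (2*p-1) (L a \<xi>)) - (s * \<i>) *\<^sub>C G p (D (2*p) (L a \<xi>)))
      = L (\<delta> p a) (G p \<xi>) + L a ((1/2) *\<^sub>C (G p (D (2*p-1) \<xi>) - (s * \<i>) *\<^sub>C G p (D (2*p) \<xi>)))"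
      unfolding D_L[OF a index(1)[OF p] \<xi>] D_L[OF a index(2)[OF p] \<xi>]
      by (simp add: clinear_simps[OF clinear_G]
          clinear_simps[OF clinear_L[OF a]] L_G[OF a] scaleC_add_right scaleC_diff_right)
  qed
  also have "\<dots> = one_form (\<lambda>p. \<delta> p a) \<xi> + L a (dolb \<xi>)"
    by (simp add: sum.distrib one_form_def dolb_eq clinear_sum[OF clinear_L[OF a]])
  finally show "one_form (\<lambda>p. \<delta> p a) \<xi> = dolb (L a \<xi>) - L a (dolb \<xi>)" by simp
qed


section \<open>Independence of the products of Grassmann operators\<close>

lemma G_G:
  assumes p: "p \<in> {1..n}" and q: "q \<in> {1..n}"
  shows "G p (G q \<xi>) + G q (G p \<xi>) = 0"
proof -
  have "G p (G q \<xi>) + G q (G p \<xi>) =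
      (\<Gamma> (2*p-1) (\<Gamma> (2*q-1) \<xi>) + \<Gamma> (2*q-1) (\<Gamma> (2*p-1) \<xi>))
      + (s * \<i>) *\<^sub>C (\<Gamma> (2*p-1) (\<Gamma> (2*q) \<xi>) + \<Gamma> (2*q) (\<Gamma> (2*p-1) \<xi>))
      + (s * \<i>) *\<^sub>C (\<Gamma> (2*p) (\<Gamma> (2*q-1) \<xi>) + \<Gamma> (2*q-1) (\<Gamma> (2*p) \<xi>))
      + (s * \<i> * (s * \<i>)) *\<^sub>C (\<Gamma> (2*p) (\<Gamma> (2*q) \<xi>) + \<Gamma> (2*q) (\<Gamma> (2*p) \<xi>))"
    by (simp add: G_def clinear_simps[OF clinear_\<Gamma>] scaleC_add_right scaleC_scaleC)
  then show ?thesis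
    by (simp only: \<Gamma>_\<Gamma> index p q scaleC_zero_right add_0)
qed

lemma G_G_swap:
  assumes "p \<in> {1..n}" "q \<in> {1..n}" shows "G q (G p \<xi>) = - G p (G q \<xi>)"
  using G_G[OF assms, of \<xi>] by (simp add: eq_neg_iff_add_eq_0 add.commute)

lemma G_square:
  assumes "p \<in> {1..n}" shows "G p (G p \<xi>) = 0"
proof -
  have "2 *\<^sub>R G p (G p \<xi>) = 0" using G_G[OF assms assms, of \<xi>] by (simp add: scaleR_2)
  then show ?thesis by simp
qed

text \<open>Contraction with the dual of \<open>G p\<close>. One annihilation operator suffices: it contracts the summand
  \<open>\<Gamma> (2*p-1)\<close> of \<open>G p\<close> to \<open>1\<close> and anticommutes with all other summands.\<close>

definition K :: "nat \<Rightarrow> 'h ^ 's ^ 's \<Rightarrow> 'h ^ 's ^ 's" where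
  "K p = \<Gamma>' (2*p-1)"

lemma clinear_K: "clinear (K p)"
  by (simp add: K_def clinear_\<Gamma>')

lemma L_K: "a \<in> A \<Longrightarrow> L a (K p \<xi>) = K p (L a \<xi>)"
  by (simp add: K_def L_\<Gamma>')

lemma K_G:
  assumes p: "p \<in> {1..n}" and q: "q \<in> {1..n}"
  shows "K p (G q \<xi>) = (if p = q then \<xi> else 0) - G q (K p \<xi>)"
proof -
  have eq: "2*p-1 = 2*q-1 \<longleftrightarrow> p = q" "2*p-1 \<noteq> 2*q" using p q by (auto, presburger)
  have "K p (G q \<xi>) + G q (K p \<xi>) =
      (\<Gamma>' (2*p-1) (\<Gamma> (2*q-1) \<xi>) + \<Gamma> (2*q-1) (\<Gamma>' (2*p-1) \<xi>))
      + (s * \<i>) *\<^sub>C (\<Gamma>' (2*p-1) (\<Gamma> (2*q) \<xi>) + \<Gamma> (2*q) (\<Gamma>' (2*p-1) \<xi>))"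
    by (simp add: K_def G_def clinear_simps[OF clinear_\<Gamma>'] scaleC_add_right)
  then have "K p (G q \<xi>) + G q (K p \<xi>) = (if p = q then \<xi> else 0)"
    by (simp only: \<Gamma>'_\<Gamma> index p q eq if_False scaleC_zero_right add_0_right)
  then show ?thesis by (simp add: eq_diff_eq)
qed

text \<open>The anticommutator with \<open>K p\<close> sends \<open>G q\<close> to the scalar \<open>0\<close> or \<open>1\<close>, so it reads off the
  coefficient.\<close>

lemma one_form_coefficient:
  assumes x: "x \<in> {1..n} \<rightarrow> A" and p: "p \<in> {1..n}"
  shows "K p (one_form x \<xi>) + one_form x (K p \<xi>) = L (x p) \<xi>"
proof -
  have "K p (one_form x \<xi>) + one_form x (K p \<xi>) = (\<Sum>q\<in>{1..n}. if p = q then L (x p) \<xi> else 0)"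
    unfolding one_form_def clinear_sum[OF clinear_K] sum.distrib[symmetric]
  proof (rule sum.cong[OF refl])
    fix q assume q: "q \<in> {1..n}"
    then have xq: "x q \<in> A" using x by blast
    show "K p (L (x q) (G q \<xi>)) + L (x q) (G q (K p \<xi>)) = (if p = q then L (x p) \<xi> else 0)"
      by (simp add: L_K[OF xq, symmetric] K_G[OF p q] clinear_simps[OF clinear_L[OF xq]])
  qed
  also have "\<dots> = L (x p) \<xi>" using p by simp
  finally show ?thesis .
qed

definition pairs :: "(nat \<times> nat) set" where
  "pairs = {(p, q). 1 \<le> p \<and> p < q \<and> q \<le> n}"

definition two_form :: "(nat \<times> nat \<Rightarrow> 'a) \<Rightarrow> 'h ^ 's ^ 's \<Rightarrow> 'h ^ 's ^ 's" where
  "two_form z \<xi> = (\<Sum>(p, q)\<in>pairs. L (z (p, q)) (G p (G q \<xi>)))"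

lemma pairsD: "(p, q) \<in> pairs \<Longrightarrow> p \<in> {1..n} \<and> q \<in> {1..n} \<and> p < q"
  by (auto simp: pairs_def)

lemma finite_pairs: "finite pairs"
  by (rule finite_subset[of _ "{1..n} \<times> {1..n}"]) (auto simp: pairs_def)

text \<open>Contraction is an antiderivation: the commutator with \<open>K r\<close> sends \<open>G p G q\<close> to a difference of
  multiples of \<open>G q\<close> and \<open>G p\<close>, and the anticommutator of the result with \<open>K t\<close> is a scalar. Because
  \<open>p < q\<close> and \<open>r < t\<close>, the second of the two resulting terms never survives.\<close>

lemma two_form_coefficient:
  assumes z: "z \<in> pairs \<rightarrow> A" and rt: "(r, t) \<in> pairs"
  shows "K t (K r (two_form z \<xi>) - two_form z (K r \<xi>))
       + (K r (two_form z (K t \<xi>)) - two_form z (K r (K t \<xi>))) = L (z (r, t)) \<xi>"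
proof -
  have r: "r \<in> {1..n}" and t: "t \<in> {1..n}" and lt: "r < t" using pairsD[OF rt] by auto
  have contract: "K r (two_form z \<zeta>) - two_form z (K r \<zeta>)
      = (\<Sum>(p, q)\<in>pairs. L (z (p, q)) ((if r = p then G q \<zeta> else 0) - (if r = q then G p \<zeta> else 0)))" for \<zeta>
    unfolding two_form_def clinear_sum[OF clinear_K] sum_subtractf[symmetric]
  proof (rule sum.cong[OF refl], clarify)
    fix p q assume pq: "(p, q) \<in> pairs"
    then have p: "p \<in> {1..n}" and q: "q \<in> {1..n}" and zA: "z (p, q) \<in> A" using pairsD z by auto
    show "K r (L (z (p, q)) (G p (G q \<zeta>))) - L (z (p, q)) (G p (G q (K r \<zeta>)))
        = L (z (p, q)) ((if r = p then G q \<zeta> else 0) - (if r = q then G p \<zeta> else 0))"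
      by (simp add: L_K[OF zA, symmetric] K_G[OF r p] K_G[OF r q] clinear_simps[OF clinear_L[OF zA]]
          clinear_simps[OF clinear_G])
  qed
  have "K t (K r (two_form z \<xi>) - two_form z (K r \<xi>)) + (K r (two_form z (K t \<xi>)) - two_form z (K r (K t \<xi>)))
      = (\<Sum>pq\<in>pairs. if pq = (r, t) then L (z (r, t)) \<xi> else 0)"
    unfolding contract clinear_sum[OF clinear_K] sum.distrib[symmetric]
  proof (rule sum.cong[OF refl], clarify)
    fix p q assume pq: "(p, q) \<in> pairs"
    then have p: "p \<in> {1..n}" and q: "q \<in> {1..n}" and pq_lt: "p < q" and zA: "z (p, q) \<in> A"
      using pairsD z by auto
    let ?W = "\<lambda>\<zeta>. (if r = p then G q \<zeta> else 0) - (if r = q then G p \<zeta> else 0)"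
    have "K t (?W \<xi>) + ?W (K t \<xi>) = (if (p, q) = (r, t) then \<xi> else 0)"
      using lt pq_lt p q t by (auto simp: clinear_simps[OF clinear_K] K_G)
    then have "L (z (p, q)) (K t (?W \<xi>)) + L (z (p, q)) (?W (K t \<xi>)) = (if (p, q) = (r, t) then L (z (r, t)) \<xi> else 0)"
      using clinear_zero[OF clinear_L[OF zA]] by (simp flip: clinear_add[OF clinear_L[OF zA]])
    then show "K t (L (z (p, q)) (?W \<xi>)) + L (z (p, q)) (?W (K t \<xi>)) = (if (p, q) = (r, t) then L (z (r, t)) \<xi> else 0)"
      by (simp only: L_K[OF zA])
  qed
  also have "\<dots> = L (z (r, t)) \<xi>" using rt finite_pairs by simp
  finally show ?thesis .
qed

lemma one_form_inject:
  assumes "x \<in> {1..n} \<rightarrow> A" "y \<in> {1..n} \<rightarrow> A" "one_form x = one_form y" "p \<in> {1..n}"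
  shows "x p = y p"
proof (rule L_inject)
  show "L (x p) = L (y p)"
    using one_form_coefficient[OF assms(1,4)] one_form_coefficient[OF assms(2,4)] assms(3) by (intro ext) simp
qed (use assms in auto)

lemma two_form_inject:
  assumes "z \<in> pairs \<rightarrow> A" "w \<in> pairs \<rightarrow> A" "two_form z = two_form w" "rt \<in> pairs"
  shows "z rt = w rt"
proof -
  obtain r t where rt: "rt = (r, t)" by (cases rt)
  have "L (z (r, t)) = L (w (r, t))"
    using two_form_coefficient[OF assms(1) assms(4)[unfolded rt]]
      two_form_coefficient[OF assms(2) assms(4)[unfolded rt]] assms(3) by (intro ext) simp
  then show ?thesis using assms(1,2,4) rt by (intro L_inject) auto
qed

text \<open>In the double sum the diagonal vanishes by \<open>G_square\<close>, and the terms at \<open>(p, q)\<close> and \<open>(q, p)\<close>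
  combine by anticommutativity.\<close>

lemma one_form_mult:
  assumes x: "x \<in> {1..n} \<rightarrow> A" and y: "y \<in> {1..n} \<rightarrow> A"
  shows "one_form x \<circ> one_form y = two_form (\<lambda>(p, q). x p * y q - x q * y p)"
proof
  fix \<xi> :: "'h ^ 's ^ 's"
  define h where "h = (\<lambda>(p, q). L (x p * y q) (G p (G q \<xi>)))"
  let ?I = "{1..n}"
  have xA: "x p \<in> A" and yA: "y p \<in> A" if "p \<in> ?I" for p using x y that by auto
  have "(one_form x \<circ> one_form y) \<xi> = (\<Sum>p\<in>?I. \<Sum>q\<in>?I. h (p, q))"
    unfolding o_def one_form_def
    by (intro sum.cong refl)
       (simp add: clinear_sum[OF clinear_G] clinear_sum[OF clinear_L] xA,
        auto intro!: sum.cong simp: h_def L_mult xA yA L_G)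
  also have "\<dots> = sum h (?I \<times> ?I)" by (simp add: sum.cartesian_product)
  also have "?I \<times> ?I = (pairs \<union> prod.swap ` pairs) \<union> (\<lambda>p. (p, p)) ` ?I"
    by (auto simp: pairs_def image_iff)
  also have "sum h ((pairs \<union> prod.swap ` pairs) \<union> (\<lambda>p. (p, p)) ` ?I)
      = sum h pairs + sum h (prod.swap ` pairs) + sum h ((\<lambda>p. (p, p)) ` ?I)"
  proof -
    have "pairs \<inter> prod.swap ` pairs = {}" "(pairs \<union> prod.swap ` pairs) \<inter> (\<lambda>p. (p, p)) ` ?I = {}"
      by (auto simp: pairs_def)
    then show ?thesis
      by (simp only: sum.union_disjoint finite_UnI finite_imageI finite_atLeastAtMost finite_pairs)
  qed
  also have "sum h ((\<lambda>p. (p, p)) ` ?I) = 0"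
    by (intro sum.neutral) (auto simp: h_def G_square clinear_zero[OF clinear_L] xA yA mult_smooth)
  also have "sum h (prod.swap ` pairs) = (\<Sum>pq\<in>pairs. h (prod.swap pq))"
    by (subst sum.reindex) (auto simp: inj_on_def)
  also have "sum h pairs + (\<Sum>pq\<in>pairs. h (prod.swap pq)) + 0
      = two_form (\<lambda>(p, q). x p * y q - x q * y p) \<xi>"
    unfolding two_form_def add_0_right sum.distrib[symmetric]
  proof (rule sum.cong[OF refl], clarify)
    fix p q assume "(p, q) \<in> pairs"
    then have p: "p \<in> ?I" and q: "q \<in> ?I" using pairsD by auto
    show "h (p, q) + h (prod.swap (p, q)) = L (x p * y q - x q * y p) (G p (G q \<xi>))"
      using G_G_swap[OF p q, of \<xi>] mult_smooth[OF xA[OF p] yA[OF q]] mult_smooth[OF xA[OF q] yA[OF p]]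
      by (simp add: h_def L_diff clinear_minus[OF clinear_L])
  qed
  finally show "(one_form x \<circ> one_form y) \<xi> = two_form (\<lambda>(p, q). x p * y q - x q * y p) \<xi>" .
qed

end


section \<open>Forms as free bimodules\<close>

lemma card_ordered_pairs: "card {(p, q). 1 \<le> p \<and> p < q \<and> q \<le> n} = n * (n - 1) div 2"
proof -
  have "card {(p, q). 1 \<le> p \<and> p < q \<and> q \<le> n} = n choose 2"
  proof (induction n)
    case 0
    have "{(p, q :: nat). 1 \<le> p \<and> p < q \<and> q \<le> 0} = {}" by auto
    then show ?case by (simp only:) simp
  next
    case (Suc n)
    have eq: "{(p, q). 1 \<le> p \<and> p < q \<and> q \<le> Suc n}
        = {(p, q). 1 \<le> p \<and> p < q \<and> q \<le> n} \<union> (\<lambda>p. (p, Suc n)) ` {1..n}"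
      by (auto simp: le_Suc_eq)
    have fin: "finite {(p, q). 1 \<le> p \<and> p < q \<and> q \<le> n}"
      by (rule finite_subset[of _ "{1..n} \<times> {1..n}"]) auto
    have "card {(p, q). 1 \<le> p \<and> p < q \<and> q \<le> Suc n}
        = card {(p, q). 1 \<le> p \<and> p < q \<and> q \<le> n} + card ((\<lambda>p. (p, Suc n)) ` {1..n})"
      unfolding eq by (rule card_Un_disjoint[OF fin]) auto
    also have "\<dots> = (n choose 2) + n"
      unfolding Suc.IH by (simp add: card_image inj_on_def)
    finally have "card {(p, q). 1 \<le> p \<and> p < q \<and> q \<le> Suc n} = (n choose 2) + n" .
    then show ?case by (simp add: numeral_2_eq_2)
  qed
  then show ?thesis by (simp add: choose_two)
qed

context dolbeault
begin

definition combination :: "nat \<Rightarrow> (nat \<Rightarrow> 'h ^ 's ^ 's \<Rightarrow> 'h ^ 's ^ 's) \<Rightarrow> (nat \<Rightarrow> 'a) \<Rightarrow> 'h ^ 's ^ 's \<Rightarrow> 'h ^ 's ^ 's" where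
  "combination r B x \<xi> = (\<Sum>i\<in>{1..r}. L (x i) (B i \<xi>))"

text \<open>A complex linear combination of forms is absorbed into their left coefficients.\<close>

lemma op_span_combinations:
  assumes sub: "S \<subseteq> combination r B ` ({1..r} \<rightarrow> A)"
    and gen: "\<And>i a. i \<in> {1..r} \<Longrightarrow> a \<in> A \<Longrightarrow> (\<lambda>\<xi>. L a (B i \<xi>)) \<in> S"
  shows "op_span S = combination r B ` ({1..r} \<rightarrow> A)"
proof (intro set_eqI iffI)
  fix V assume "V \<in> op_span S"
  then obtain N c T where V: "V = (\<lambda>\<xi>. \<Sum>k<(N::nat). c k *\<^sub>C T k \<xi>)" and T: "\<And>k. k < N \<Longrightarrow> T k \<in> S"
    unfolding op_span_def by blast
  have "\<forall>k\<in>{..<N}. \<exists>x. x \<in> {1..r} \<rightarrow> A \<and> T k = combination r B x" using T sub by blast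
  then obtain x where x: "\<And>k. k < N \<Longrightarrow> x k \<in> {1..r} \<rightarrow> A" "\<And>k. k < N \<Longrightarrow> T k = combination r B (x k)"
    unfolding bchoice_iff by auto
  define y where "y i = (\<Sum>k<N. c k *\<^sub>C x k i)" for i
  have xA: "c k *\<^sub>C x k i \<in> A" "x k i \<in> A" if "k < N" "i \<in> {1..r}" for k i
  proof -
    show "x k i \<in> A" using x(1)[OF that(1)] that(2) by blast
    then show "c k *\<^sub>C x k i \<in> A" by (rule scaleC_smooth)
  qed
  have "V \<xi> = combination r B y \<xi>" for \<xi>
  proof -
    have "V \<xi> = (\<Sum>k<N. \<Sum>i\<in>{1..r}. L (c k *\<^sub>C x k i) (B i \<xi>))"
      unfolding V
    proof (rule sum.cong[OF refl])
      fix k assume "k \<in> {..<N}"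
      then have k: "k < N" by simp
      show "c k *\<^sub>C T k \<xi> = (\<Sum>i\<in>{1..r}. L (c k *\<^sub>C x k i) (B i \<xi>))"
        unfolding x(2)[OF k] combination_def scaleC_sum_right
        by (rule sum.cong[OF refl]) (simp only: L_scaleC xA(2)[OF k])
    qed
    also have "\<dots> = (\<Sum>i\<in>{1..r}. \<Sum>k<N. L (c k *\<^sub>C x k i) (B i \<xi>))" by (rule sum.swap)
    also have "\<dots> = combination r B y \<xi>"
      unfolding combination_def y_def
      by (intro sum.cong refl L_sum[symmetric] xA) auto
    finally show ?thesis .
  qed
  moreover have "y \<in> {1..r} \<rightarrow> A" unfolding y_def by (intro Pi_I sum_smooth xA) auto
  ultimately show "V \<in> combination r B ` ({1..r} \<rightarrow> A)" by blast
next
  fix V assume "V \<in> combination r B ` ({1..r} \<rightarrow> A)"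
  then obtain x where x: "x \<in> {1..r} \<rightarrow> A" and V: "V = combination r B x" by blast
  have "V = (\<lambda>\<xi>. \<Sum>k<r. 1 *\<^sub>C L (x (Suc k)) (B (Suc k) \<xi>))"
    by (rule ext) (simp add: V combination_def sum.atLeast1_atMost_eq)
  moreover have "(\<lambda>\<xi>. L (x (Suc k)) (B (Suc k) \<xi>)) \<in> S" if "k < r" for k
  proof -
    have k: "Suc k \<in> {1..r}" using that by simp
    show ?thesis by (rule gen[OF k funcset_mem[OF x k]])
  qed
  ultimately show "V \<in> op_span S"
    unfolding op_span_def mem_Collect_eq
    by (intro exI[of _ r] exI[of _ "\<lambda>_. 1"] exI[of _ "\<lambda>k \<xi>. L (x (Suc k)) (B (Suc k) \<xi>)"]) auto
qed

text \<open>Independence makes the passage from coefficients to operators bijective, and since each \<open>B i\<close>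
  commutes with the algebra, multiplication from the right also acts on coefficients. The isomorphism is the
  inverse of this passage; its values on combinations are recorded for the product formula.\<close>

lemma bimod_iso_combinations:
  assumes commute: "\<And>i a \<xi>. i \<in> {1..r} \<Longrightarrow> a \<in> A \<Longrightarrow> L a (B i \<xi>) = B i (L a \<xi>)"
    and independent: "\<And>x y i. x \<in> {1..r} \<rightarrow> A \<Longrightarrow> y \<in> {1..r} \<rightarrow> A \<Longrightarrow>
      combination r B x = combination r B y \<Longrightarrow> i \<in> {1..r} \<Longrightarrow> x i = y i"
  shows "\<exists>\<phi>. bimod_iso A (op_bimod n U \<eta> (combination r B ` ({1..r} \<rightarrow> A))) (free_bimod A r) \<phi> \<and>
           (\<forall>x\<in>{1..r} \<rightarrow> A. \<forall>i\<in>{1..r}. \<phi> (combination r B x) i = x i)"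
proof -
  let ?R = "combination r B" and ?X = "{1..r} \<rightarrow>\<^sub>E A"
  have restrict: "?R (restrict x {1..r}) = ?R x" for x
    by (rule ext) (simp add: combination_def)
  have inj: "inj_on ?R ?X"
  proof (rule inj_onI)
    fix x y assume xy: "x \<in> ?X" "y \<in> ?X" "?R x = ?R y"
    show "x = y" by (rule PiE_ext[OF xy(1,2)]) (rule independent, use xy in auto)
  qed
  have img: "?R ` ?X = ?R ` ({1..r} \<rightarrow> A)"
  proof
    show "?R ` ?X \<subseteq> ?R ` ({1..r} \<rightarrow> A)" by (rule image_mono) auto
    show "?R ` ({1..r} \<rightarrow> A) \<subseteq> ?R ` ?X"
    proof (rule image_subsetI)
      fix x assume "x \<in> {1..r} \<rightarrow> A"
      then have "restrict x {1..r} \<in> ?X" by auto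
      then show "?R x \<in> ?R ` ?X" using restrict[of x] by (metis image_eqI)
    qed
  qed
  define \<phi> where "\<phi> = the_inv_into ?X ?R"
  have \<phi>: "\<phi> (?R x) = restrict x {1..r}" if "x \<in> {1..r} \<rightarrow> A" for x
    unfolding \<phi>_def restrict[of x, symmetric] by (rule the_inv_into_f_f[OF inj]) (use that in auto)
  have add: "(\<lambda>\<xi>. ?R x \<xi> + ?R y \<xi>) = ?R (\<lambda>i. x i + y i)" if "x \<in> {1..r} \<rightarrow> A" "y \<in> {1..r} \<rightarrow> A" for x y
    unfolding combination_def sum.distrib[symmetric]
    by (rule ext, rule sum.cong[OF refl], rule L_add[symmetric]) (use that in blast)+
  have left: "L a \<circ> ?R x = ?R (\<lambda>i. a * x i)" if "a \<in> A" "x \<in> {1..r} \<rightarrow> A" for a x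
    unfolding combination_def o_def clinear_sum[OF clinear_L[OF that(1)]]
    by (rule ext, rule sum.cong[OF refl], rule L_mult[symmetric]) (use that in blast)+
  have right: "?R x \<circ> L a = ?R (\<lambda>i. x i * a)" if "a \<in> A" "x \<in> {1..r} \<rightarrow> A" for a x
  proof
    fix \<xi>
    have "L (x i) (B i (L a \<xi>)) = L (x i * a) (B i \<xi>)" if "i \<in> {1..r}" for i
    proof -
      have "x i \<in> A" using that \<open>x \<in> {1..r} \<rightarrow> A\<close> by blast
      then show ?thesis using \<open>a \<in> A\<close> by (simp only: L_mult commute[OF that \<open>a \<in> A\<close>])
    qed
    then show "(?R x \<circ> L a) \<xi> = ?R (\<lambda>i. x i * a) \<xi>" by (simp add: combination_def)
  qed
  have mem_add: "(\<lambda>i. x i + y i) \<in> {1..r} \<rightarrow> A"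
    if "x \<in> {1..r} \<rightarrow> A" "y \<in> {1..r} \<rightarrow> A" for x y using that by auto
  have mem_mult: "(\<lambda>i. a * x i) \<in> {1..r} \<rightarrow> A" "(\<lambda>i. x i * a) \<in> {1..r} \<rightarrow> A"
    if "a \<in> A" "x \<in> {1..r} \<rightarrow> A" for x a using that by auto
  have "bimod_iso A (op_bimod n U \<eta> (?R ` ({1..r} \<rightarrow> A))) (free_bimod A r) \<phi>"
    unfolding bimod_iso_def
  proof (intro conjI)
    show "bimod_closed A (op_bimod n U \<eta> (?R ` ({1..r} \<rightarrow> A)))"
      unfolding bimod_closed_def op_bimod_def
      by (auto simp only: bimod.simps add left right intro!: imageI Pi_I add_smooth mult_smooth
          intro: funcset_mem)
    show "bimod_closed A (free_bimod A r)"
      unfolding bimod_closed_def free_bimod_def by auto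
    show "bij_betw \<phi> (elems (op_bimod n U \<eta> (?R ` ({1..r} \<rightarrow> A)))) (elems (free_bimod A r))"
      using bij_betw_the_inv_into[OF inj_on_imp_bij_betw[OF inj]]
      unfolding img \<phi>_def[symmetric] by (simp add: op_bimod_def free_bimod_def)
    show "\<forall>S\<in>elems (op_bimod n U \<eta> (?R ` ({1..r} \<rightarrow> A))). \<forall>T\<in>elems (op_bimod n U \<eta> (?R ` ({1..r} \<rightarrow> A))).
        \<phi> (madd (op_bimod n U \<eta> (?R ` ({1..r} \<rightarrow> A))) S T) = madd (free_bimod A r) (\<phi> S) (\<phi> T)"
      using mem_add by (auto simp: op_bimod_def free_bimod_def add \<phi> intro!: restrict_ext)
    show "\<forall>a\<in>A. \<forall>S\<in>elems (op_bimod n U \<eta> (?R ` ({1..r} \<rightarrow> A))).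
        \<phi> (lact (op_bimod n U \<eta> (?R ` ({1..r} \<rightarrow> A))) a S) = lact (free_bimod A r) a (\<phi> S) \<and>
        \<phi> (ract (op_bimod n U \<eta> (?R ` ({1..r} \<rightarrow> A))) S a) = ract (free_bimod A r) (\<phi> S) a"
      using mem_mult by (auto simp: op_bimod_def free_bimod_def left right \<phi> intro!: restrict_ext)
  qed
  moreover have "\<forall>x\<in>{1..r} \<rightarrow> A. \<forall>i\<in>{1..r}. \<phi> (?R x) i = x i" by (simp add: \<phi>)
  ultimately show ?thesis by blast
qed

lemma forms0_iso: "\<exists>\<phi>. bimod_iso A (op_bimod n U \<eta> (forms0 n U \<eta> :: ('h ^ 's ^ 's \<Rightarrow> _) set)) (regular_bimod A) \<phi>"
proof -
  have inj: "inj_on L A" by (rule inj_onI) (rule L_inject)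
  have "L a \<circ> L b = L (a * b)" "(\<lambda>\<xi>. L a \<xi> + L b \<xi>) = L (a + b)" if "a \<in> A" "b \<in> A" for a b
    using that by (auto simp: L_mult L_add)
  then have "bimod_iso A (op_bimod n U \<eta> (L ` A)) (regular_bimod A) (the_inv_into A L)"
    unfolding bimod_iso_def bimod_closed_def op_bimod_def regular_bimod_def
    using bij_betw_the_inv_into[OF inj_on_imp_bij_betw[OF inj]]
    by (auto simp: the_inv_into_f_f[OF inj] add_smooth mult_smooth)
  then show ?thesis unfolding forms0_def by blast
qed

lemma one_form_combination: "one_form = combination n G"
  by (intro ext) (simp add: one_form_def combination_def)

text \<open>A unitary eigenvector of \<open>\<delta> p\<close> that is annihilated by every other \<open>\<delta> q\<close>, so that its commutator
  with the Dolbeault operator isolates \<open>G p\<close>.\<close>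

definition u :: "nat \<Rightarrow> 'a" where "u p = U (2*p-1)"

lemma u_smooth: "p \<in> {1..n} \<Longrightarrow> u p \<in> A"
  unfolding u_def by (rule U_smooth[OF index(1)])

lemma star_u_u: "p \<in> {1..n} \<Longrightarrow> star (u p) * u p = 1"
  using unitary_U[OF index(1)] unfolding u_def is_unitary_def by blast

lemma delta_u:
  assumes "p \<in> {1..n}" "q \<in> {1..n}"
  shows "\<delta> q (u p) = (if q = p then (\<i>/2) *\<^sub>C u p else 0)"
proof -
  have "2*q-1 = 2*p-1 \<longleftrightarrow> q = p" "2*q \<noteq> 2*p-1" using assms by (auto, presburger)
  then show ?thesis
    unfolding \<delta>_def u_def deriv_U[OF index(1)[OF assms(1)] index(1)[OF assms(2)]]
      deriv_U[OF index(1)[OF assms(1)] index(2)[OF assms(2)]]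
    by (simp add: scaleC_scaleC)
qed

lemma commutator_u:
  assumes p: "p \<in> {1..n}"
  shows "commutator n U \<eta> dolb (u p) \<xi> = L ((\<i>/2) *\<^sub>C u p) (G p \<xi>)"
proof -
  have "commutator n U \<eta> dolb (u p) \<xi> = (\<Sum>q\<in>{1..n}. if q = p then L ((\<i>/2) *\<^sub>C u p) (G p \<xi>) else 0)"
    unfolding commutator_dolb[OF u_smooth[OF p]] one_form_def
    by (rule sum.cong[OF refl]) (simp add: delta_u[OF p] L_zero)
  then show ?thesis using p by simp
qed

lemma L_one_form:
  assumes "a \<in> A" "x \<in> {1..n} \<rightarrow> A"
  shows "L a \<circ> one_form x = one_form (\<lambda>p. a * x p)"
  unfolding one_form_def o_def clinear_sum[OF clinear_L[OF assms(1)]]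
  by (rule ext, rule sum.cong[OF refl], rule L_mult[symmetric]) (use assms in blast)+

lemma delta_Pi: "b \<in> A \<Longrightarrow> (\<lambda>p. \<delta> p b) \<in> {1..n} \<rightarrow> A"
  using delta_smooth by blast

text \<open>To obtain the coefficient \<open>a\<close> at \<open>G p\<close> alone, the eigenvector \<open>u p\<close> is differentiated and its
  value \<open>(\<i>/2) *\<^sub>C u p\<close> is cancelled by the factor \<open>(2/\<i>) *\<^sub>C star (u p)\<close> on the left.\<close>

lemma forms1_eq: "forms1 n U \<eta> dolb = one_form ` ({1..n} \<rightarrow> A)"
  unfolding forms1_def one_form_combination
proof (rule op_span_combinations)
  show "{L a \<circ> commutator n U \<eta> dolb b |a b. a \<in> A \<and> b \<in> A} \<subseteq> combination n G ` ({1..n} \<rightarrow> A)"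
  proof clarify
    fix a b assume "a \<in> A" "b \<in> A"
    then show "L a \<circ> commutator n U \<eta> dolb b \<in> combination n G ` ({1..n} \<rightarrow> A)"
      unfolding one_form_combination[symmetric] commutator_dolb[OF \<open>b \<in> A\<close>] L_one_form[OF \<open>a \<in> A\<close> delta_Pi[OF \<open>b \<in> A\<close>]]
      using delta_Pi[of b] by (intro imageI) auto
  qed
  fix p a assume p: "p \<in> {1..n}" and a: "a \<in> A"
  let ?a = "(2/\<i>) *\<^sub>C (a * star (u p))"
  have aA: "?a \<in> A" using a u_smooth[OF p] by (intro scaleC_smooth mult_smooth star_smooth)
  have "?a * ((\<i>/2) *\<^sub>C u p) = a"
    by (simp add: scaleC_mult_left scaleC_mult_right scaleC_scaleC mult.assoc star_u_u[OF p])
  then have "(\<lambda>\<xi>. L a (G p \<xi>)) = L ?a \<circ> commutator n U \<eta> dolb (u p)"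
    using L_mult[OF aA scaleC_smooth[OF u_smooth[OF p]], of "\<i>/2"]
    by (intro ext) (simp add: commutator_u[OF p] del: L_mult)
  then show "(\<lambda>\<xi>. L a (G p \<xi>)) \<in> {L a \<circ> commutator n U \<eta> dolb b |a b. a \<in> A \<and> b \<in> A}"
    using aA u_smooth[OF p] by blast
qed

lemma forms1_iso:
  "\<exists>\<phi>. bimod_iso A (op_bimod n U \<eta> (forms1 n U \<eta> dolb)) (free_bimod A n) \<phi> \<and>
     (\<forall>x\<in>{1..n} \<rightarrow> A. \<forall>p\<in>{1..n}. \<phi> (one_form x) p = x p)"
  unfolding forms1_eq unfolding one_form_combination
proof (rule bimod_iso_combinations)
  show "L a (G p \<xi>) = G p (L a \<xi>)" if "a \<in> A" for a p \<xi> by (rule L_G[OF that])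
  show "x p = y p" if "x \<in> {1..n} \<rightarrow> A" "y \<in> {1..n} \<rightarrow> A" "combination n G x = combination n G y" "p \<in> {1..n}"
    for x y p using that unfolding one_form_combination[symmetric] by (rule one_form_inject)
qed

text \<open>The products \<open>G p G q\<close>, numbered through an enumeration \<open>e\<close> of the pairs.\<close>

definition G2 :: "(nat \<times> nat \<Rightarrow> nat) \<Rightarrow> nat \<Rightarrow> 'h ^ 's ^ 's \<Rightarrow> 'h ^ 's ^ 's" where
  "G2 e i \<xi> = (case inv_into pairs e i of (p, q) \<Rightarrow> G p (G q \<xi>))"

lemma two_form_combination:
  assumes e: "bij_betw e pairs {1..r}"
  shows "combination r (G2 e) x = two_form (x \<circ> e)"
proof
  fix \<xi>
  have "combination r (G2 e) x \<xi> = (\<Sum>pq\<in>pairs. L (x (e pq)) (G2 e (e pq) \<xi>))"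
    unfolding combination_def by (rule sum.reindex_bij_betw[OF e, symmetric])
  also have "\<dots> = two_form (x \<circ> e) \<xi>"
    unfolding two_form_def G2_def using bij_betw_imp_inj_on[OF e]
    by (intro sum.cong refl) auto
  finally show "combination r (G2 e) x \<xi> = two_form (x \<circ> e) \<xi>" .
qed

lemma two_form_as_combination:
  assumes e: "bij_betw e pairs {1..r}"
  shows "two_form z = combination r (G2 e) (z \<circ> inv_into pairs e)"
  unfolding two_form_combination[OF e] two_form_def
  by (intro ext sum.cong refl) (auto simp: inv_into_f_f[OF bij_betw_imp_inj_on[OF e]])

lemma two_form_image:
  assumes e: "bij_betw e pairs {1..r}"
  shows "combination r (G2 e) ` ({1..r} \<rightarrow> A) = two_form ` (pairs \<rightarrow> A)"
proof (intro equalityI image_subsetI)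
  fix x assume "x \<in> {1..r} \<rightarrow> A"
  then have "x \<circ> e \<in> pairs \<rightarrow> A" using bij_betwE[OF e] by auto
  then show "combination r (G2 e) x \<in> two_form ` (pairs \<rightarrow> A)"
    unfolding two_form_combination[OF e] by (rule imageI)
next
  fix z assume "z \<in> pairs \<rightarrow> A"
  then have "z \<circ> inv_into pairs e \<in> {1..r} \<rightarrow> A"
    using bij_betwE[OF bij_betw_inv_into[OF e]] by auto
  then show "two_form z \<in> combination r (G2 e) ` ({1..r} \<rightarrow> A)"
    unfolding two_form_as_combination[OF e] by (rule imageI)
qed

lemma G2_mem:
  assumes e: "bij_betw e pairs {1..r}" and i: "i \<in> {1..r}"
  obtains p q where "(p, q) \<in> pairs" "e (p, q) = i" "\<And>\<xi>. G2 e i \<xi> = G p (G q \<xi>)"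
proof -
  obtain p q where pq: "inv_into pairs e i = (p, q)" by (cases "inv_into pairs e i")
  then have "(p, q) \<in> pairs" "e (p, q) = i"
    using bij_betwE[OF bij_betw_inv_into[OF e]] i bij_betw_inv_into_right[OF e i] by metis+
  then show ?thesis using that pq by (simp add: G2_def)
qed

text \<open>Generators are products of one-forms, hence two-forms. Conversely \<open>u p\<close> and \<open>u q\<close> isolate
  \<open>G p G q\<close>; the constant \<open>- 4\<close> inverts \<open>(\<i>/2)\<^sup>2\<close>, and the adjoints are taken in reverse order.\<close>

lemma forms2_eq:
  assumes e: "bij_betw e pairs {1..r}"
  shows "forms2 n U \<eta> dolb = combination r (G2 e) ` ({1..r} \<rightarrow> A)"
  unfolding forms2_def
proof (rule op_span_combinations)
  show "{L a \<circ> commutator n U \<eta> dolb b \<circ> commutator n U \<eta> dolb c |a b c. a \<in> A \<and> b \<in> A \<and> c \<in> A}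
      \<subseteq> combination r (G2 e) ` ({1..r} \<rightarrow> A)"
  proof clarify
    fix a b c assume a: "a \<in> A" and b: "b \<in> A" and c: "c \<in> A"
    have ab: "(\<lambda>p. a * \<delta> p b) \<in> {1..n} \<rightarrow> A" using a delta_Pi[OF b] by auto
    have "L a \<circ> commutator n U \<eta> dolb b \<circ> commutator n U \<eta> dolb c
        = two_form (\<lambda>(p, q). a * \<delta> p b * \<delta> q c - a * \<delta> q b * \<delta> p c)"
      unfolding commutator_dolb[OF b] commutator_dolb[OF c] L_one_form[OF a delta_Pi[OF b]]
      by (rule one_form_mult[OF ab delta_Pi[OF c]])
    moreover have "(\<lambda>(p, q). a * \<delta> p b * \<delta> q c - a * \<delta> q b * \<delta> p c) \<in> pairs \<rightarrow> A"
      using a b c by (auto dest!: pairsD intro!: diff_smooth mult_smooth delta_smooth)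
    ultimately show "L a \<circ> commutator n U \<eta> dolb b \<circ> commutator n U \<eta> dolb c
        \<in> combination r (G2 e) ` ({1..r} \<rightarrow> A)"
      unfolding two_form_image[OF e] by blast
  qed
  fix i a assume i: "i \<in> {1..r}" and a: "a \<in> A"
  obtain p q where pq: "(p, q) \<in> pairs" and G2: "\<And>\<xi>. G2 e i \<xi> = G p (G q \<xi>)"
    using G2_mem[OF e i] by metis
  have p: "p \<in> {1..n}" and q: "q \<in> {1..n}" using pairsD[OF pq] by auto
  let ?a = "(- 4) *\<^sub>C (a * (star (u q) * star (u p)))"
  let ?p = "(\<i>/2) *\<^sub>C u p" and ?q = "(\<i>/2) *\<^sub>C u q"
  have aA: "?a \<in> A" and pA: "?p \<in> A" and qA: "?q \<in> A"
    by (intro scaleC_smooth mult_smooth star_smooth a u_smooth p q)+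
  have "star (u q) * (star (u p) * (u p * u q)) = star (u q) * (star (u p) * u p) * u q"
    by (simp only: mult.assoc)
  also have "\<dots> = 1" by (simp add: star_u_u[OF p] star_u_u[OF q])
  finally have "?a * ?p * ?q = a"
    by (simp add: scaleC_mult_left scaleC_mult_right scaleC_scaleC mult.assoc)
  then have "L a (G2 e i \<xi>) = L ?a (L ?p (L ?q (G p (G q \<xi>))))" for \<xi>
    unfolding G2 L_mult[OF aA pA, symmetric] L_mult[OF mult_smooth[OF aA pA] qA, symmetric] by simp
  then have "(\<lambda>\<xi>. L a (G2 e i \<xi>)) = L ?a \<circ> commutator n U \<eta> dolb (u p) \<circ> commutator n U \<eta> dolb (u q)"
    by (intro ext) (simp add: commutator_u[OF p] commutator_u[OF q] L_G[OF qA])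
  then show "(\<lambda>\<xi>. L a (G2 e i \<xi>)) \<in>
      {L a \<circ> commutator n U \<eta> dolb b \<circ> commutator n U \<eta> dolb c |a b c. a \<in> A \<and> b \<in> A \<and> c \<in> A}"
    using aA u_smooth[OF p] u_smooth[OF q] by blast
qed

lemma forms2_iso:
  assumes e: "bij_betw e pairs {1..r}"
  shows "\<exists>\<psi>. bimod_iso A (op_bimod n U \<eta> (forms2 n U \<eta> dolb)) (free_bimod A r) \<psi> \<and>
     (\<forall>z\<in>pairs \<rightarrow> A. two_form z \<in> forms2 n U \<eta> dolb \<and> (\<forall>pq\<in>pairs. \<psi> (two_form z) (e pq) = z pq))"
proof -
  have "\<exists>\<psi>. bimod_iso A (op_bimod n U \<eta> (combination r (G2 e) ` ({1..r} \<rightarrow> A))) (free_bimod A r) \<psi> \<and>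
      (\<forall>x\<in>{1..r} \<rightarrow> A. \<forall>i\<in>{1..r}. \<psi> (combination r (G2 e) x) i = x i)"
  proof (rule bimod_iso_combinations)
    fix i a \<xi> assume i: "i \<in> {1..r}" and a: "a \<in> A"
    obtain p q where G2: "\<And>\<xi>. G2 e i \<xi> = G p (G q \<xi>)" using G2_mem[OF e i] by metis
    show "L a (G2 e i \<xi>) = G2 e i (L a \<xi>)" by (simp add: G2 L_G[OF a])
  next
    fix x y i assume x: "x \<in> {1..r} \<rightarrow> A" and y: "y \<in> {1..r} \<rightarrow> A"
      and eq: "combination r (G2 e) x = combination r (G2 e) y" and i: "i \<in> {1..r}"
    obtain p q where pq: "(p, q) \<in> pairs" "e (p, q) = i" using G2_mem[OF e i] by metis
    have "(x \<circ> e) (p, q) = (y \<circ> e) (p, q)"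
      by (rule two_form_inject[OF _ _ eq[unfolded two_form_combination[OF e]] pq(1)])
         (use x y bij_betwE[OF e] in auto)
    then show "x i = y i" using pq by simp
  qed
  then obtain \<psi> where iso: "bimod_iso A (op_bimod n U \<eta> (forms2 n U \<eta> dolb)) (free_bimod A r) \<psi>"
    and \<psi>: "\<And>x i. x \<in> {1..r} \<rightarrow> A \<Longrightarrow> i \<in> {1..r} \<Longrightarrow> \<psi> (combination r (G2 e) x) i = x i"
    unfolding forms2_eq[OF e] by blast
  have "two_form z \<in> forms2 n U \<eta> dolb" "\<psi> (two_form z) (e pq) = z pq" if z: "z \<in> pairs \<rightarrow> A" and pq: "pq \<in> pairs" for z pq
  proof -
    show "two_form z \<in> forms2 n U \<eta> dolb" unfolding forms2_eq[OF e] two_form_image[OF e] using z by blast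
    have "z \<circ> inv_into pairs e \<in> {1..r} \<rightarrow> A" using z bij_betwE[OF bij_betw_inv_into[OF e]] by auto
    from \<psi>[OF this, of "e pq"] show "\<psi> (two_form z) (e pq) = z pq"
      using bij_betwE[OF e] pq inv_into_f_f[OF bij_betw_imp_inj_on[OF e] pq]
      by (simp add: two_form_as_combination[OF e])
  qed
  moreover have "two_form z \<in> forms2 n U \<eta> dolb" if "z \<in> pairs \<rightarrow> A" for z
    unfolding forms2_eq[OF e] two_form_image[OF e] using that by blast
  ultimately show ?thesis using iso by blast
qed

lemma pairs_enumeration: "\<exists>e. bij_betw e pairs {1..n * (n - 1) div 2}"
  using card_ordered_pairs[of n] finite_same_card_bij[OF finite_pairs, of "{1..n * (n - 1) div 2}"]
  by (simp add: pairs_def)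

lemma dolbeault_forms:
  "\<exists>\<phi> \<psi> e.
      bimod_iso A (op_bimod n U \<eta> (forms1 n U \<eta> dolb)) (free_bimod A n) \<phi> \<and>
      bimod_iso A (op_bimod n U \<eta> (forms2 n U \<eta> dolb)) (free_bimod A (n * (n - 1) div 2)) \<psi> \<and>
      bij_betw e {(p, q). 1 \<le> p \<and> p < q \<and> q \<le> n} {1..n * (n - 1) div 2} \<and>
      (\<forall>S\<in>forms1 n U \<eta> dolb. \<forall>T\<in>forms1 n U \<eta> dolb. S \<circ> T \<in> forms2 n U \<eta> dolb \<and>
        (\<forall>p q. 1 \<le> p \<and> p < q \<and> q \<le> n \<longrightarrow>
          \<psi> (S \<circ> T) (e (p, q)) = \<phi> S p * \<phi> T q - \<phi> S q * \<phi> T p))"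
proof -
  obtain e where e: "bij_betw e pairs {1..n * (n - 1) div 2}" using pairs_enumeration by blast
  obtain \<phi> where \<phi>: "bimod_iso A (op_bimod n U \<eta> (forms1 n U \<eta> dolb)) (free_bimod A n) \<phi>"
    "\<And>x p. x \<in> {1..n} \<rightarrow> A \<Longrightarrow> p \<in> {1..n} \<Longrightarrow> \<phi> (one_form x) p = x p"
    using forms1_iso by blast
  obtain \<psi> where \<psi>: "bimod_iso A (op_bimod n U \<eta> (forms2 n U \<eta> dolb)) (free_bimod A (n * (n - 1) div 2)) \<psi>"
    "\<And>z. z \<in> pairs \<rightarrow> A \<Longrightarrow> two_form z \<in> forms2 n U \<eta> dolb"
    "\<And>z pq. z \<in> pairs \<rightarrow> A \<Longrightarrow> pq \<in> pairs \<Longrightarrow> \<psi> (two_form z) (e pq) = z pq"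
    using forms2_iso[OF e] by blast
  have "S \<circ> T \<in> forms2 n U \<eta> dolb \<and> (\<forall>p q. 1 \<le> p \<and> p < q \<and> q \<le> n \<longrightarrow>
          \<psi> (S \<circ> T) (e (p, q)) = \<phi> S p * \<phi> T q - \<phi> S q * \<phi> T p)"
    if ST: "S \<in> forms1 n U \<eta> dolb" "T \<in> forms1 n U \<eta> dolb" for S T
  proof -
    obtain x y where x: "x \<in> {1..n} \<rightarrow> A" "S = one_form x" and y: "y \<in> {1..n} \<rightarrow> A" "T = one_form y"
      using ST unfolding forms1_eq by blast
    let ?z = "\<lambda>(p, q). x p * y q - x q * y p"
    have ST_eq: "S \<circ> T = two_form ?z" unfolding x(2) y(2) by (rule one_form_mult[OF x(1) y(1)])
    have z: "?z \<in> pairs \<rightarrow> A"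
      using x(1) y(1) by (auto dest!: pairsD intro!: diff_smooth mult_smooth)
    show ?thesis
    proof (intro conjI allI impI)
      show "S \<circ> T \<in> forms2 n U \<eta> dolb" unfolding ST_eq by (rule \<psi>(2)[OF z])
      fix p q assume "1 \<le> p \<and> p < q \<and> q \<le> n"
      then have pq: "(p, q) \<in> pairs" by (simp add: pairs_def)
      then have p: "p \<in> {1..n}" and q: "q \<in> {1..n}" using pairsD by auto
      show "\<psi> (S \<circ> T) (e (p, q)) = \<phi> S p * \<phi> T q - \<phi> S q * \<phi> T p"
        unfolding ST_eq \<psi>(3)[OF z pq] unfolding x(2) y(2)
        by (simp only: prod.case \<phi>(2)[OF x(1) p] \<phi>(2)[OF x(1) q] \<phi>(2)[OF y(1) p] \<phi>(2)[OF y(1) q])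
    qed
  qed
  then show ?thesis using \<phi>(1) \<psi>(1) e unfolding pairs_def by blast
qed

end


section \<open>The bimodules of forms on the noncommutative torus\<close>

theorem lemma4p12:
  fixes n :: nat
    and \<Theta> :: "nat \<Rightarrow> nat \<Rightarrow> real"
    and U :: "nat \<Rightarrow> 'a::cstar_algebra"
    and \<eta> :: "'a \<Rightarrow> 'h::complex_hilbert"
    and \<gamma> :: "nat \<Rightarrow> complex ^ 's ^ 's::finite"
    and \<sigma> :: "complex ^ 's ^ 's"
    and \<epsilon> :: real
  defines "A \<equiv> smooth_torus n U"
    and "\<Omega>\<^sub>0\<^sub>0 \<equiv> (forms0 n U \<eta> :: ('h ^ 's ^ 's \<Rightarrow> 'h ^ 's ^ 's) set)"
    and "\<Omega>\<^sub>1\<^sub>0 \<equiv> forms1 n U \<eta> (del_op n U \<eta> \<gamma> \<sigma> \<epsilon>)"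
    and "\<Omega>\<^sub>0\<^sub>1 \<equiv> forms1 n U \<eta> (delbar_op n U \<eta> \<gamma> \<sigma> \<epsilon>)"
    and "\<Omega>\<^sub>2\<^sub>0 \<equiv> forms2 n U \<eta> (del_op n U \<eta> \<gamma> \<sigma> \<epsilon>)"
    and "\<Omega>\<^sub>0\<^sub>2 \<equiv> forms2 n U \<eta> (delbar_op n U \<eta> \<gamma> \<sigma> \<epsilon>)"
  assumes "n > 1"
    and "skew_symmetric n \<Theta>"
    and "dense_lattice n \<Theta>"
    and "universal_torus TYPE('b::cstar_algebra) n \<Theta> U"
    and "is_L2 n U \<eta>"
    and "clifford_rep n \<gamma> \<sigma>"
    and "\<epsilon> \<in> {1, -1}"
  shows "(\<exists>\<phi>. bimod_iso A (op_bimod n U \<eta> \<Omega>\<^sub>0\<^sub>0) (regular_bimod A) \<phi>) \<and>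
    (\<exists>\<phi>. bimod_iso A (op_bimod n U \<eta> \<Omega>\<^sub>1\<^sub>0) (free_bimod A n) \<phi>) \<and>
    (\<exists>\<phi>. bimod_iso A (op_bimod n U \<eta> \<Omega>\<^sub>2\<^sub>0) (free_bimod A (n * (n - 1) div 2)) \<phi>) \<and>
    (\<exists>\<phi> \<psi> e.
      bimod_iso A (op_bimod n U \<eta> \<Omega>\<^sub>0\<^sub>1) (free_bimod A n) \<phi> \<and>
      bimod_iso A (op_bimod n U \<eta> \<Omega>\<^sub>0\<^sub>2) (free_bimod A (n * (n - 1) div 2)) \<psi> \<and>
      bij_betw e {(p, q). 1 \<le> p \<and> p < q \<and> q \<le> n} {1..n * (n - 1) div 2} \<and>
      (\<forall>S\<in>\<Omega>\<^sub>0\<^sub>1. \<forall>T\<in>\<Omega>\<^sub>0\<^sub>1. S \<circ> T \<in> \<Omega>\<^sub>0\<^sub>2 \<and>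
        (\<forall>p q. 1 \<le> p \<and> p < q \<and> q \<le> n \<longrightarrow>
          \<psi> (S \<circ> T) (e (p, q)) = \<phi> S p * \<phi> T q - \<phi> S q * \<phi> T p)))"
proof -
  have "torus_relations n \<Theta> U" using assms unfolding universal_torus_def by blast
  then have dolb: "dolbeault n \<Theta> U \<eta> \<gamma> \<sigma> \<epsilon> s" if "s * s = 1" for s
    using assms that by unfold_locales auto
  interpret hol: dolbeault n \<Theta> U \<eta> \<gamma> \<sigma> \<epsilon> "- 1" by (rule dolb) simp
  interpret anti: dolbeault n \<Theta> U \<eta> \<gamma> \<sigma> \<epsilon> 1 by (rule dolb) simp
  have del: "del_op n U \<eta> \<gamma> \<sigma> \<epsilon> = hol.dolb"
    by (rule ext) (simp add: del_op_def hol.dolb_def)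
  have delbar: "delbar_op n U \<eta> \<gamma> \<sigma> \<epsilon> = anti.dolb"
    by (rule ext) (simp add: delbar_op_def anti.dolb_def)
  show ?thesis
    unfolding A_def \<Omega>\<^sub>0\<^sub>0_def \<Omega>\<^sub>1\<^sub>0_def \<Omega>\<^sub>0\<^sub>1_def \<Omega>\<^sub>2\<^sub>0_def \<Omega>\<^sub>0\<^sub>2_def del delbar
  proof (intro conjI)
    show "\<exists>\<phi>. bimod_iso (smooth_torus n U) (op_bimod n U \<eta> (forms0 n U \<eta> :: ('h ^ 's ^ 's \<Rightarrow> _) set))
        (regular_bimod (smooth_torus n U)) \<phi>"
      by (rule hol.forms0_iso)
    show "\<exists>\<phi>. bimod_iso (smooth_torus n U) (op_bimod n U \<eta> (forms1 n U \<eta> hol.dolb))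
        (free_bimod (smooth_torus n U) n) \<phi>"
      using hol.forms1_iso by blast
    show "\<exists>\<phi>. bimod_iso (smooth_torus n U) (op_bimod n U \<eta> (forms2 n U \<eta> hol.dolb))
        (free_bimod (smooth_torus n U) (n * (n - 1) div 2)) \<phi>"
      using hol.dolbeault_forms by blast
  qed (rule anti.dolbeault_forms)
qed

end
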